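(* There exist universal positive constants $c_{\mathrm{dim}},c_{\mathrm{prob}},c_{\mathrm{err}}$ and an integer $d_0\in\mathbb N$ such that the following holds. For every integer $d\ge d_0$, every integer $k$ with $1\le k\le c_{\mathrm{dim}}d$, every integer $T\geq 1$ with $$T\le c_{\mathrm{prob}}\frac{dk}{\log(ek)},$$ and every deterministic algorithm $\mathsf d\in\mathcal A_{\mathrm{det}}^{(T)}$, $$\mathbb P_\Xi\left(\operatorname{err}_T(\mathsf d,f_\Xi)>\frac{c_{\mathrm{err}}}{\sqrt k}\right)\ge\frac34 .$$
   Context: $B_2^d=\{\mathbf x\in\mathbb R^d:\|\mathbf x\|_2\le1\}$; $\log$ is the natural logarithm and $e$ its base. Deterministic algorithms. For $T\in\mathbb N=\{1,2,\dots\}$, an element $\mathsf d\in\mathcal A_{\mathrm{det}}^{(T)}$ is a tuple $(\mathbf x_1,\pi_2,\dots,\pi_T,\pi_{\mathrm{out}})$ with $\mathbf x_1\in B_2^d$ and Borel maps $\pi_t:\mathbb R^{t-1}\to B_2^d$ ($t=2,\dots,T$), $\pi_{\mathrm{out}}:\mathbb R^T\to B_2^d$. Run on $f:B_2^d\to\mathbb R$, it queries $\mathbf x_1$, then $\mathbf x_t=\pi_t(f(\mathbf x_1),\dots,f(\mathbf x_{t-1}))$, and outputs $\widehat{\mathbf x}_T(\mathsf d,f)=\pi_{\mathrm{out}}(f(\mathbf x_1),\dots,f(\mathbf x_T))$. Its error is $\operatorname{err}_T(\mathsf d,f)=f(\widehat{\mathbf x}_T(\mathsf d,f))-\min_{B_2^d}f$.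 Hard distribution. $\gamma_d^{\mathrm{tr}}$ is the law of a standard Gaussian vector $\mathbf g\sim N(\mathbf 0,\mathbf I_d)$ conditioned on $\|\mathbf g\|_2\le2\sqrt d$. The seed is $\Xi=(\breve{\mathbf b}_1,\dots,\breve{\mathbf b}_k)$ with $\breve{\mathbf b}_i$ i.i.d. $\sim\gamma_d^{\mathrm{tr}}$ and law $\mathbb P_\Xi$; $\breve{\mathbf a}_i=\breve{\mathbf b}_i/\sqrt d$; and $$f_\Xi(\mathbf x)=\max_{1\le i\le k}\langle\breve{\mathbf a}_i,\mathbf x\rangle,\qquad\mathbf x\in B_2^d.$$ *)

theory Defs
  imports "HOL-Probability.Probability"
begin

text \<open>
  The dimension \<open>d\<close> is quantified inside the statement, after the constants, so it cannot be a type.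
  A vector of \<open>\<real>\<^sup>n\<close> is an extensional function on \<open>{1..n}\<close>, that is, a point of the product
  measurable space below, whose sigma-algebra is the Borel one.
\<close>

type_synonym vec = "nat \<Rightarrow> real"

abbreviation borel_vec :: "nat \<Rightarrow> vec measure" where
  "borel_vec n \<equiv> PiM {1..n} (\<lambda>_. borel)"

definition unit_ball :: "nat \<Rightarrow> vec set" where
  "unit_ball d = {x \<in> {1..d} \<rightarrow>\<^sub>E UNIV. L2_set x {1..d} \<le> 1}"

text \<open>
  \<open>next_query A t\<close> is \<open>\<pi>\<^sub>t\<close>; only its values for \<open>t\<close> in \<open>{2..T}\<close> are constrained or used
  in a run of length \<open>T\<close>.
\<close>

record algorithm =
  first_query :: vec
  next_query :: "nat \<Rightarrow> vec \<Rightarrow> vec"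
  final_output :: "vec \<Rightarrow> vec"

definition det_algorithms :: "nat \<Rightarrow> nat \<Rightarrow> algorithm set" where
  "det_algorithms d T = {A.
     first_query A \<in> unit_ball d \<and>
     (\<forall>t\<in>{2..T}. next_query A t \<in> borel_vec (t - 1) \<rightarrow>\<^sub>M restrict_space (borel_vec d) (unit_ball d)) \<and>
     final_output A \<in> borel_vec T \<rightarrow>\<^sub>M restrict_space (borel_vec d) (unit_ball d)}"

definition query :: "algorithm \<Rightarrow> nat \<Rightarrow> vec \<Rightarrow> vec" where
  "query A t y = (if t = 1 then first_query A else next_query A t y)"

text \<open>\<open>answers A f t\<close> is the vector \<open>(f x\<^sub>1, \<dots>, f x\<^sub>t)\<close> of the first \<open>t\<close> oracle answers.\<close>

primrec answers :: "algorithm \<Rightarrow> (vec \<Rightarrow> real) \<Rightarrow> nat \<Rightarrow> vec" where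
  "answers A f 0 = (\<lambda>_. undefined)"
| "answers A f (Suc t) = (answers A f t)(Suc t := f (query A (Suc t) (answers A f t)))"

definition output_point :: "nat \<Rightarrow> algorithm \<Rightarrow> (vec \<Rightarrow> real) \<Rightarrow> vec" where
  "output_point T A f = final_output A (answers A f T)"

text \<open>
  The infimum is the minimum for every \<open>f\<close> continuous on the (compact) ball, in particular for
  the functions \<open>hard_function\<close> below.
\<close>

definition err :: "nat \<Rightarrow> nat \<Rightarrow> algorithm \<Rightarrow> (vec \<Rightarrow> real) \<Rightarrow> real" where
  "err d T A f = f (output_point T A f) - (INF x\<in>unit_ball d. f x)"

definition std_gaussian :: "nat \<Rightarrow> vec measure" where
  "std_gaussian d = PiM {1..d} (\<lambda>_. std_normal_distribution)"

text \<open>\<open>uniform_measure M S\<close> is the measure \<open>M\<close> conditioned on the event \<open>S\<close>.\<close>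

definition truncated_gaussian :: "nat \<Rightarrow> vec measure" where
  "truncated_gaussian d =
     uniform_measure (std_gaussian d) {g \<in> space (std_gaussian d). L2_set g {1..d} \<le> 2 * sqrt (real d)}"

text \<open>A seed \<open>\<Xi>\<close> maps \<open>i \<in> {1..k}\<close> to the vector \<open>b\<^sub>i\<close>; the product measure makes the \<open>b\<^sub>i\<close> i.i.d.\<close>

definition seed_law :: "nat \<Rightarrow> nat \<Rightarrow> (nat \<Rightarrow> vec) measure" where
  "seed_law d k = PiM {1..k} (\<lambda>_. truncated_gaussian d)"

definition hard_function :: "nat \<Rightarrow> nat \<Rightarrow> (nat \<Rightarrow> vec) \<Rightarrow> vec \<Rightarrow> real" where
  "hard_function d k \<Xi> x = (MAX i\<in>{1..k}. \<Sum>j=1..d. (\<Xi> i j / sqrt (real d)) * x j)"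

end

theory Submission
  imports Defs
begin

text \<open>
  Up to the factor \<open>1 / sqrt d\<close>, the oracle answers a query \<open>x\<close> by the largest of the numbers
  \<open>\<langle>b i, x\<rangle>\<close>. Suppose first that answers are rounded to finitely many values, and add to each
  answer the first index \<open>i\<close> that attains the maximum. A transcript then confines every \<open>b i\<close> to a
  set of its own, so the \<open>b i\<close> remain independent given the transcript, and their conditional means
  \<open>\<beta> i\<close> satisfy \<open>E \<langle>\<beta> i, \<beta> j\<rangle> = E \<langle>b i, b j\<rangle> = 0\<close> for \<open>i \<noteq> j\<close>. Hence
  \<open>E (norm (\<Sum>i. \<beta> i))\<^sup>2 = (\<Sum>i. E (norm (\<beta> i))\<^sup>2)\<close>. For a fixed sequence of indices the transcript
  consists of \<open>T\<close> adaptive linear measurements of a Gaussian vector, and there are \<open>k ^ T\<close> such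
  sequences; Jensen's inequality for \<open>exp\<close> therefore bounds the right-hand side by a multiple of
  \<open>k + T * ln (e * k)\<close>, which is small compared to \<open>d * k\<close>. On the other hand, an output \<open>x\<close> in the
  unit ball with all \<open>\<langle>b i, x\<rangle> \<le> - c * sqrt (d / k)\<close> forces \<open>norm (\<Sum>i. \<beta> i) \<ge> c * sqrt (d * k)\<close>.
  Exact answers are reached by making the queries, one after the other, limits of continuous
  functions of the previous answers. Finally the minimum of the hard function is at most
  \<open>- 1 / (12 * sqrt k)\<close> with high probability, since otherwise the perceptron algorithm would find
  \<open>24 * k\<close> of the vectors, with multiplicity, whose sum is too short.
\<close>

section \<open>Gaussian shifts\<close>

text \<open>Rounding is there so that conditioning only ever means dividing by the probability of
  one of finitely many cells. The number of rounded values must then not enter the estimate, since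
  the rounding is refined without bound afterwards: for a fixed index the sets belonging to
  different answers are disjoint, so their exponential moments add up at no cost, and each query
  costs only a factor \<open>sqrt 2\<close> for the new direction and \<open>k\<close> for the
  choice of the index. The independence argument needs the full cell, which constrains all
  \<open>k\<close> vectors at every query; the moment bound needs few directions and uses the larger
  set on which only the vector with the listed index is constrained. The output is treated as one
  more query, so that its value is part of the transcript. Continuous approximations of the queries
  may leave the unit ball; the success event therefore allows squared norms below 4, and both its
  conditions are strict so that they survive limits. Truncation costs a factor \<open>4 / 3\<close>
  per vector and provides the norm bound that the perceptron uses.\<close>

definition inner_vec :: "nat \<Rightarrow> vec \<Rightarrow> vec \<Rightarrow> real" where
  "inner_vec d x y = (\<Sum>j=1..d. x j * y j)"

definition inner_seed :: "nat \<Rightarrow> nat \<Rightarrow> (nat \<Rightarrow> vec) \<Rightarrow> (nat \<Rightarrow> vec) \<Rightarrow> real" where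
  "inner_seed d k b w = (\<Sum>i=1..k. inner_vec d (b i) (w i))"

definition gaussian_seed :: "nat \<Rightarrow> nat \<Rightarrow> (nat \<Rightarrow> vec) measure" where
  "gaussian_seed d k = PiM {1..k} (\<lambda>_. std_gaussian d)"

lemma prob_space_std_normal: "prob_space std_normal_distribution"
  by (rule prob_space_normal_density) simp

lemma prob_space_std_gaussian: "prob_space (std_gaussian d)"
  unfolding std_gaussian_def by (intro prob_space_PiM prob_space_std_normal)

lemma sets_std_gaussian [measurable_cong]: "sets (std_gaussian d) = sets (borel_vec d)"
  unfolding std_gaussian_def by (intro sets_PiM_cong) auto

lemma space_std_gaussian: "space (std_gaussian d) = {1..d} \<rightarrow>\<^sub>E UNIV"
  unfolding std_gaussian_def by (simp add: space_PiM)

lemma prob_space_gaussian_seed: "prob_space (gaussian_seed d k)"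
  unfolding gaussian_seed_def by (intro prob_space_PiM prob_space_std_gaussian)

lemma sets_gaussian_seed [measurable_cong]:
  "sets (gaussian_seed d k) = sets (PiM {1..k} (\<lambda>_. borel_vec d))"
  unfolding gaussian_seed_def by (intro sets_PiM_cong sets_std_gaussian refl)

lemma density_PiM:
  fixes M :: "'i \<Rightarrow> 'a measure"
  assumes "finite I" and M: "\<And>i. prob_space (M i)"
    and l [measurable]: "\<And>i. l i \<in> borel_measurable (M i)"
    and D: "\<And>i. prob_space (density (M i) (l i))"
  shows "density (PiM I M) (\<lambda>x. \<Prod>i\<in>I. l i (x i)) = PiM I (\<lambda>i. density (M i) (l i))"
    (is "?L = ?R")
proof -
  interpret M: product_prob_space M I
    by (intro product_prob_spaceI M)
  interpret D: product_prob_space "\<lambda>i. density (M i) (l i)" I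
    by (intro product_prob_spaceI D)
  show ?thesis
  proof (rule D.PiM_eqI)
    show "sets ?L = sets ?R"
      by (simp cong: sets_PiM_cong)
    fix A assume A: "\<And>i. i \<in> I \<Longrightarrow> A i \<in> sets (density (M i) (l i))"
    have [measurable]: "Pi\<^sub>E I A \<in> sets (PiM I M)"
      using A assms(1) by auto
    have "emeasure ?L (Pi\<^sub>E I A) = (\<integral>\<^sup>+x. (\<Prod>i\<in>I. l i (x i)) * indicator (Pi\<^sub>E I A) x \<partial>PiM I M)"
      by (subst emeasure_density) auto
    also have "\<dots> = (\<integral>\<^sup>+x. (\<Prod>i\<in>I. l i (x i) * indicator (A i) (x i)) \<partial>PiM I M)"
    proof (rule nn_integral_cong)
      fix x assume "x \<in> space (PiM I M)"
      then have "indicator (Pi\<^sub>E I A) x = (\<Prod>i\<in>I. indicator (A i) (x i) :: ennreal)"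
        using assms(1) by (auto simp: space_PiM PiE_iff indicator_def prod_zero_iff)
      then show "(\<Prod>i\<in>I. l i (x i)) * indicator (Pi\<^sub>E I A) x = (\<Prod>i\<in>I. l i (x i) * indicator (A i) (x i))"
        by (simp add: prod.distrib)
    qed
    also have "\<dots> = (\<Prod>i\<in>I. \<integral>\<^sup>+x. l i x * indicator (A i) x \<partial>M i)"
      using A by (intro M.product_nn_integral_prod assms(1)) auto
    also have "\<dots> = (\<Prod>i\<in>I. emeasure (density (M i) (l i)) (A i))"
      using A by (intro prod.cong refl) (auto simp: emeasure_density)
    finally show "emeasure ?L (Pi\<^sub>E I A) = (\<Prod>i\<in>I. emeasure (density (M i) (l i)) (A i))" .
  qed (use assms in auto)
qed

text \<open>Both sides are product measures with the same factors. The lemma lifts the shift from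
  numbers to vectors and from vectors to seeds, and also the reflection that centres the truncated
  Gaussian.\<close>

lemma density_PiM_eq_distr_PiM:
  fixes M :: "'i \<Rightarrow> 'a measure"
  assumes "finite I" and M: "\<And>i. prob_space (M i)"
    and T [measurable]: "\<And>i. T i \<in> M i \<rightarrow>\<^sub>M M i"
    and l [measurable]: "\<And>i. l i \<in> borel_measurable (M i)"
    and eq: "\<And>i. density (M i) (l i) = distr (M i) (M i) (T i)"
  shows "density (PiM I M) (\<lambda>x. \<Prod>i\<in>I. l i (x i)) = distr (PiM I M) (PiM I M) (\<lambda>x. \<lambda>i\<in>I. T i (x i))"
    (is "_ = ?R")
proof -
  have T': "prob_space (distr (M i) (M i) (T i))" for i
    by (intro prob_space.prob_space_distr M) simp
  interpret M: product_prob_space M I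
    by (intro product_prob_spaceI M)
  interpret T: product_prob_space "\<lambda>i. distr (M i) (M i) (T i)" I
    by (intro product_prob_spaceI T')
  have "?R = PiM I (\<lambda>i. distr (M i) (M i) (T i))"
  proof (rule T.PiM_eqI)
    show "sets ?R = sets (PiM I (\<lambda>i. distr (M i) (M i) (T i)))"
      by (simp cong: sets_PiM_cong)
    fix A assume A: "\<And>i. i \<in> I \<Longrightarrow> A i \<in> sets (distr (M i) (M i) (T i))"
    have [measurable]: "Pi\<^sub>E I A \<in> sets (PiM I M)"
      using A assms(1) by auto
    have "emeasure ?R (Pi\<^sub>E I A) = emeasure (PiM I M) (Pi\<^sub>E I (\<lambda>i. T i -` A i \<inter> space (M i)))"
      by (subst emeasure_distr)
        (auto intro!: arg_cong[where f="emeasure _"] simp: space_PiM PiE_iff)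
    also have "\<dots> = (\<Prod>i\<in>I. emeasure (M i) (T i -` A i \<inter> space (M i)))"
      using A by (intro M.emeasure_PiM assms(1)) (auto intro!: measurable_sets[OF T])
    also have "\<dots> = (\<Prod>i\<in>I. emeasure (distr (M i) (M i) (T i)) (A i))"
      using A by (intro prod.cong refl) (simp add: emeasure_distr)
    finally show "emeasure ?R (Pi\<^sub>E I A) = (\<Prod>i\<in>I. emeasure (distr (M i) (M i) (T i)) (A i))" .
  qed (use assms in auto)
  then show ?thesis
    using T' by (subst density_PiM) (simp_all add: assms)
qed

text \<open>The Cameron-Martin formula in dimension one: completing the square turns the density of
  the shifted variable into the given exponential weight.\<close>

lemma std_normal_shift:
  "density std_normal_distribution (\<lambda>x. ennreal (exp (w * x - w\<^sup>2 / 2))) =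
     distr std_normal_distribution std_normal_distribution (\<lambda>x. x + w)"
proof -
  \<comment> \<open>\<open>lborel\<close> is written as its own translate by \<open>- w\<close>, so
    that the outer translation can be undone and only the density is moved.\<close>
  have "distr std_normal_distribution std_normal_distribution (\<lambda>x. x + w)
      = distr (density (distr lborel borel (\<lambda>x. (- w) + x)) std_normal_density) borel ((+) w)"
    by (subst lborel_distr_plus) (auto intro!: distr_cong)
  also have "density (distr lborel borel (\<lambda>x. (- w) + x)) std_normal_density
      = distr (density lborel (\<lambda>x. std_normal_density ((- w) + x))) borel (\<lambda>x. (- w) + x)"
    by (subst density_distr) (auto simp: comp_def)
  also have "distr \<dots> borel ((+) w) = density lborel (\<lambda>x. std_normal_density ((- w) + x))"
    by (subst distr_distr) (auto simp: comp_def intro!: distr_id2)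
  also have "\<dots> = density lborel (\<lambda>x. ennreal (std_normal_density x) * ennreal (exp (w * x - w\<^sup>2 / 2)))"
  proof (rule density_cong; (intro AE_I2)?)
    fix x
    have "std_normal_density (- w + x) = std_normal_density x * exp (w * x - w\<^sup>2 / 2)"
      by (simp add: std_normal_density_def exp_add[symmetric] field_simps power2_eq_square)
    then show "ennreal (std_normal_density (- w + x)) = ennreal (std_normal_density x) * ennreal (exp (w * x - w\<^sup>2 / 2))"
      by (simp add: ennreal_mult)
  qed auto
  also have "\<dots> = density std_normal_distribution (\<lambda>x. ennreal (exp (w * x - w\<^sup>2 / 2)))"
    by (subst density_density_eq) auto
  finally show ?thesis by simp
qed

lemma std_gaussian_shift:
  "density (std_gaussian d) (\<lambda>x. ennreal (exp (inner_vec d x w - inner_vec d w w / 2))) =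
     distr (std_gaussian d) (std_gaussian d) (\<lambda>x. \<lambda>j\<in>{1..d}. x j + w j)"
proof -
  have "(\<Prod>j=1..d. ennreal (exp (w j * x j - (w j)\<^sup>2 / 2))) = ennreal (exp (inner_vec d x w - inner_vec d w w / 2))" for x
    by (simp add: prod_ennreal inner_vec_def sum_divide_distrib power2_eq_square mult.commute
        flip: exp_sum sum_subtractf)
  moreover have "density (std_gaussian d) (\<lambda>x. \<Prod>j=1..d. ennreal (exp (w j * x j - (w j)\<^sup>2 / 2))) =
     distr (std_gaussian d) (std_gaussian d) (\<lambda>x. \<lambda>j\<in>{1..d}. x j + w j)"
    unfolding std_gaussian_def
    by (rule density_PiM_eq_distr_PiM) (auto simp: std_normal_shift prob_space_std_normal)
  ultimately show ?thesis by simp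
qed

lemma inner_vec_measurable [measurable]:
  "inner_vec d x \<in> borel_measurable (borel_vec d)"
  "(\<lambda>x. inner_vec d x y) \<in> borel_measurable (borel_vec d)"
  unfolding inner_vec_def by measurable

definition shift_seed :: "nat \<Rightarrow> nat \<Rightarrow> (nat \<Rightarrow> vec) \<Rightarrow> (nat \<Rightarrow> vec) \<Rightarrow> nat \<Rightarrow> vec" where
  "shift_seed d k w b = (\<lambda>i\<in>{1..k}. \<lambda>j\<in>{1..d}. b i j + w i j)"

lemma shift_vec_measurable [measurable]:
  "(\<lambda>x. \<lambda>j\<in>{1..d}. x j + w j) \<in> borel_vec d \<rightarrow>\<^sub>M borel_vec d" for w :: vec
  by (rule measurable_restrict) measurable

lemma shift_seed_measurable [measurable]:
  "shift_seed d k w \<in> PiM {1..k} (\<lambda>_. borel_vec d) \<rightarrow>\<^sub>M PiM {1..k} (\<lambda>_. borel_vec d)"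
proof -
  have "(\<lambda>b. \<lambda>j\<in>{1..d}. b i j + w i j) \<in> PiM {1..k} (\<lambda>_. borel_vec d) \<rightarrow>\<^sub>M borel_vec d" if "i \<in> {1..k}" for i
    using measurable_compose[OF measurable_component_singleton[OF that] shift_vec_measurable[of "w i" d]] .
  then show ?thesis unfolding shift_seed_def by (rule measurable_restrict)
qed

lemma inner_seed_measurable [measurable]:
  "(\<lambda>b. inner_seed d k b w) \<in> borel_measurable (PiM {1..k} (\<lambda>_. borel_vec d))"
proof -
  have "(\<lambda>b. inner_vec d (b i) (w i)) \<in> borel_measurable (PiM {1..k} (\<lambda>_. borel_vec d))" if "i \<in> {1..k}" for i
    using measurable_compose[OF measurable_component_singleton[OF that] inner_vec_measurable(2)] .
  then show ?thesis unfolding inner_seed_def by (intro borel_measurable_sum)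
qed

lemma gaussian_seed_shift:
  "density (gaussian_seed d k) (\<lambda>b. ennreal (exp (inner_seed d k b w - inner_seed d k w w / 2))) =
     distr (gaussian_seed d k) (gaussian_seed d k) (shift_seed d k w)"
proof -
  have "(\<Prod>i=1..k. ennreal (exp (inner_vec d (b i) (w i) - inner_vec d (w i) (w i) / 2)))
      = ennreal (exp (inner_seed d k b w - inner_seed d k w w / 2))" for b
    by (simp add: prod_ennreal inner_seed_def sum_divide_distrib flip: exp_sum sum_subtractf)
  moreover have "density (gaussian_seed d k) (\<lambda>b. \<Prod>i=1..k. ennreal (exp (inner_vec d (b i) (w i) - inner_vec d (w i) (w i) / 2))) =
     distr (gaussian_seed d k) (gaussian_seed d k) (\<lambda>b. \<lambda>i\<in>{1..k}. \<lambda>j\<in>{1..d}. b i j + w i j)"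
    unfolding gaussian_seed_def
    by (intro density_PiM_eq_distr_PiM finite_atLeastAtMost prob_space_std_gaussian std_gaussian_shift)
      measurable
  ultimately show ?thesis by (simp add: shift_seed_def[abs_def])
qed

lemma cameron_martin:
  assumes [measurable]: "H \<in> borel_measurable (gaussian_seed d k)"
  shows "(\<integral>\<^sup>+b. ennreal (exp (inner_seed d k b w - inner_seed d k w w / 2)) * H b \<partial>gaussian_seed d k) =
     (\<integral>\<^sup>+b. H (shift_seed d k w b) \<partial>gaussian_seed d k)"
  using arg_cong[OF gaussian_seed_shift[of d k w], of "\<lambda>M. nn_integral M H"]
  by (simp add: nn_integral_density nn_integral_distr)

lemma nn_integral_exp_std_normal:
  "(\<integral>\<^sup>+x. ennreal (exp (a * x)) \<partial>std_normal_distribution) = ennreal (exp (a\<^sup>2 / 2))"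
proof -
  interpret prob_space std_normal_distribution by (rule prob_space_std_normal)
  have "(\<integral>\<^sup>+x. ennreal (exp (a * x - a\<^sup>2 / 2)) \<partial>std_normal_distribution) = 1"
    using arg_cong[OF std_normal_shift[of a], of "\<lambda>M. emeasure M UNIV"] emeasure_space_1
    by (simp add: emeasure_density emeasure_distr)
  moreover have "(\<integral>\<^sup>+x. ennreal (exp (a * x)) \<partial>std_normal_distribution)
      = (\<integral>\<^sup>+x. ennreal (exp (a\<^sup>2 / 2)) * ennreal (exp (a * x - a\<^sup>2 / 2)) \<partial>std_normal_distribution)"
    by (intro nn_integral_cong) (simp flip: ennreal_mult exp_add)
  ultimately show ?thesis by (subst (asm) nn_integral_cmult) auto
qed

text \<open>The weight turns the density of \<open>N(0, 1)\<close> into \<open>sqrt 2\<close> times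
  that of \<open>N(0, 2)\<close>. This \<open>sqrt 2\<close> is what each new direction will
  cost.\<close>

lemma nn_integral_exp_square_std_normal:
  "(\<integral>\<^sup>+x. ennreal (exp (x\<^sup>2 / 4)) \<partial>std_normal_distribution) = ennreal (sqrt 2)"
proof -
  have "(\<integral>\<^sup>+x. ennreal (exp (x\<^sup>2 / 4)) \<partial>std_normal_distribution)
      = (\<integral>\<^sup>+x. ennreal (sqrt 2) * ennreal (normal_density 0 (sqrt 2) x) \<partial>lborel)"
    by (subst nn_integral_density)
      (auto intro!: nn_integral_cong simp: normal_density_def real_sqrt_mult exp_add[symmetric] field_simps simp flip: ennreal_mult)
  also have "\<dots> = ennreal (sqrt 2) * emeasure (density lborel (normal_density 0 (sqrt 2))) UNIV"
    by (subst nn_integral_cmult) (auto simp: emeasure_density)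
  also have "\<dots> = ennreal (sqrt 2)"
    using prob_space.emeasure_space_1[OF prob_space_normal_density[of "sqrt 2" 0]] by simp
  finally show ?thesis .
qed

section \<open>Exponential moments along adaptively chosen directions\<close>

text \<open>Gaussian linearisation: \<open>exp (y\<^sup>2 / 4)\<close> is the mean of
  \<open>exp (y / sqrt 2 * \<xi>)\<close> over a standard normal \<xi>. For fixed \<xi> the weight
  is exponential in a linear form, so it amounts to a shift along \<open>e\<close>, to which
  \<open>H\<close> is blind. No splitting of the Gaussian into a component along \<open>e\<close>
  and an independent rest has to be built, and \<open>e\<close> may also be zero.\<close>

lemma exp_square_direction:
  assumes [measurable]: "H \<in> borel_measurable (gaussian_seed d k)"
    and inv: "\<And>c b. H (shift_seed d k (\<lambda>i j. c * e i j) b) = H b"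
    and e: "inner_seed d k e e \<le> 1"
  shows "(\<integral>\<^sup>+b. H b * ennreal (exp ((inner_seed d k b e)\<^sup>2 / 4)) \<partial>gaussian_seed d k)
    \<le> ennreal (sqrt 2) * (\<integral>\<^sup>+b. H b \<partial>gaussian_seed d k)"
proof -
  let ?G = "gaussian_seed d k" and ?N = std_normal_distribution
  interpret G: prob_space ?G by (rule prob_space_gaussian_seed)
  interpret N: prob_space ?N by (rule prob_space_std_normal)
  interpret pair_prob_space ?G ?N ..
  have *: "(\<integral>\<^sup>+b. H b * ennreal (exp (inner_seed d k b e / sqrt 2 * \<xi>)) \<partial>?G)
      \<le> (\<integral>\<^sup>+b. H b \<partial>?G) * ennreal (exp (\<xi>\<^sup>2 / 4))" for \<xi>
  proof -
    define w where "w = (\<lambda>i j. \<xi> / sqrt 2 * e i j)"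
    have w: "inner_seed d k b w = inner_seed d k b e / sqrt 2 * \<xi>"
      "inner_seed d k w w = \<xi>\<^sup>2 / 2 * inner_seed d k e e" for b
      by (simp_all add: inner_seed_def inner_vec_def w_def sum_distrib_left sum_distrib_right
          sum_divide_distrib power2_eq_square field_simps)
    have "(\<integral>\<^sup>+b. H b * ennreal (exp (inner_seed d k b e / sqrt 2 * \<xi>)) \<partial>?G)
        = (\<integral>\<^sup>+b. ennreal (exp (inner_seed d k w w / 2)) *
            (ennreal (exp (inner_seed d k b w - inner_seed d k w w / 2)) * H b) \<partial>?G)"
    proof (rule nn_integral_cong)
      fix b
      have "ennreal (exp z) = ennreal (exp a) * ennreal (exp (z - a))" for z a :: real
        by (simp flip: ennreal_mult exp_add)
      from this[of "inner_seed d k b w" "inner_seed d k w w / 2"]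
      show "H b * ennreal (exp (inner_seed d k b e / sqrt 2 * \<xi>)) = ennreal (exp (inner_seed d k w w / 2)) *
            (ennreal (exp (inner_seed d k b w - inner_seed d k w w / 2)) * H b)"
        unfolding w(1)[symmetric] by (simp only: mult_ac)
    qed
    also have "\<dots> = ennreal (exp (inner_seed d k w w / 2)) * (\<integral>\<^sup>+b. H (shift_seed d k w b) \<partial>?G)"
      by (subst nn_integral_cmult) (auto simp: cameron_martin)
    also have "\<dots> = ennreal (exp (inner_seed d k w w / 2)) * (\<integral>\<^sup>+b. H b \<partial>?G)"
      unfolding w_def by (subst inv) simp
    also have "\<dots> \<le> ennreal (exp (\<xi>\<^sup>2 / 4)) * (\<integral>\<^sup>+b. H b \<partial>?G)"
    proof (intro mult_right_mono ennreal_leI)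
      have "\<xi>\<^sup>2 / 2 * inner_seed d k e e \<le> \<xi>\<^sup>2 / 2 * 1"
        using e by (intro mult_left_mono) auto
      then show "exp (inner_seed d k w w / 2) \<le> exp (\<xi>\<^sup>2 / 4)"
        using w(2) by simp
    qed simp
    finally show ?thesis by (simp add: mult.commute)
  qed
  have "(\<integral>\<^sup>+b. H b * ennreal (exp ((inner_seed d k b e)\<^sup>2 / 4)) \<partial>?G)
      = (\<integral>\<^sup>+b. (\<integral>\<^sup>+\<xi>. H b * ennreal (exp (inner_seed d k b e / sqrt 2 * \<xi>)) \<partial>?N) \<partial>?G)"
  proof (rule nn_integral_cong)
    fix b
    have "(inner_seed d k b e / sqrt 2)\<^sup>2 / 2 = (inner_seed d k b e)\<^sup>2 / 4"
      by (simp add: power_divide)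
    then show "H b * ennreal (exp ((inner_seed d k b e)\<^sup>2 / 4)) =
        (\<integral>\<^sup>+\<xi>. H b * ennreal (exp (inner_seed d k b e / sqrt 2 * \<xi>)) \<partial>?N)"
      by (subst nn_integral_cmult) (simp_all only: nn_integral_exp_std_normal, measurable)
  qed
  also have "\<dots> = (\<integral>\<^sup>+\<xi>. (\<integral>\<^sup>+b. H b * ennreal (exp (inner_seed d k b e / sqrt 2 * \<xi>)) \<partial>?G) \<partial>?N)"
    by (rule Fubini'[symmetric]) measurable
  also have "\<dots> \<le> (\<integral>\<^sup>+\<xi>. (\<integral>\<^sup>+b. H b \<partial>?G) * ennreal (exp (\<xi>\<^sup>2 / 4)) \<partial>?N)"
    by (intro nn_integral_mono *)
  also have "\<dots> = ennreal (sqrt 2) * (\<integral>\<^sup>+b. H b \<partial>?G)"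
    by (subst nn_integral_cmult) (auto simp: nn_integral_exp_square_std_normal mult.commute)
  finally show ?thesis .
qed

section \<open>Inner products of seeds and orthonormalisation\<close>

lemma inner_seed_commute: "inner_seed d k b w = inner_seed d k w b"
  by (simp add: inner_seed_def inner_vec_def mult.commute)

lemma inner_seed_nonneg: "0 \<le> inner_seed d k b b"
  by (auto simp: inner_seed_def inner_vec_def intro!: sum_nonneg)

lemma inner_seed_self_eq_0: "inner_seed d k b b = 0 \<Longrightarrow> inner_seed d k b w = 0"
  unfolding inner_seed_def inner_vec_def
  by (subst (asm) sum_nonneg_eq_0_iff; force intro!: sum_nonneg sum.neutral simp: sum_nonneg_eq_0_iff)

lemma inner_seed_diff: "inner_seed d k (\<lambda>i j. x i j - y i j) w = inner_seed d k x w - inner_seed d k y w"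
  by (simp add: inner_seed_def inner_vec_def sum_subtractf algebra_simps)

lemma inner_seed_add: "inner_seed d k (\<lambda>i j. x i j + y i j) w = inner_seed d k x w + inner_seed d k y w"
  by (simp add: inner_seed_def inner_vec_def sum.distrib algebra_simps)

lemma inner_seed_scale: "inner_seed d k (\<lambda>i j. c * x i j) w = c * inner_seed d k x w"
  by (simp add: inner_seed_def inner_vec_def sum_distrib_left mult.assoc)

lemma inner_seed_divide: "inner_seed d k (\<lambda>i j. x i j / c) w = inner_seed d k x w / c"
  by (simp add: inner_seed_def inner_vec_def sum_divide_distrib)

lemma inner_seed_sum_list:
  "inner_seed d k (\<lambda>i j. \<Sum>e\<leftarrow>es. c e * e i j) w = (\<Sum>e\<leftarrow>es. c e * inner_seed d k e w)"
proof (induction es)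
  case Nil
  then show ?case by (simp add: inner_seed_def inner_vec_def)
next
  case (Cons e es)
  then show ?case by (simp add: inner_seed_add inner_seed_scale)
qed

lemma inner_seed_shift: "inner_seed d k (shift_seed d k w b) v = inner_seed d k b v + inner_seed d k w v"
  by (simp add: inner_seed_add[symmetric]) (simp add: inner_seed_def inner_vec_def shift_seed_def)

text \<open>The tail is orthonormalised before the head: directions are listed latest first, so a
  new query only adds a vector at the front and leaves the earlier ones as they are.\<close>

fun gram_schmidt :: "nat \<Rightarrow> nat \<Rightarrow> (nat \<Rightarrow> vec) list \<Rightarrow> (nat \<Rightarrow> vec) list" where
  "gram_schmidt d k [] = []"
| "gram_schmidt d k (v # vs) =
    (let es = gram_schmidt d k vs;
         u = (\<lambda>i j. v i j - (\<Sum>e\<leftarrow>es. inner_seed d k v e * e i j))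
     in (\<lambda>i j. u i j / sqrt (inner_seed d k u u)) # es)"

text \<open>Linearly dependent input vectors yield zero vectors in the output, since \<open>x / 0 = 0\<close>.\<close>

definition orthonormal0 :: "nat \<Rightarrow> nat \<Rightarrow> (nat \<Rightarrow> vec) list \<Rightarrow> bool" where
  "orthonormal0 d k es \<longleftrightarrow> (\<forall>e\<in>set es. inner_seed d k e e \<in> {0, 1}) \<and>
     sorted_wrt (\<lambda>e e'. inner_seed d k e e' = 0) es"

lemma inner_seed_projection:
  assumes "orthonormal0 d k es" "e \<in> set es"
  shows "(\<Sum>e'\<leftarrow>es. inner_seed d k v e' * inner_seed d k e' e) = inner_seed d k v e"
  using assms
proof (induction es)
  case (Cons a es)
  have a: "inner_seed d k a a \<in> {0, 1}" "\<And>e'. e' \<in> set es \<Longrightarrow> inner_seed d k a e' = 0"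
    and es: "orthonormal0 d k es"
    using Cons.prems(1) by (auto simp: orthonormal0_def)
  show ?case
  proof (cases "e \<in> set es")
    case True
    then show ?thesis using Cons.IH[OF es True] a(2)[OF True] by simp
  next
    case False
    then have "e = a" using Cons.prems by simp
    moreover have "(\<Sum>e'\<leftarrow>es. inner_seed d k v e' * inner_seed d k e' a) = 0"
      using a(2) by (simp add: inner_seed_commute[of d k _ a] cong: map_cong)
    moreover have "inner_seed d k v a * inner_seed d k a a = inner_seed d k v a"
      using a(1) inner_seed_self_eq_0[of d k a v] by (auto simp: inner_seed_commute[of d k v])
    ultimately show ?thesis by simp
  qed
qed simp

text \<open>If \<open>v\<close> depends on the earlier vectors, the remainder \<open>u\<close> has
  norm 0; then \<open>e0\<close> pairs to 0 with everything, and so does \<open>u\<close>, so that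
  the expansion of \<open>v\<close> stays exact.\<close>

lemma gram_schmidt_step:
  fixes v :: "nat \<Rightarrow> vec"
  assumes es: "orthonormal0 d k es"
  defines "u \<equiv> (\<lambda>i j. v i j - (\<Sum>e\<leftarrow>es. inner_seed d k v e * e i j))"
  defines "e0 \<equiv> (\<lambda>i j. u i j / sqrt (inner_seed d k u u))"
  shows "orthonormal0 d k (e0 # es)"
    and "inner_seed d k v b = (\<Sum>e\<leftarrow>e0 # es. inner_seed d k v e * inner_seed d k e b)"
proof -
  have uw: "inner_seed d k u w = inner_seed d k v w - (\<Sum>e\<leftarrow>es. inner_seed d k v e * inner_seed d k e w)" for w
    by (simp add: u_def inner_seed_diff inner_seed_sum_list)
  have ue: "inner_seed d k u e = 0" if "e \<in> set es" for e
    using inner_seed_projection[OF es that, of v] by (simp add: uw)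
  have ew: "inner_seed d k e0 w = inner_seed d k u w / sqrt (inner_seed d k u u)" for w
    by (simp add: e0_def inner_seed_divide)
  have ee: "inner_seed d k e0 e0 = inner_seed d k u u / (sqrt (inner_seed d k u u))\<^sup>2"
    by (simp add: ew inner_seed_commute[of d k u e0] power2_eq_square)
  show "orthonormal0 d k (e0 # es)"
    using es ue ee inner_seed_nonneg[of d k u] by (auto simp: orthonormal0_def ew)
  have "(\<Sum>e\<leftarrow>es. inner_seed d k v e * inner_seed d k e u) = 0"
    using ue by (simp add: inner_seed_commute[of d k _ u] cong: map_cong)
  then have vu: "inner_seed d k v u = inner_seed d k u u"
    using uw[of u] by simp
  have "inner_seed d k v e0 * inner_seed d k e0 b = inner_seed d k u b"
  proof (cases "inner_seed d k u u = 0")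
    case True
    then show ?thesis by (simp add: ew inner_seed_self_eq_0)
  next
    case False
    then show ?thesis
      using inner_seed_nonneg[of d k u] by (simp add: inner_seed_commute[of d k v e0] ew inner_seed_commute[of d k u v] vu)
  qed
  then show "inner_seed d k v b = (\<Sum>e\<leftarrow>e0 # es. inner_seed d k v e * inner_seed d k e b)"
    using uw[of b] by simp
qed

lemma orthonormal0_gram_schmidt: "orthonormal0 d k (gram_schmidt d k vs)"
proof (induction vs)
  case Nil
  then show ?case by (simp add: orthonormal0_def)
next
  case (Cons v vs)
  then show ?case using gram_schmidt_step(1)[OF Cons, of v] by (simp add: Let_def)
qed

lemma gram_schmidt_expansion:
  "inner_seed d k v b = (\<Sum>e\<leftarrow>gram_schmidt d k (v # vs). inner_seed d k v e * inner_seed d k e b)"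
  using gram_schmidt_step(2)[OF orthonormal0_gram_schmidt, of d k v b vs] by (simp add: Let_def)

text \<open>By the expansion of \<open>v\<close> in the output vectors. It transfers invariance
  under shifts from the orthonormal system to the raw query directions, by which the cells are
  defined.\<close>

lemma gram_schmidt_span:
  assumes "v \<in> set vs" "\<And>e. e \<in> set (gram_schmidt d k vs) \<Longrightarrow> inner_seed d k w e = 0"
  shows "inner_seed d k w v = 0"
  using assms
proof (induction vs)
  case (Cons a vs)
  show ?case
  proof (cases "v = a")
    case True
    have "inner_seed d k v w = (\<Sum>e\<leftarrow>gram_schmidt d k (v # vs). inner_seed d k v e * inner_seed d k e w)"
      by (rule gram_schmidt_expansion)
    also have "\<dots> = (\<Sum>e\<leftarrow>gram_schmidt d k (v # vs). 0)"
      using Cons.prems(2) True by (intro arg_cong[where f=sum_list] map_cong refl) (simp add: inner_seed_commute[of d k _ w])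
    finally show ?thesis by (simp add: inner_seed_commute[of d k w])
  next
    case False
    then show ?thesis using Cons by (auto simp: Let_def)
  qed
qed simp

text \<open>The squared norm of the orthogonal projection of \<open>b\<close> onto the span of
  \<open>vs\<close>.\<close>

definition bessel_sum :: "nat \<Rightarrow> nat \<Rightarrow> (nat \<Rightarrow> vec) list \<Rightarrow> (nat \<Rightarrow> vec) \<Rightarrow> real" where
  "bessel_sum d k vs b = (\<Sum>e\<leftarrow>gram_schmidt d k vs. (inner_seed d k b e)\<^sup>2)"

text \<open>Having \<open>v\<close> itself in the list makes its expansion exact, and
  \<open>2 * x * y \<le> x\<^sup>2 + y\<^sup>2\<close> is applied to each term. With
  \<open>v\<close> the conditional mean of \<open>b\<close>, this will bound the squared norm of
  \<open>v\<close> by the mean squared projection.\<close>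

lemma inner_seed_le_bessel_sum:
  "2 * inner_seed d k b v \<le> inner_seed d k v v + bessel_sum d k (v # vs) b"
proof -
  let ?es = "gram_schmidt d k (v # vs)"
  have "2 * inner_seed d k v b = (\<Sum>e\<leftarrow>?es. 2 * (inner_seed d k v e * inner_seed d k e b))"
    by (subst gram_schmidt_expansion[of d k v b vs]) (simp only: sum_list_const_mult)
  also have "\<dots> \<le> (\<Sum>e\<leftarrow>?es. inner_seed d k v e * inner_seed d k e v + (inner_seed d k b e)\<^sup>2)"
  proof (rule sum_list_mono)
    fix e
    show "2 * (inner_seed d k v e * inner_seed d k e b) \<le> inner_seed d k v e * inner_seed d k e v + (inner_seed d k b e)\<^sup>2"
      using sum_squares_bound[of "inner_seed d k v e" "inner_seed d k b e"]
      by (simp add: inner_seed_commute[of d k e] power2_eq_square)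
  qed
  also have "\<dots> = inner_seed d k v v + bessel_sum d k (v # vs) b"
    unfolding bessel_sum_def sum_list_addf gram_schmidt_expansion[of d k v v vs, symmetric] by simp
  finally show ?thesis by (simp add: inner_seed_commute[of d k b])
qed

lemma bessel_sum_measurable [measurable]:
  "bessel_sum d k vs \<in> borel_measurable (PiM {1..k} (\<lambda>_. borel_vec d))"
proof -
  have "(\<lambda>b. \<Sum>e\<leftarrow>es. (inner_seed d k b e)\<^sup>2) \<in> borel_measurable (PiM {1..k} (\<lambda>_. borel_vec d))" for es
    by (induction es) (simp_all del: One_nat_def)
  then show ?thesis unfolding bessel_sum_def .
qed

text \<open>A query \<open>x\<close> put to the vector with index \<open>s\<close> measures the
  whole seed along the vector that is \<open>x\<close> in block \<open>s\<close> and 0 elsewhere.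
  Queries depend on the answers alone, so for a given transcript the adaptively chosen directions
  are fixed vectors.\<close>

fun directions :: "(real list \<Rightarrow> vec) \<Rightarrow> (nat \<times> real) list \<Rightarrow> (nat \<Rightarrow> vec) list" where
  "directions X [] = []"
| "directions X (p # \<tau>) = (\<lambda>i j. if i = fst p then X (map snd \<tau>) j else 0) # directions X \<tau>"

text \<open>A transcript lists pairs of an index and a rounded answer, the latest first;
  \<open>index_cell\<close> asks that each answer is the one given by the vector with the listed index,
  whether or not that vector attains the maximum.\<close>

fun index_cell :: "nat \<Rightarrow> (real list \<Rightarrow> vec) \<Rightarrow> (real \<Rightarrow> real) \<Rightarrow> (nat \<times> real) list \<Rightarrow> (nat \<Rightarrow> vec) \<Rightarrow> bool" where
  "index_cell d X r [] b = True"
| "index_cell d X r (p # \<tau>) b = (r (inner_vec d (b (fst p)) (X (map snd \<tau>))) = snd p \<and> index_cell d X r \<tau> b)"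

definition transcripts :: "nat \<Rightarrow> real set \<Rightarrow> nat \<Rightarrow> (nat \<times> real) list set" where
  "transcripts k Q n = {\<tau>. set \<tau> \<subseteq> {1..k} \<times> Q \<and> length \<tau> = n}"

lemma finite_transcripts: "finite Q \<Longrightarrow> finite (transcripts k Q n)"
  unfolding transcripts_def by (intro finite_lists_length_eq) auto

lemma transcripts_0: "transcripts k Q 0 = {[]}"
  by (auto simp: transcripts_def)

lemma transcripts_Suc: "transcripts k Q (Suc n) = (\<lambda>(p, \<tau>). p # \<tau>) ` (({1..k} \<times> Q) \<times> transcripts k Q n)"
  by (auto simp: transcripts_def length_Suc_conv image_iff)

lemma index_cell_measurable [measurable]:
  assumes [measurable]: "r \<in> borel_measurable borel" and "set \<tau> \<subseteq> {1..k} \<times> Q"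
  shows "Measurable.pred (PiM {1..k} (\<lambda>_. borel_vec d)) (index_cell d X r \<tau>)"
  using assms(2)
proof (induction \<tau>)
  case (Cons p \<tau>)
  have "fst p \<in> {1..k}" using Cons.prems by auto
  from measurable_compose[OF measurable_component_singleton[OF this] inner_vec_measurable(2)]
  have [measurable]: "(\<lambda>b. inner_vec d (b (fst p)) (X (map snd \<tau>))) \<in> borel_measurable (PiM {1..k} (\<lambda>_. borel_vec d))" .
  have [measurable]: "Measurable.pred (PiM {1..k} (\<lambda>_. borel_vec d)) (index_cell d X r \<tau>)"
    using Cons by auto
  show ?case unfolding index_cell.simps by measurable
next
  case Nil
  have "index_cell d X r [] = (\<lambda>_. True)" by (intro ext) simp
  then show ?case by simp
qed

lemma inner_seed_direction:
  assumes "s \<in> {1..k}"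
  shows "inner_seed d k b (\<lambda>i j. if i = s then x j else 0) = inner_vec d (b s) x"
proof -
  have "inner_seed d k b (\<lambda>i j. if i = s then x j else 0) = (\<Sum>i=1..k. if i = s then inner_vec d (b i) x else 0)"
    unfolding inner_seed_def by (intro sum.cong refl) (simp add: inner_vec_def)
  then show ?thesis using assms by simp
qed

lemma index_cell_shift:
  assumes "set \<tau> \<subseteq> {1..k} \<times> Q" "\<And>v. v \<in> set (directions X \<tau>) \<Longrightarrow> inner_seed d k w v = 0"
  shows "index_cell d X r \<tau> (shift_seed d k w b) = index_cell d X r \<tau> b"
  using assms
proof (induction \<tau>)
  case (Cons p \<tau>)
  have p: "fst p \<in> {1..k}" using Cons.prems by auto
  have "inner_vec d (shift_seed d k w b (fst p)) (X (map snd \<tau>)) = inner_vec d (b (fst p)) (X (map snd \<tau>))"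
    unfolding inner_seed_direction[OF p, symmetric] inner_seed_shift using Cons.prems(2) by simp
  then show ?case using Cons by auto
qed simp

text \<open>The head of the Gram-Schmidt list is orthogonal to all earlier directions, so a shift
  along it changes neither the cell nor the earlier projections, and
  \<open>exp_square_direction\<close> applies. Here \<open>v\<close> is arbitrary: besides the next
  query it will also be a conditional mean.\<close>

lemma nn_integral_cell_exp_step:
  assumes [measurable]: "r \<in> borel_measurable borel" and \<tau>: "set \<tau> \<subseteq> {1..k} \<times> Q"
  shows "(\<integral>\<^sup>+b. of_bool (index_cell d X r \<tau> b) * ennreal (exp (bessel_sum d k (v # directions X \<tau>) b / 4)) \<partial>gaussian_seed d k)
    \<le> ennreal (sqrt 2) *
      (\<integral>\<^sup>+b. of_bool (index_cell d X r \<tau> b) * ennreal (exp (bessel_sum d k (directions X \<tau>) b / 4)) \<partial>gaussian_seed d k)"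
proof -
  note [measurable] = index_cell_measurable[OF assms(1) \<tau>]
  define e where "e = hd (gram_schmidt d k (v # directions X \<tau>))"
  have gs: "gram_schmidt d k (v # directions X \<tau>) = e # gram_schmidt d k (directions X \<tau>)"
    by (simp add: e_def Let_def)
  have on: "orthonormal0 d k (e # gram_schmidt d k (directions X \<tau>))"
    using orthonormal0_gram_schmidt[of d k "v # directions X \<tau>"] unfolding gs .
  then have e: "inner_seed d k e e \<le> 1" "\<And>e'. e' \<in> set (gram_schmidt d k (directions X \<tau>)) \<Longrightarrow> inner_seed d k e e' = 0"
    by (auto simp: orthonormal0_def)
  define H where "H b = of_bool (index_cell d X r \<tau> b) * ennreal (exp (bessel_sum d k (directions X \<tau>) b / 4))" for b
  have [measurable]: "H \<in> borel_measurable (gaussian_seed d k)"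
    unfolding H_def by measurable
  have "H (shift_seed d k (\<lambda>i j. c * e i j) b) = H b" for c b
  proof -
    have 1: "inner_seed d k (\<lambda>i j. c * e i j) e' = 0" if "e' \<in> set (gram_schmidt d k (directions X \<tau>))" for e'
      using e(2)[OF that] by (simp add: inner_seed_scale)
    have "inner_seed d k (\<lambda>i j. c * e i j) v' = 0" if "v' \<in> set (directions X \<tau>)" for v'
      using gram_schmidt_span[OF that] 1 by blast
    then show ?thesis
      using 1 by (simp add: H_def index_cell_shift[OF \<tau>] bessel_sum_def inner_seed_shift cong: map_cong)
  qed
  from exp_square_direction[OF _ this e(1)]
  have "(\<integral>\<^sup>+b. H b * ennreal (exp ((inner_seed d k b e)\<^sup>2 / 4)) \<partial>gaussian_seed d k)
    \<le> ennreal (sqrt 2) * (\<integral>\<^sup>+b. H b \<partial>gaussian_seed d k)"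
    by measurable
  moreover have "H b * ennreal (exp ((inner_seed d k b e)\<^sup>2 / 4)) =
      of_bool (index_cell d X r \<tau> b) * ennreal (exp (bessel_sum d k (v # directions X \<tau>) b / 4))" for b
    by (simp add: H_def bessel_sum_def gs add_divide_distrib exp_add ennreal_mult mult_ac del: gram_schmidt.simps)
  ultimately show ?thesis by (simp add: H_def)
qed

text \<open>Induction over the queries. For a fixed index exactly one rounded answer fits a given
  \<open>b\<close>, so the sum over the answers is free. Sets belonging to different index sequences
  may overlap, hence the power of \<open>k\<close>.\<close>

lemma sum_cell_exp_le:
  assumes [measurable]: "r \<in> borel_measurable borel" and Q: "finite Q" "range r \<subseteq> Q"
  shows "(\<Sum>\<tau>\<in>transcripts k Q n. \<integral>\<^sup>+b. of_bool (index_cell d X r \<tau> b) * ennreal (exp (bessel_sum d k (directions X \<tau>) b / 4)) \<partial>gaussian_seed d k)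
    \<le> (ennreal (real k * sqrt 2)) ^ n"
proof (induction n)
  case 0
  interpret prob_space "gaussian_seed d k" by (rule prob_space_gaussian_seed)
  show ?case by (simp add: transcripts_0 bessel_sum_def emeasure_space_1)
next
  case (Suc n)
  let ?G = "gaussian_seed d k"
  let ?E = "\<lambda>\<tau> b. ennreal (exp (bessel_sum d k (directions X \<tau>) b / 4))"
  let ?I = "\<lambda>\<tau> b. of_bool (index_cell d X r \<tau> b) :: ennreal"
  have step: "(\<Sum>q\<in>Q. \<integral>\<^sup>+b. ?I ((s, q) # \<tau>) b * ?E ((s, q) # \<tau>) b \<partial>?G) \<le> ennreal (sqrt 2) * (\<integral>\<^sup>+b. ?I \<tau> b * ?E \<tau> b \<partial>?G)"
    if s: "s \<in> {1..k}" and \<tau>: "\<tau> \<in> transcripts k Q n" for s \<tau>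
  proof -
    have \<tau>': "set \<tau> \<subseteq> {1..k} \<times> Q" using \<tau> by (simp add: transcripts_def)
    note [measurable] = index_cell_measurable[OF assms(1) \<tau>']
    have [measurable]: "(\<lambda>b. inner_vec d (b s) (X (map snd \<tau>))) \<in> borel_measurable ?G"
      unfolding measurable_cong_sets[OF sets_gaussian_seed refl]
      by (rule measurable_compose[OF measurable_component_singleton[OF s] inner_vec_measurable(2)])
    let ?v = "\<lambda>i j. if i = s then X (map snd \<tau>) j else 0"
    let ?E' = "\<lambda>b. ennreal (exp (bessel_sum d k (?v # directions X \<tau>) b / 4))"
    have "(\<Sum>q\<in>Q. \<integral>\<^sup>+b. ?I ((s, q) # \<tau>) b * ?E ((s, q) # \<tau>) b \<partial>?G)
      = (\<Sum>q\<in>Q. \<integral>\<^sup>+b. of_bool (r (inner_vec d (b s) (X (map snd \<tau>))) = q) * (?I \<tau> b * ?E' b) \<partial>?G)"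
      by (intro sum.cong refl nn_integral_cong) simp
    also have "\<dots> = (\<integral>\<^sup>+b. (\<Sum>q\<in>Q. of_bool (r (inner_vec d (b s) (X (map snd \<tau>))) = q) * (?I \<tau> b * ?E' b)) \<partial>?G)"
      by (rule nn_integral_sum[symmetric]) measurable
    also have "\<dots> = (\<integral>\<^sup>+b. ?I \<tau> b * ?E' b \<partial>?G)"
    proof (rule nn_integral_cong)
      fix b
      have "(\<Sum>q\<in>Q. of_bool (r (inner_vec d (b s) (X (map snd \<tau>))) = q) * (?I \<tau> b * ?E' b))
        = (\<Sum>q\<in>Q. if r (inner_vec d (b s) (X (map snd \<tau>))) = q then ?I \<tau> b * ?E' b else 0)"
        by (intro sum.cong refl) simp
      also have "\<dots> = ?I \<tau> b * ?E' b"
        using Q by (subst sum.delta'[OF Q(1)]) auto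
      finally show "(\<Sum>q\<in>Q. of_bool (r (inner_vec d (b s) (X (map snd \<tau>))) = q) * (?I \<tau> b * ?E' b)) = ?I \<tau> b * ?E' b" .
    qed
    also have "\<dots> \<le> ennreal (sqrt 2) * (\<integral>\<^sup>+b. ?I \<tau> b * ?E \<tau> b \<partial>?G)"
      by (rule nn_integral_cell_exp_step[OF assms(1) \<tau>'])
    finally show ?thesis .
  qed
  have "inj_on (\<lambda>(p, \<tau>). p # \<tau>) (({1..k} \<times> Q) \<times> transcripts k Q n)"
    by (auto simp: inj_on_def)
  then have "(\<Sum>\<tau>\<in>transcripts k Q (Suc n). \<integral>\<^sup>+b. ?I \<tau> b * ?E \<tau> b \<partial>?G)
    = (\<Sum>(p, \<tau>)\<in>({1..k} \<times> Q) \<times> transcripts k Q n. \<integral>\<^sup>+b. ?I (p # \<tau>) b * ?E (p # \<tau>) b \<partial>?G)"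
    unfolding transcripts_Suc by (subst sum.reindex) (auto simp: case_prod_unfold)
  also have "\<dots> = (\<Sum>s=1..k. \<Sum>q\<in>Q. \<Sum>\<tau>\<in>transcripts k Q n. \<integral>\<^sup>+b. ?I ((s, q) # \<tau>) b * ?E ((s, q) # \<tau>) b \<partial>?G)"
    by (simp only: sum.cartesian_product' prod.case)
  also have "\<dots> = (\<Sum>s=1..k. \<Sum>\<tau>\<in>transcripts k Q n. \<Sum>q\<in>Q. \<integral>\<^sup>+b. ?I ((s, q) # \<tau>) b * ?E ((s, q) # \<tau>) b \<partial>?G)"
    by (intro sum.cong refl sum.swap)
  also have "\<dots> \<le> (\<Sum>s=1..k. \<Sum>\<tau>\<in>transcripts k Q n. ennreal (sqrt 2) * (\<integral>\<^sup>+b. ?I \<tau> b * ?E \<tau> b \<partial>?G))"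
    by (intro sum_mono step)
  also have "\<dots> = of_nat k * ennreal (sqrt 2) * (\<Sum>\<tau>\<in>transcripts k Q n. \<integral>\<^sup>+b. ?I \<tau> b * ?E \<tau> b \<partial>?G)"
    by (simp add: sum_distrib_left mult.assoc)
  also have "\<dots> \<le> of_nat k * ennreal (sqrt 2) * (ennreal (real k * sqrt 2)) ^ n"
    by (intro mult_left_mono Suc.IH) auto
  also have "\<dots> = (ennreal (real k * sqrt 2)) ^ Suc n"
    by (simp add: ennreal_mult ennreal_of_nat_eq_real_of_nat)
  finally show ?case .
qed

section \<open>The truncated Gaussian\<close>

definition trunc_set :: "nat \<Rightarrow> vec set" where
  "trunc_set d = {g \<in> space (std_gaussian d). L2_set g {1..d} \<le> 2 * sqrt (real d)}"

lemma L2_set_le_iff_inner_vec: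
  assumes "0 \<le> c"
  shows "L2_set x {1..d} \<le> c \<longleftrightarrow> inner_vec d x x \<le> c\<^sup>2"
proof -
  have "L2_set x {1..d} = sqrt (inner_vec d x x)"
    by (simp add: L2_set_def inner_vec_def power2_eq_square)
  then show ?thesis
    by (metis assms real_sqrt_abs abs_of_nonneg real_sqrt_le_iff)
qed

lemma trunc_set_eq: "trunc_set d = {g \<in> space (std_gaussian d). inner_vec d g g \<le> 4 * real d}"
  unfolding trunc_set_def by (subst L2_set_le_iff_inner_vec) (auto simp: power_mult_distrib)

lemma inner_vec_self_measurable [measurable]: "(\<lambda>x. inner_vec d x x) \<in> borel_measurable (borel_vec d)"
  unfolding inner_vec_def by measurable

lemma trunc_set_measurable [measurable]: "trunc_set d \<in> sets (std_gaussian d)"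
  unfolding trunc_set_eq by measurable

lemma std_gaussian_component_square:
  assumes "j \<in> {1..d}"
  shows "integrable (std_gaussian d) (\<lambda>g. (g j)\<^sup>2)" "(LINT g|std_gaussian d. (g j)\<^sup>2) = 1"
proof -
  interpret product_prob_space "\<lambda>_. std_normal_distribution" "{1..d}"
    by (intro product_prob_spaceI prob_space_std_normal)
  have eq: "distr (std_gaussian d) std_normal_distribution (\<lambda>g. g j) = std_normal_distribution"
    unfolding std_gaussian_def using PiM_component[OF assms] .
  have [measurable]: "(\<lambda>g. g j) \<in> std_gaussian d \<rightarrow>\<^sub>M std_normal_distribution"
    unfolding std_gaussian_def using assms by measurable
  have [measurable]: "(\<lambda>g. g j) \<in> borel_measurable (std_gaussian d)"
    unfolding measurable_cong_sets[OF sets_std_gaussian refl] using assms by measurable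
  show "integrable (std_gaussian d) (\<lambda>g. (g j)\<^sup>2)"
    using std_normal_distribution_even_moments(2)[of 1]
    by (subst (asm) eq[symmetric], subst (asm) integrable_distr_eq) simp_all
  show "(LINT g|std_gaussian d. (g j)\<^sup>2) = 1"
    using std_normal_distribution_even_moments(1)[of 1]
    by (subst (asm) eq[symmetric]) (simp add: integral_distr)
qed

text \<open>Markov's inequality: the squared norm has mean \<open>d\<close> and is truncated at
  \<open>4 * d\<close>.\<close>

lemma measure_trunc_set: "3 / 4 \<le> measure (std_gaussian d) (trunc_set d)"
proof (cases "d = 0")
  case True
  interpret prob_space "std_gaussian d" by (rule prob_space_std_gaussian)
  have "trunc_set d = space (std_gaussian d)"
    unfolding trunc_set_eq using True by (auto simp: inner_vec_def)
  then show ?thesis by (simp add: prob_space)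
next
  case False
  interpret prob_space "std_gaussian d" by (rule prob_space_std_gaussian)
  have int: "integrable (std_gaussian d) (\<lambda>g. inner_vec d g g)"
    unfolding inner_vec_def power2_eq_square[symmetric]
    by (intro Bochner_Integration.integrable_sum std_gaussian_component_square)
  have ex: "expectation (\<lambda>g. inner_vec d g g) = d"
    unfolding inner_vec_def power2_eq_square[symmetric]
    by (subst Bochner_Integration.integral_sum) (simp_all add: std_gaussian_component_square)
  have "prob {g \<in> space (std_gaussian d). 4 * real d \<le> inner_vec d g g} \<le> expectation (\<lambda>g. inner_vec d g g) / (4 * real d)"
    using False by (intro integral_Markov_inequality_measure[where A="{}"] int)
      (auto simp: inner_vec_def intro!: sum_nonneg)
  also have "\<dots> = 1 / 4" using False by (simp add: ex)
  finally have 1: "prob {g \<in> space (std_gaussian d). 4 * real d \<le> inner_vec d g g} \<le> 1 / 4" .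
  have "space (std_gaussian d) - trunc_set d \<subseteq> {g \<in> space (std_gaussian d). 4 * real d \<le> inner_vec d g g}"
    by (auto simp: trunc_set_eq)
  then have "prob (space (std_gaussian d) - trunc_set d) \<le> 1 / 4"
    by (rule order_trans[OF finite_measure_mono 1]) measurable
  then show ?thesis by (subst (asm) prob_compl) auto
qed

lemma truncated_gaussian_eq: "truncated_gaussian d = uniform_measure (std_gaussian d) (trunc_set d)"
  by (simp add: truncated_gaussian_def trunc_set_def)

lemma emeasure_trunc_set: "emeasure (std_gaussian d) (trunc_set d) = ennreal (measure (std_gaussian d) (trunc_set d))"
  using prob_space.finite_measure[OF prob_space_std_gaussian]
  by (simp add: finite_measure.emeasure_eq_measure)

lemma prob_space_truncated_gaussian: "prob_space (truncated_gaussian d)"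
  unfolding truncated_gaussian_eq using measure_trunc_set[of d]
  by (intro prob_space_uniform_measure) (auto simp: emeasure_trunc_set)

lemma sets_truncated_gaussian [measurable_cong]: "sets (truncated_gaussian d) = sets (borel_vec d)"
  by (simp add: truncated_gaussian_eq sets_std_gaussian)

lemma prob_space_seed_law: "prob_space (seed_law d k)"
  unfolding seed_law_def by (intro prob_space_PiM prob_space_truncated_gaussian)

lemma sets_seed_law [measurable_cong]: "sets (seed_law d k) = sets (PiM {1..k} (\<lambda>_. borel_vec d))"
  unfolding seed_law_def by (intro sets_PiM_cong sets_truncated_gaussian refl)

lemma component_measurable [measurable]:
  assumes "i \<in> {1..k}"
  shows "(\<lambda>b. b i) \<in> seed_law d k \<rightarrow>\<^sub>M borel_vec d"
  unfolding measurable_cong_sets[OF sets_seed_law refl] using measurable_component_singleton[OF assms] .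

lemma entry_measurable [measurable]:
  assumes "i \<in> {1..k}" "j \<in> {1..d}"
  shows "(\<lambda>b. b i j) \<in> borel_measurable (seed_law d k)"
  using measurable_compose[OF component_measurable[OF assms(1)] measurable_component_singleton[OF assms(2)]] .

text \<open>The truncated law has density at most \<open>4 / 3\<close> per vector with respect to
  the Gaussian. Upper bounds can thus be computed for the Gaussian seed, where shifts and Laplace
  transforms are explicit.\<close>

lemma nn_integral_seed_law_le:
  assumes [measurable]: "H \<in> borel_measurable (PiM {1..k} (\<lambda>_. borel_vec d))"
  shows "(\<integral>\<^sup>+b. H b \<partial>seed_law d k) \<le> ennreal ((4 / 3) ^ k) * (\<integral>\<^sup>+b. H b \<partial>gaussian_seed d k)"
proof -
  define l where "l g = indicator (trunc_set d) g / emeasure (std_gaussian d) (trunc_set d)" for g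
  have [measurable]: "l \<in> borel_measurable (std_gaussian d)"
    unfolding l_def by measurable
  have l: "l g \<le> ennreal (4 / 3)" for g
    using measure_trunc_set[of d]
    by (auto simp: l_def emeasure_trunc_set indicator_def divide_ennreal ennreal_1[symmetric] simp del: ennreal_1
        intro!: ennreal_leI simp: field_simps)
  have 1: "seed_law d k = density (gaussian_seed d k) (\<lambda>b. \<Prod>i=1..k. l (b i))"
    unfolding seed_law_def gaussian_seed_def truncated_gaussian_eq uniform_measure_def l_def[symmetric]
    using prob_space_truncated_gaussian[of d]
    by (intro density_PiM[symmetric] prob_space_std_gaussian)
      (auto simp: truncated_gaussian_eq uniform_measure_def l_def[symmetric])
  have "(\<lambda>b. l (b i)) \<in> borel_measurable (gaussian_seed d k)" if "i \<in> {1..k}" for i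
    unfolding gaussian_seed_def
    by (rule measurable_compose[OF measurable_component_singleton[OF that]]) measurable
  then have [measurable]: "(\<lambda>b. \<Prod>i=1..k. l (b i)) \<in> borel_measurable (gaussian_seed d k)"
    by (intro borel_measurable_prod_ennreal)
  have "(\<integral>\<^sup>+b. H b \<partial>seed_law d k) = (\<integral>\<^sup>+b. (\<Prod>i=1..k. l (b i)) * H b \<partial>gaussian_seed d k)"
    by (subst 1, subst nn_integral_density) measurable
  also have "\<dots> \<le> (\<integral>\<^sup>+b. ennreal ((4 / 3) ^ k) * H b \<partial>gaussian_seed d k)"
  proof (intro nn_integral_mono mult_right_mono)
    fix b
    have "(\<Prod>i\<in>A. l (b i)) \<le> ennreal (4 / 3) ^ card A" if "finite A" for A :: "nat set"
      using that by induction (auto intro!: mult_mono l)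
    from this[of "{1..k}"] show "(\<Prod>i=1..k. l (b i)) \<le> ennreal ((4 / 3) ^ k)"
      by (simp add: ennreal_power)
  qed simp
  also have "\<dots> = ennreal ((4 / 3) ^ k) * (\<integral>\<^sup>+b. H b \<partial>gaussian_seed d k)"
    by (rule nn_integral_cmult) measurable
  finally show ?thesis .
qed

lemma AE_truncated_gaussian_bounded: "AE g in truncated_gaussian d. inner_vec d g g \<le> 4 * real d"
  unfolding truncated_gaussian_eq
  by (intro AE_uniform_measureI trunc_set_measurable AE_I2) (simp add: trunc_set_eq)

lemma AE_seed_law_bounded: "AE b in seed_law d k. \<forall>i\<in>{1..k}. inner_vec d (b i) (b i) \<le> 4 * real d"
proof -
  have "AE b in seed_law d k. inner_vec d (b i) (b i) \<le> 4 * real d" if "i \<in> {1..k}" for i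
    unfolding seed_law_def
    by (intro AE_PiM_component[OF prob_space_truncated_gaussian that] AE_truncated_gaussian_bounded)
  then show ?thesis by (intro AE_finite_allI) auto
qed

lemma std_gaussian_uminus:
  "distr (std_gaussian d) (std_gaussian d) (\<lambda>x. \<lambda>j\<in>{1..d}. - x j) = std_gaussian d"
proof -
  \<comment> \<open>The constant density 1 casts the reflection into the form that
    \<open>density_PiM_eq_distr_PiM\<close> lifts to products.\<close>
  have N: "density std_normal_distribution (\<lambda>x. 1) = distr std_normal_distribution std_normal_distribution uminus"
  proof -
    have "distr std_normal_distribution std_normal_distribution uminus = distr (density (distr lborel borel uminus) std_normal_density) borel uminus"
      by (subst lborel_distr_uminus) (auto intro!: distr_cong)
    also have "\<dots> = std_normal_distribution"
      by (subst density_distr, simp, simp, subst distr_distr)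
        (auto simp: comp_def std_normal_density_def intro!: distr_id2 density_cong)
    finally show ?thesis by (simp add: density_1)
  qed
  have "density (std_gaussian d) (\<lambda>x. \<Prod>j=1..d. 1) = distr (std_gaussian d) (std_gaussian d) (\<lambda>x. \<lambda>j\<in>{1..d}. - x j)"
    unfolding std_gaussian_def
    by (rule density_PiM_eq_distr_PiM) (auto simp: N prob_space_std_normal)
  then show ?thesis by (simp add: density_1)
qed

lemma abs_component_le:
  assumes "inner_vec d g g \<le> 4 * real d" "j \<in> {1..d}"
  shows "\<bar>g j\<bar> \<le> 2 * sqrt (real d)"
proof -
  have "(g j)\<^sup>2 \<le> inner_vec d g g"
    unfolding inner_vec_def power2_eq_square by (rule member_le_sum[OF assms(2)]) auto
  also have "\<dots> \<le> (2 * sqrt (real d))\<^sup>2" using assms(1) by (simp add: power_mult_distrib)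
  finally show ?thesis using abs_le_square_iff[of "g j" "2 * sqrt (real d)"] by simp
qed

text \<open>The truncation set is invariant under reflection. Vanishing means are what kills the
  cross terms between different vectors later.\<close>

lemma integral_truncated_gaussian_component:
  assumes j: "j \<in> {1..d}"
  shows "(LINT g|truncated_gaussian d. g j) = 0"
proof -
  have [measurable]: "(\<lambda>g. g j) \<in> borel_measurable (std_gaussian d)"
    unfolding measurable_cong_sets[OF sets_std_gaussian refl] using j by measurable
  have [measurable]: "(\<lambda>x. \<lambda>j\<in>{1..d}. - x j) \<in> std_gaussian d \<rightarrow>\<^sub>M std_gaussian d"
    unfolding measurable_cong_sets[OF sets_std_gaussian sets_std_gaussian]
    by (rule measurable_restrict) measurable
  define I where "I = (LINT g|std_gaussian d. indicator (trunc_set d) g * g j)"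
  have "I = (LINT g|std_gaussian d. indicator (trunc_set d) (\<lambda>j\<in>{1..d}. - g j) * - g j)"
    unfolding I_def by (subst std_gaussian_uminus[symmetric], subst integral_distr, measurable) (use j in simp)
  also have "\<dots> = (LINT g|std_gaussian d. - (indicator (trunc_set d) g * g j))"
  proof (rule Bochner_Integration.integral_cong[OF refl])
    fix g assume "g \<in> space (std_gaussian d)"
    then have "(\<lambda>j\<in>{1..d}. - g j) \<in> trunc_set d \<longleftrightarrow> g \<in> trunc_set d"
      by (auto simp: trunc_set_eq space_std_gaussian inner_vec_def)
    then show "indicator (trunc_set d) (\<lambda>j\<in>{1..d}. - g j) * - g j = - (indicator (trunc_set d) g * g j)"
      by (simp add: indicator_def)
  qed
  also have "\<dots> = - I" by (simp add: I_def)
  finally have "I = 0" by simp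
  define c where "c = measure (std_gaussian d) (trunc_set d)"
  have c: "c > 0" using measure_trunc_set[of d] by (simp add: c_def)
  have "(LINT g|truncated_gaussian d. g j) = (LINT g|std_gaussian d. (indicator (trunc_set d) g / c) *\<^sub>R g j)"
    unfolding truncated_gaussian_eq uniform_measure_def
  proof (subst integral_density[symmetric])
    have "indicator (trunc_set d) g / emeasure (std_gaussian d) (trunc_set d) = ennreal (indicator (trunc_set d) g / c)" for g
      using c by (auto simp: emeasure_trunc_set c_def[symmetric] indicator_def divide_ennreal simp flip: ennreal_1)
    then show "integral\<^sup>L (density (std_gaussian d) (\<lambda>x. indicator (trunc_set d) x / emeasure (std_gaussian d) (trunc_set d))) (\<lambda>g. g j) =
      integral\<^sup>L (density (std_gaussian d) (\<lambda>x. ennreal (indicator (trunc_set d) x / c))) (\<lambda>g. g j)"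
      by simp
  qed (use c in auto)
  also have "\<dots> = I / c"
    unfolding I_def by (simp flip: Bochner_Integration.integral_divide_zero)
  finally show ?thesis using \<open>I = 0\<close> by simp
qed

section \<open>Protocols with rounded answers\<close>

definition max_inner :: "nat \<Rightarrow> nat \<Rightarrow> (nat \<Rightarrow> vec) \<Rightarrow> vec \<Rightarrow> real" where
  "max_inner d k b x = (MAX i\<in>{1..k}. inner_vec d (b i) x)"

text \<open>Breaking ties by the least index turns a joint event into a conjunction with one
  condition on each \<open>v i\<close> alone: strictly below \<open>q\<close> before
  \<open>s\<close>, at most \<open>q\<close> after it. This is the source of the product form of the
  cells.\<close>

lemma first_argmax_iff:
  fixes v :: "nat \<Rightarrow> real"
  assumes s: "s \<in> {1..k}"
  shows "((LEAST i. i \<in> {1..k} \<and> v i = (MAX i\<in>{1..k}. v i)) = s \<and> (MAX i\<in>{1..k}. v i) = q) \<longleftrightarrow>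
    (\<forall>i\<in>{1..k}. if i = s then v i = q else if i < s then v i < q else v i \<le> q)"
proof -
  let ?M = "MAX i\<in>{1..k}. v i"
  let ?P = "\<lambda>i. i \<in> {1..k} \<and> v i = ?M"
  have le: "v i \<le> ?M" if "i \<in> {1..k}" for i
    using that by simp
  have "?M \<in> v ` {1..k}" using s by (intro Max_in) auto
  then obtain m where m: "?P m" by auto
  show ?thesis
  proof (intro iffI ballI; (elim conjE)?)
    fix i assume L: "(LEAST i. ?P i) = s" "?M = q" and i: "i \<in> {1..k}"
    have "v s = ?M" using LeastI[of ?P, OF m] L(1) by simp
    moreover have "v i \<noteq> ?M" if "i < s" using not_less_Least[of i ?P] that L(1) i by auto
    ultimately show "if i = s then v i = q else if i < s then v i < q else v i \<le> q"
      using le[OF i] L(2) by auto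
  next
    assume A: "\<forall>i\<in>{1..k}. if i = s then v i = q else if i < s then v i < q else v i \<le> q"
    have M: "?M = q"
    proof (rule Max_eqI)
      show "q \<in> v ` {1..k}" using A s by force
    next
      fix y assume "y \<in> v ` {1..k}"
      then obtain i where "i \<in> {1..k}" "y = v i" by auto
      with A show "y \<le> q" by (metis less_imp_le order_refl)
    qed simp
    moreover have "(LEAST i. ?P i) = s"
    proof (rule Least_equality)
      show "?P s" using A s M by auto
    next
      fix y assume "?P y"
      then show "s \<le> y" using A M by (metis less_irrefl not_le)
    qed
    ultimately show "(LEAST i. ?P i) = s \<and> ?M = q" by blast
  qed
qed

fun block_cell :: "nat \<Rightarrow> (real list \<Rightarrow> vec) \<Rightarrow> (real \<Rightarrow> real) \<Rightarrow> nat \<Rightarrow> (nat \<times> real) list \<Rightarrow> vec \<Rightarrow> bool" where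
  "block_cell d X r i [] c = True"
| "block_cell d X r i (p # \<tau>) c =
    ((let v = r (inner_vec d c (X (map snd \<tau>)))
      in if i = fst p then v = snd p else if i < fst p then v < snd p else v \<le> snd p) \<and>
     block_cell d X r i \<tau> c)"

lemma block_cell_measurable [measurable]:
  assumes [measurable]: "r \<in> borel_measurable borel"
  shows "Measurable.pred (borel_vec d) (block_cell d X r i \<tau>)"
proof (induction \<tau>)
  case Nil
  have "block_cell d X r i [] = (\<lambda>_. True)" by (intro ext) simp
  then show ?case by simp
next
  case (Cons p \<tau>)
  note [measurable] = this
  show ?case
    unfolding block_cell.simps Let_def by measurable
qed

text \<open>\<open>X\<close> gives the next query from the list of earlier answers, latest first.
  Monotonicity lets \<open>r\<close> commute with the maximum, so a rounded answer is the maximum of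
  the rounded inner products; finite range makes every event about a run of fixed length a finite
  union of cells.\<close>

locale rounded_protocol =
  fixes d k :: nat and X :: "real list \<Rightarrow> vec" and r :: "real \<Rightarrow> real"
  assumes k: "1 \<le> k" and mono_r: "mono r" and finite_r: "finite (range r)"
begin

primrec run :: "(nat \<Rightarrow> vec) \<Rightarrow> nat \<Rightarrow> (nat \<times> real) list" where
  "run b 0 = []"
| "run b (Suc n) =
    (let x = X (map snd (run b n)); q = r (max_inner d k b x)
     in (LEAST i. i \<in> {1..k} \<and> r (inner_vec d (b i) x) = q, q) # run b n)"

lemma r_max_inner: "r (max_inner d k b x) = (MAX i\<in>{1..k}. r (inner_vec d (b i) x))"
  unfolding max_inner_def using k by (subst mono_Max_commute[OF mono_r]) (auto simp: image_image)

lemma run_in_transcripts: "run b n \<in> transcripts k (range r) n"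
proof (induction n)
  case (Suc n)
  let ?v = "\<lambda>i. r (inner_vec d (b i) (X (map snd (run b n))))"
  have "(MAX i\<in>{1..k}. ?v i) \<in> ?v ` {1..k}"
    using k by (intro Max_in) auto
  then have "\<exists>i. i \<in> {1..k} \<and> ?v i = (MAX i\<in>{1..k}. ?v i)" by auto
  from LeastI_ex[OF this]
  have "(LEAST i. i \<in> {1..k} \<and> ?v i = (MAX i\<in>{1..k}. ?v i)) \<in> {1..k}" by blast
  then show ?case using Suc unfolding r_max_inner[symmetric] by (simp add: transcripts_def Let_def)
qed (simp add: transcripts_def)

text \<open>Given the earlier entries, the next query is a fixed vector;
  \<open>first_argmax_iff\<close> then splits the latest entry into one condition for each
  block.\<close>

lemma run_eq_iff:
  assumes "\<tau> \<in> transcripts k (range r) n"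
  shows "run b n = \<tau> \<longleftrightarrow> (\<forall>i\<in>{1..k}. block_cell d X r i \<tau> (b i))"
  using assms
proof (induction n arbitrary: \<tau>)
  case 0
  then show ?case by (simp add: transcripts_0)
next
  case (Suc n)
  then obtain s q \<tau>' where \<tau>: "\<tau> = (s, q) # \<tau>'" "s \<in> {1..k}" "\<tau>' \<in> transcripts k (range r) n"
    by (auto simp: transcripts_Suc)
  show ?case
  proof (cases "run b n = \<tau>'")
    case True
    then have "run b (Suc n) = \<tau> \<longleftrightarrow>
      (LEAST i. i \<in> {1..k} \<and> r (inner_vec d (b i) (X (map snd \<tau>'))) = (MAX i\<in>{1..k}. r (inner_vec d (b i) (X (map snd \<tau>'))))) = s \<and>
      (MAX i\<in>{1..k}. r (inner_vec d (b i) (X (map snd \<tau>')))) = q"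
      by (simp add: \<tau>(1) Let_def r_max_inner del: One_nat_def)
    then show ?thesis
      unfolding first_argmax_iff[OF \<tau>(2)] using Suc.IH[OF \<tau>(3)] True
      by (simp add: \<tau>(1) Let_def ball_conj_distrib del: One_nat_def)
  next
    case False
    then have "\<not> (\<forall>i\<in>{1..k}. block_cell d X r i \<tau>' (b i))" using Suc.IH[OF \<tau>(3)] by blast
    with False show ?thesis unfolding \<tau>(1) run.simps block_cell.simps Let_def by blast
  qed
qed

text \<open>Only the condition on the vector with the listed index is kept, so that the set is
  unchanged by shifts orthogonal to the listed directions; a cell depends on the other vectors as
  well.\<close>

lemma index_cell_run:
  assumes "\<tau> \<in> transcripts k (range r) n" "run b n = \<tau>"
  shows "index_cell d X r \<tau> b"
proof -
  have "set \<tau>' \<subseteq> {1..k} \<times> range r \<Longrightarrow> (\<forall>i\<in>{1..k}. block_cell d X r i \<tau>' (b i)) \<Longrightarrow> index_cell d X r \<tau>' b" for \<tau>'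
    by (induction \<tau>') (fastforce simp: Let_def)+
  then show ?thesis
    using assms run_eq_iff[OF assms(1), of b] by (auto simp: transcripts_def)
qed

lemma finite_runs: "finite (transcripts k (range r) n)"
  by (intro finite_transcripts finite_r)

lemma r_measurable [measurable]: "r \<in> borel_measurable borel"
  using mono_r by (rule borel_measurable_mono)

sublocale prob_space "seed_law d k"
  by (rule prob_space_seed_law)

abbreviation P :: "(nat \<Rightarrow> vec) measure" where "P \<equiv> seed_law d k"

definition cell :: "(nat \<times> real) list \<Rightarrow> (nat \<Rightarrow> vec) set" where
  "cell \<tau> = {b \<in> space P. run b (length \<tau>) = \<tau>}"

text \<open>The conditional mean of the seed on the cell, entry by entry. On a null cell
  \<open>x / 0 = 0\<close> makes it 0, and \<open>weight_mean\<close> holds there too.\<close>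

definition mean :: "(nat \<times> real) list \<Rightarrow> nat \<Rightarrow> nat \<Rightarrow> real" where
  "mean \<tau> i j = (LINT b|P. indicator (cell \<tau>) b * b i j) / prob (cell \<tau>)"

lemma indicator_cell:
  assumes "\<tau> \<in> transcripts k (range r) n" "b \<in> space P"
  shows "indicator (cell \<tau>) b = (\<Prod>i=1..k. of_bool (block_cell d X r i \<tau> (b i)) :: real)"
  using assms run_eq_iff[OF assms(1), of b]
  by (auto simp: cell_def transcripts_def indicator_def prod_zero_iff)

lemma cell_measurable [measurable]:
  assumes "\<tau> \<in> transcripts k (range r) n"
  shows "cell \<tau> \<in> sets P"
proof -
  have "Measurable.pred P (\<lambda>b. block_cell d X r i \<tau> (b i))" if "i \<in> {1..k}" for i
    by (rule measurable_compose[OF component_measurable[OF that] block_cell_measurable[OF r_measurable]])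
  then have "{b \<in> space P. \<forall>i\<in>{1..k}. block_cell d X r i \<tau> (b i)} \<in> sets P"
    by (intro sets.sets_Collect_finite_All) (auto intro: measurable_sets_Collect)
  also have "{b \<in> space P. \<forall>i\<in>{1..k}. block_cell d X r i \<tau> (b i)} = cell \<tau>"
    using run_eq_iff[OF assms] assms by (auto simp: cell_def transcripts_def)
  finally show ?thesis .
qed

lemma integrable_entry:
  assumes "i \<in> {1..k}" "j \<in> {1..d}"
  shows "integrable P (\<lambda>b. b i j)"
  using AE_seed_law_bounded[of k d] assms
  by (intro integrable_const_bound[where B="2 * sqrt (real d)"]) (auto elim!: eventually_mono intro!: abs_component_le)

lemma integrable_entries:
  assumes "i \<in> {1..k}" "j \<in> {1..d}" "i' \<in> {1..k}" "j' \<in> {1..d}"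
  shows "integrable P (\<lambda>b. b i j * b i' j')"
proof (rule integrable_const_bound[where B="2 * sqrt (real d) * (2 * sqrt (real d))"])
  show "AE b in P. norm (b i j * b i' j') \<le> 2 * sqrt (real d) * (2 * sqrt (real d))"
    using AE_seed_law_bounded[of k d]
  proof eventually_elim
    fix b assume b: "\<forall>i\<in>{1..k}. inner_vec d (b i) (b i) \<le> 4 * real d"
    show "norm (b i j * b i' j') \<le> 2 * sqrt (real d) * (2 * sqrt (real d))"
      unfolding real_norm_def abs_mult
      by (intro mult_mono abs_component_le b[rule_format] assms) auto
  qed
qed (use assms in measurable)

lemma sum_cells:
  fixes h :: "(nat \<times> real) list \<Rightarrow> real"
  assumes "b \<in> space P"
  shows "(\<Sum>\<tau>\<in>transcripts k (range r) n. indicator (cell \<tau>) b * h \<tau>) = h (run b n)"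
proof -
  have "(\<Sum>\<tau>\<in>transcripts k (range r) n. indicator (cell \<tau>) b * h \<tau>)
      = (\<Sum>\<tau>\<in>transcripts k (range r) n. if run b n = \<tau> then h \<tau> else 0)"
    by (intro sum.cong refl) (auto simp: cell_def transcripts_def assms)
  then show ?thesis by (simp add: finite_runs run_in_transcripts)
qed

lemma integral_seed_law_prod:
  fixes g :: "nat \<Rightarrow> vec \<Rightarrow> real"
  assumes "\<And>i. i \<in> {1..k} \<Longrightarrow> integrable (truncated_gaussian d) (g i)"
  shows "(LINT b|P. (\<Prod>i=1..k. g i (b i))) = (\<Prod>i=1..k. (LINT c|truncated_gaussian d. g i c))"
proof -
  interpret product_prob_space "\<lambda>_. truncated_gaussian d" "{1..k}"
    by (intro product_prob_spaceI prob_space_truncated_gaussian)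
  show ?thesis unfolding seed_law_def
    by (rule product_integral_prod) (use assms in auto)
qed

lemma truncated_gaussian_integrable:
  fixes g :: "vec \<Rightarrow> real" and B :: real
  assumes [measurable]: "g \<in> borel_measurable (borel_vec d)"
    and "\<And>c. inner_vec d c c \<le> 4 * real d \<Longrightarrow> \<bar>g c\<bar> \<le> B"
  shows "integrable (truncated_gaussian d) g"
proof -
  interpret T: prob_space "truncated_gaussian d" by (rule prob_space_truncated_gaussian)
  have "g \<in> borel_measurable (truncated_gaussian d)"
    unfolding measurable_cong_sets[OF sets_truncated_gaussian refl] by fact
  then show ?thesis
    using AE_truncated_gaussian_bounded[of d]
    by (intro T.integrable_const_bound[where B=B]) (auto elim!: eventually_mono intro: assms(2))
qed

text \<open>A cell is a product of sets, one for each vector of the seed: distinct vectors stay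
  independent when conditioned on it. The identity is stated without division by \<open>prob (cell \<tau>)\<close>.\<close>

lemma cell_independence:
  assumes \<tau>: "\<tau> \<in> transcripts k (range r) n"
    and i: "i \<in> {1..k}" "i' \<in> {1..k}" "i \<noteq> i'" and j: "j \<in> {1..d}"
  shows "prob (cell \<tau>) * (LINT b|P. indicator (cell \<tau>) b * (b i j * b i' j)) =
    (LINT b|P. indicator (cell \<tau>) b * b i j) * (LINT b|P. indicator (cell \<tau>) b * b i' j)"
proof -
  let ?I = "\<lambda>l c. of_bool (block_cell d X r l \<tau> c) :: real"
  have [measurable]: "(\<lambda>c. c j) \<in> borel_measurable (borel_vec d)"
    using j by measurable
  note [measurable] = block_cell_measurable[OF r_measurable]
  \<comment> \<open>Taken at \<open>S = {}\<close>, \<open>{i}\<close>, \<open>{i'}\<close> and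
    \<open>{i, i'}\<close>, this writes all four integrals as products over the same blocks, so that
    the identity can be checked block by block.\<close>
  have E: "(LINT b|P. indicator (cell \<tau>) b * (\<Prod>l=1..k. if l \<in> S then b l j else 1))
    = (\<Prod>l=1..k. (LINT c|truncated_gaussian d. ?I l c * (if l \<in> S then c j else 1)))" for S
  proof -
    have "(LINT b|P. indicator (cell \<tau>) b * (\<Prod>l=1..k. if l \<in> S then b l j else 1))
      = (LINT b|P. (\<Prod>l=1..k. ?I l (b l) * (if l \<in> S then b l j else 1)))"
      by (intro Bochner_Integration.integral_cong refl) (simp add: indicator_cell[OF \<tau>] prod.distrib del: One_nat_def)
    also have "\<dots> = (\<Prod>l=1..k. (LINT c|truncated_gaussian d. ?I l c * (if l \<in> S then c j else 1)))"
    proof (rule integral_seed_law_prod, rule truncated_gaussian_integrable)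
      fix l and c :: vec assume "inner_vec d c c \<le> 4 * real d"
      from abs_component_le[OF this j]
      show "\<bar>?I l c * (if l \<in> S then c j else 1)\<bar> \<le> max 1 (2 * sqrt (real d))" by auto
    qed measurable
    finally show ?thesis .
  qed
  have p: "(\<Prod>l=1..k. if l \<in> {a} then b l j else 1) = b a j" if "a \<in> {1..k}" for a and b :: "nat \<Rightarrow> vec"
    using that by (simp add: prod.delta del: One_nat_def)
  have pp: "(\<Prod>l=1..k. if l \<in> {i, i'} then b l j else 1) = b i j * b i' j" for b :: "nat \<Rightarrow> vec"
  proof -
    have "(\<Prod>l=1..k. if l \<in> {i, i'} then b l j else 1) = (\<Prod>l\<in>{i, i'}. b l j)"
      using i by (subst prod.inter_restrict[symmetric]) (auto intro!: prod.cong)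
    then show ?thesis using i by simp
  qed
  have e0: "prob (cell \<tau>) = (\<Prod>l=1..k. (LINT c|truncated_gaussian d. ?I l c * 1))"
    using E[of "{}"] \<tau> by simp
  have e1: "(LINT b|P. indicator (cell \<tau>) b * b a j) = (\<Prod>l=1..k. (LINT c|truncated_gaussian d. ?I l c * (if l \<in> {a} then c j else 1)))"
    if "a \<in> {1..k}" for a
    by (subst p[OF that, symmetric]) (rule E)
  have e2: "(LINT b|P. indicator (cell \<tau>) b * (b i j * b i' j)) = (\<Prod>l=1..k. (LINT c|truncated_gaussian d. ?I l c * (if l \<in> {i, i'} then c j else 1)))"
    by (subst pp[symmetric]) (rule E)
  show ?thesis
    unfolding e0 e1[OF i(1)] e1[OF i(2)] e2 prod.distrib[symmetric]
  proof (intro prod.cong refl)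
    fix l
    show "(LINT c|truncated_gaussian d. ?I l c * 1) * (LINT c|truncated_gaussian d. ?I l c * (if l \<in> {i, i'} then c j else 1)) =
      (LINT c|truncated_gaussian d. ?I l c * (if l \<in> {i} then c j else 1)) *
      (LINT c|truncated_gaussian d. ?I l c * (if l \<in> {i'} then c j else 1))"
      using i(3) by (cases "l = i"; cases "l = i'") simp_all
  qed
qed

end

text \<open>Bounds the exponential moments summed over transcripts of length \<open>n\<close>:
  \<open>(4 / 3) ^ k\<close> pays for the truncation, \<open>real k * sqrt 2\<close> for the index
  and the direction of each query, and the single \<open>sqrt 2\<close> for the conditional mean,
  which is adjoined as an extra direction.\<close>

definition exp_bound :: "nat \<Rightarrow> nat \<Rightarrow> real" where
  "exp_bound k n = (4 / 3) ^ k * (sqrt 2 * (real k * sqrt 2) ^ n)"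

section \<open>Second moments of the conditional means\<close>

context rounded_protocol
begin

lemma integral_entry:
  assumes i: "i \<in> {1..k}" and j: "j \<in> {1..d}"
  shows "(LINT b|P. b i j) = 0"
proof -
  interpret product_prob_space "\<lambda>_. truncated_gaussian d" "{1..k}"
    by (intro product_prob_spaceI prob_space_truncated_gaussian)
  have [measurable]: "(\<lambda>c. c j) \<in> borel_measurable (truncated_gaussian d)"
    unfolding measurable_cong_sets[OF sets_truncated_gaussian refl] using j by measurable
  have "(LINT c|distr P (truncated_gaussian d) (\<lambda>b. b i). c j) = (LINT b|P. b i j)"
    unfolding seed_law_def using i by (subst integral_distr) auto
  moreover have "distr P (truncated_gaussian d) (\<lambda>b. b i) = truncated_gaussian d"
    unfolding seed_law_def by (rule PiM_component[OF i])
  ultimately show ?thesis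
    using integral_truncated_gaussian_component[OF j] by simp
qed

lemma integrable_cell_mult:
  assumes "\<tau> \<in> transcripts k (range r) n" "integrable P f"
  shows "integrable P (\<lambda>b. indicator (cell \<tau>) b * f b :: real)"
  using integrable_real_mult_indicator[OF cell_measurable[OF assms(1)] assms(2)] by (simp add: mult.commute)

lemma integral_cell_null:
  fixes f :: "(nat \<Rightarrow> vec) \<Rightarrow> real"
  assumes "\<tau> \<in> transcripts k (range r) n" "prob (cell \<tau>) = 0"
  shows "(LINT b|P. indicator (cell \<tau>) b * f b) = 0"
proof -
  have "AE b in P. b \<notin> cell \<tau>"
    using assms by (subst prob_eq_0[symmetric]) auto
  then show ?thesis
    by (intro integral_eq_zero_AE) (auto elim!: eventually_mono)
qed

lemma weight_mean:
  assumes "\<tau> \<in> transcripts k (range r) n"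
  shows "prob (cell \<tau>) * mean \<tau> i j = (LINT b|P. indicator (cell \<tau>) b * b i j)"
  using integral_cell_null[OF assms, of "\<lambda>b. b i j"] by (cases "prob (cell \<tau>) = 0") (simp_all add: mean_def)

lemma integral_sum_cells:
  fixes f :: "(nat \<Rightarrow> vec) \<Rightarrow> real"
  assumes "integrable P f"
  shows "(\<Sum>\<tau>\<in>transcripts k (range r) n. LINT b|P. indicator (cell \<tau>) b * f b) = (LINT b|P. f b)"
proof -
  have "(\<Sum>\<tau>\<in>transcripts k (range r) n. LINT b|P. indicator (cell \<tau>) b * f b)
      = (LINT b|P. (\<Sum>\<tau>\<in>transcripts k (range r) n. indicator (cell \<tau>) b * f b))"
    by (rule Bochner_Integration.integral_sum[symmetric]) (rule integrable_cell_mult[OF _ assms])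
  also have "\<dots> = (LINT b|P. f b)"
    by (intro Bochner_Integration.integral_cong refl) (rule sum_cells)
  finally show ?thesis .
qed

lemma sum_prob_cells: "(\<Sum>\<tau>\<in>transcripts k (range r) n. prob (cell \<tau>)) = 1"
  using integral_sum_cells[of "\<lambda>_. 1" n] by (simp add: prob_space)

lemma integral_cell_linear:
  fixes c :: "nat \<Rightarrow> nat \<Rightarrow> real"
  assumes \<tau>: "\<tau> \<in> transcripts k (range r) n"
  shows "integrable P (\<lambda>b. indicator (cell \<tau>) b * (\<Sum>i=1..k. \<Sum>j=1..d. b i j * c i j))"
    and "(LINT b|P. indicator (cell \<tau>) b * (\<Sum>i=1..k. \<Sum>j=1..d. b i j * c i j)) =
      prob (cell \<tau>) * (\<Sum>i=1..k. \<Sum>j=1..d. mean \<tau> i j * c i j)"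
proof -
  have int: "integrable P (\<lambda>b. indicator (cell \<tau>) b * b i j * c i j)" if "i \<in> {1..k}" "j \<in> {1..d}" for i j
    by (intro integrable_mult_left integrable_cell_mult[OF \<tau>] integrable_entry that)
  have eq: "indicator (cell \<tau>) b * (\<Sum>i=1..k. \<Sum>j=1..d. b i j * c i j) = (\<Sum>i=1..k. \<Sum>j=1..d. indicator (cell \<tau>) b * b i j * c i j)" for b
    by (simp add: sum_distrib_left mult.assoc)
  show "integrable P (\<lambda>b. indicator (cell \<tau>) b * (\<Sum>i=1..k. \<Sum>j=1..d. b i j * c i j))"
    unfolding eq by (intro Bochner_Integration.integrable_sum int)
  have "(LINT b|P. indicator (cell \<tau>) b * (\<Sum>i=1..k. \<Sum>j=1..d. b i j * c i j))
      = (\<Sum>i=1..k. LINT b|P. (\<Sum>j=1..d. indicator (cell \<tau>) b * b i j * c i j))"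
    unfolding eq by (rule Bochner_Integration.integral_sum) (intro Bochner_Integration.integrable_sum int)
  also have "\<dots> = (\<Sum>i=1..k. \<Sum>j=1..d. LINT b|P. indicator (cell \<tau>) b * b i j * c i j)"
    by (intro sum.cong refl Bochner_Integration.integral_sum int)
  also have "\<dots> = prob (cell \<tau>) * (\<Sum>i=1..k. \<Sum>j=1..d. mean \<tau> i j * c i j)"
    unfolding integral_mult_left_zero weight_mean[OF \<tau>, symmetric] by (simp only: sum_distrib_left mult.assoc)
  finally show "(LINT b|P. indicator (cell \<tau>) b * (\<Sum>i=1..k. \<Sum>j=1..d. b i j * c i j)) =
      prob (cell \<tau>) * (\<Sum>i=1..k. \<Sum>j=1..d. mean \<tau> i j * c i j)" .
qed

text \<open>On each cell, independence turns the product of the means into the mean of the product;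
  summed over the cells this is the unconditional covariance, which is 0.\<close>

lemma sum_mean_cross:
  assumes i: "i \<in> {1..k}" "i' \<in> {1..k}" "i \<noteq> i'" and j: "j \<in> {1..d}"
  shows "(\<Sum>\<tau>\<in>transcripts k (range r) n. prob (cell \<tau>) * (mean \<tau> i j * mean \<tau> i' j)) = 0"
proof -
  have "(\<Sum>\<tau>\<in>transcripts k (range r) n. prob (cell \<tau>) * (mean \<tau> i j * mean \<tau> i' j))
      = (\<Sum>\<tau>\<in>transcripts k (range r) n. LINT b|P. indicator (cell \<tau>) b * (b i j * b i' j))"
  proof (rule sum.cong[OF refl])
    fix \<tau> assume \<tau>: "\<tau> \<in> transcripts k (range r) n"
    show "prob (cell \<tau>) * (mean \<tau> i j * mean \<tau> i' j) = (LINT b|P. indicator (cell \<tau>) b * (b i j * b i' j))"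
    proof (cases "prob (cell \<tau>) = 0")
      case True
      then show ?thesis using integral_cell_null[OF \<tau> True] by simp
    next
      case False
      let ?w = "prob (cell \<tau>)"
      have "?w * (LINT b|P. indicator (cell \<tau>) b * (b i j * b i' j)) = (?w * mean \<tau> i j) * (?w * mean \<tau> i' j)"
        using cell_independence[OF \<tau> i j] by (simp only: weight_mean[OF \<tau>])
      also have "\<dots> = ?w * (?w * (mean \<tau> i j * mean \<tau> i' j))"
        by (simp only: mult_ac)
      finally show ?thesis using False by simp
    qed
  qed
  also have "\<dots> = (LINT b|P. b i j * b i' j)"
    by (rule integral_sum_cells) (intro integrable_entries i j)
  also have "\<dots> = 0"
  proof -
    \<comment> \<open>The empty transcript has the whole space as its cell, so unconditional
      independence is a special case of \<open>cell_independence\<close>.\<close>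
    have *: "(LINT b|P. indicator (cell []) b * f b) = (LINT b|P. f b)" for f :: "_ \<Rightarrow> real"
      by (intro Bochner_Integration.integral_cong refl) (simp add: cell_def)
    have "cell [] = space P" by (simp add: cell_def)
    then show ?thesis
      using cell_independence[of "[]" 0, OF _ i j] unfolding *
      by (simp add: transcripts_0 prob_space integral_entry[OF i(1) j])
  qed
  finally show ?thesis .
qed

lemma sum_mean_square:
  "(\<Sum>\<tau>\<in>transcripts k (range r) n. prob (cell \<tau>) * (\<Sum>j=1..d. (\<Sum>i=1..k. mean \<tau> i j)\<^sup>2)) =
   (\<Sum>\<tau>\<in>transcripts k (range r) n. prob (cell \<tau>) * inner_seed d k (mean \<tau>) (mean \<tau>))"
proof -
  let ?T = "transcripts k (range r) n"
  have "(\<Sum>\<tau>\<in>?T. prob (cell \<tau>) * (\<Sum>j=1..d. (\<Sum>i=1..k. mean \<tau> i j)\<^sup>2))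
    = (\<Sum>\<tau>\<in>?T. \<Sum>j=1..d. \<Sum>i=1..k. \<Sum>i'=1..k. prob (cell \<tau>) * (mean \<tau> i j * mean \<tau> i' j))"
    unfolding power2_eq_square sum_product by (simp only: sum_distrib_left)
  also have "\<dots> = (\<Sum>j=1..d. \<Sum>i=1..k. \<Sum>i'=1..k. \<Sum>\<tau>\<in>?T. prob (cell \<tau>) * (mean \<tau> i j * mean \<tau> i' j))"
    by (simp only: sum.swap[where A="?T"])
  also have "\<dots> = (\<Sum>j=1..d. \<Sum>i=1..k. \<Sum>\<tau>\<in>?T. prob (cell \<tau>) * (mean \<tau> i j * mean \<tau> i j))"
  proof (intro sum.cong refl)
    fix j i assume "j \<in> {1..d}" and i: "i \<in> {1..k}"
    then have "(\<Sum>i'=1..k. \<Sum>\<tau>\<in>?T. prob (cell \<tau>) * (mean \<tau> i j * mean \<tau> i' j))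
      = (\<Sum>i'=1..k. if i' = i then \<Sum>\<tau>\<in>?T. prob (cell \<tau>) * (mean \<tau> i j * mean \<tau> i j) else 0)"
      by (intro sum.cong refl) (auto intro: sum_mean_cross)
    then show "(\<Sum>i'=1..k. \<Sum>\<tau>\<in>?T. prob (cell \<tau>) * (mean \<tau> i j * mean \<tau> i' j)) =
      (\<Sum>\<tau>\<in>?T. prob (cell \<tau>) * (mean \<tau> i j * mean \<tau> i j))"
      using i by simp
  qed
  also have "\<dots> = (\<Sum>\<tau>\<in>?T. \<Sum>j=1..d. \<Sum>i=1..k. prob (cell \<tau>) * (mean \<tau> i j * mean \<tau> i j))"
    by (simp only: sum.swap[where B="?T"])
  also have "\<dots> = (\<Sum>\<tau>\<in>?T. prob (cell \<tau>) * inner_seed d k (mean \<tau>) (mean \<tau>))"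
    unfolding inner_seed_def inner_vec_def sum_distrib_left by (intro sum.cong refl sum.swap)
  finally show ?thesis .
qed

lemma sum_cell_exp_bessel:
  "(\<Sum>\<tau>\<in>transcripts k (range r) n. \<integral>\<^sup>+b. indicator (cell \<tau>) b * ennreal (exp (bessel_sum d k (v \<tau> # directions X \<tau>) b / 4)) \<partial>P)
    \<le> ennreal (exp_bound k n)"
proof -
  let ?T = "transcripts k (range r) n"
  let ?E = "\<lambda>vs b. ennreal (exp (bessel_sum d k vs b / 4))"
  have "(\<integral>\<^sup>+b. indicator (cell \<tau>) b * ?E (v \<tau> # directions X \<tau>) b \<partial>P) \<le>
      ennreal ((4 / 3) ^ k) * (ennreal (sqrt 2) * (\<integral>\<^sup>+b. of_bool (index_cell d X r \<tau> b) * ?E (directions X \<tau>) b \<partial>gaussian_seed d k))"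
    if \<tau>: "\<tau> \<in> ?T" for \<tau>
  proof -
    have \<tau>': "set \<tau> \<subseteq> {1..k} \<times> range r" using \<tau> by (simp add: transcripts_def)
    note [measurable] = index_cell_measurable[OF r_measurable \<tau>']
    have "(\<integral>\<^sup>+b. indicator (cell \<tau>) b * ?E (v \<tau> # directions X \<tau>) b \<partial>P)
      \<le> (\<integral>\<^sup>+b. of_bool (index_cell d X r \<tau> b) * ?E (v \<tau> # directions X \<tau>) b \<partial>P)"
    proof (intro nn_integral_mono mult_right_mono)
      fix b
      show "indicator (cell \<tau>) b \<le> (of_bool (index_cell d X r \<tau> b) :: ennreal)"
        using index_cell_run[OF \<tau>, of b] \<tau> by (auto simp: cell_def indicator_def transcripts_def)
    qed simp
    also have "\<dots> \<le> ennreal ((4 / 3) ^ k) * (\<integral>\<^sup>+b. of_bool (index_cell d X r \<tau> b) * ?E (v \<tau> # directions X \<tau>) b \<partial>gaussian_seed d k)"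
      by (rule nn_integral_seed_law_le) measurable
    also have "\<dots> \<le> ennreal ((4 / 3) ^ k) * (ennreal (sqrt 2) * (\<integral>\<^sup>+b. of_bool (index_cell d X r \<tau> b) * ?E (directions X \<tau>) b \<partial>gaussian_seed d k))"
      by (intro mult_left_mono nn_integral_cell_exp_step[OF r_measurable \<tau>']) simp
    finally show ?thesis .
  qed
  then have "(\<Sum>\<tau>\<in>?T. \<integral>\<^sup>+b. indicator (cell \<tau>) b * ?E (v \<tau> # directions X \<tau>) b \<partial>P) \<le>
      (\<Sum>\<tau>\<in>?T. ennreal ((4 / 3) ^ k) * (ennreal (sqrt 2) * (\<integral>\<^sup>+b. of_bool (index_cell d X r \<tau> b) * ?E (directions X \<tau>) b \<partial>gaussian_seed d k)))"
    by (rule sum_mono)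
  also have "\<dots> = ennreal ((4 / 3) ^ k) * (ennreal (sqrt 2) * (\<Sum>\<tau>\<in>?T. \<integral>\<^sup>+b. of_bool (index_cell d X r \<tau> b) * ?E (directions X \<tau>) b \<partial>gaussian_seed d k))"
    by (simp add: sum_distrib_left)
  also have "\<dots> \<le> ennreal ((4 / 3) ^ k) * (ennreal (sqrt 2) * (ennreal (real k * sqrt 2)) ^ n)"
    by (intro mult_left_mono sum_cell_exp_le r_measurable finite_r order_refl) auto
  also have "\<dots> = ennreal (exp_bound k n)"
    unfolding exp_bound_def by (subst ennreal_power, simp, (subst ennreal_mult, simp, simp)+) simp
  finally show ?thesis .
qed

lemma exp_bound_pos: "0 < exp_bound k n"
  using k by (simp add: exp_bound_def)

text \<open>The mean of \<open>inner_seed d k b (mean \<tau>)\<close> over a cell is the squared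
  norm of \<open>mean \<tau>\<close>. By \<open>inner_seed_le_bessel_sum\<close> this norm is at
  most the mean squared projection, whose exponential moment is known. The conditional mean may lie
  outside the span of the listed directions, because the other vectors are constrained as well; this
  is why it is adjoined to them.\<close>

lemma sum_mean_inner_le:
  "(\<Sum>\<tau>\<in>transcripts k (range r) n. prob (cell \<tau>) * inner_seed d k (mean \<tau>) (mean \<tau>)) \<le> 4 * ln (exp_bound k n)"
proof -
  let ?T = "transcripts k (range r) n"
  define B where "B \<tau> b = bessel_sum d k (mean \<tau> # directions X \<tau>) b" for \<tau> b
  define I where "I \<tau> b = (indicator (cell \<tau>) b :: real)" for \<tau> b
  have [measurable]: "B \<tau> \<in> borel_measurable P" for \<tau>
    unfolding B_def measurable_cong_sets[OF sets_seed_law refl] by measurable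
  have [measurable]: "I \<tau> \<in> borel_measurable P" if "\<tau> \<in> ?T" for \<tau>
    unfolding I_def using that by measurable
  have B0: "0 \<le> B \<tau> b" for \<tau> b
    unfolding B_def bessel_sum_def by (intro sum_list_nonneg) auto
  have I0: "0 \<le> I \<tau> b" for \<tau> b by (simp add: I_def)
  have nn: "(\<integral>\<^sup>+b. ennreal (I \<tau> b * exp (B \<tau> b / 4)) \<partial>P) = (\<integral>\<^sup>+b. indicator (cell \<tau>) b * ennreal (exp (bessel_sum d k (mean \<tau> # directions X \<tau>) b / 4)) \<partial>P)" for \<tau>
    by (intro nn_integral_cong) (auto simp: I_def B_def indicator_def)
  have exp_sum: "(\<Sum>\<tau>\<in>?T. \<integral>\<^sup>+b. ennreal (I \<tau> b * exp (B \<tau> b / 4)) \<partial>P) \<le> ennreal (exp_bound k n)"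
    unfolding nn by (rule sum_cell_exp_bessel)
  have int_exp: "integrable P (\<lambda>b. I \<tau> b * exp (B \<tau> b / 4))" if \<tau>: "\<tau> \<in> ?T" for \<tau>
  proof (rule integrableI_bounded)
    show "(\<lambda>b. I \<tau> b * exp (B \<tau> b / 4)) \<in> borel_measurable P" using \<tau> by measurable
    have "(\<integral>\<^sup>+b. ennreal (I \<tau> b * exp (B \<tau> b / 4)) \<partial>P) \<le> (\<Sum>\<tau>\<in>?T. \<integral>\<^sup>+b. ennreal (I \<tau> b * exp (B \<tau> b / 4)) \<partial>P)"
      by (rule member_le_sum[OF \<tau>]) (auto simp: finite_runs)
    also note exp_sum
    finally show "(\<integral>\<^sup>+b. ennreal (norm (I \<tau> b * exp (B \<tau> b / 4))) \<partial>P) < \<infinity>"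
      using I0 by (simp add: abs_mult le_less_trans)
  qed
  have sum_exp: "(\<Sum>\<tau>\<in>?T. LINT b|P. I \<tau> b * exp (B \<tau> b / 4)) \<le> exp_bound k n"
  proof -
    have "ennreal (\<Sum>\<tau>\<in>?T. LINT b|P. I \<tau> b * exp (B \<tau> b / 4)) = (\<Sum>\<tau>\<in>?T. ennreal (LINT b|P. I \<tau> b * exp (B \<tau> b / 4)))"
      using I0 by (intro sum_ennreal[symmetric] integral_nonneg_AE) simp
    also have "\<dots> = (\<Sum>\<tau>\<in>?T. \<integral>\<^sup>+b. ennreal (I \<tau> b * exp (B \<tau> b / 4)) \<partial>P)"
      using I0 by (intro sum.cong refl nn_integral_eq_integral[symmetric] int_exp) auto
    also note exp_sum
    finally show ?thesis using exp_bound_pos[of n] by (simp add: ennreal_le_iff)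
  qed
  have int_B: "integrable P (\<lambda>b. I \<tau> b * B \<tau> b)" if \<tau>: "\<tau> \<in> ?T" for \<tau>
  proof (rule Bochner_Integration.integrable_bound[OF integrable_mult_right[OF int_exp[OF \<tau>], of 4]])
    show "(\<lambda>b. I \<tau> b * B \<tau> b) \<in> borel_measurable P" using \<tau> by measurable
    have "B \<tau> b \<le> 4 * exp (B \<tau> b / 4)" for b
      using exp_ge_add_one_self[of "B \<tau> b / 4"] by linarith
    then show "AE b in P. norm (I \<tau> b * B \<tau> b) \<le> norm (4 * (I \<tau> b * exp (B \<tau> b / 4)))"
      using B0 I0 by (auto simp: abs_mult mult.left_commute intro!: mult_left_mono)
  qed
  have int_I: "integrable P (I \<tau>)" if "\<tau> \<in> ?T" for \<tau>
    using integrable_cell_mult[OF that, of "\<lambda>_. 1"] by (simp add: I_def[abs_def])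
  have LI: "(LINT b|P. I \<tau> b) = prob (cell \<tau>)" if "\<tau> \<in> ?T" for \<tau>
    unfolding I_def using that by simp
  \<comment> \<open>Averaged over the cell, the left side gives twice the squared norm of the mean,
    and one copy of it comes back on the right.\<close>
  have mean: "prob (cell \<tau>) * inner_seed d k (mean \<tau>) (mean \<tau>) \<le> (LINT b|P. I \<tau> b * B \<tau> b)" if \<tau>: "\<tau> \<in> ?T" for \<tau>
  proof -
    let ?m = "inner_seed d k (mean \<tau>) (mean \<tau>)"
    have int_in: "integrable P (\<lambda>b. I \<tau> b * inner_seed d k b (mean \<tau>))"
      and e: "(LINT b|P. I \<tau> b * inner_seed d k b (mean \<tau>)) = prob (cell \<tau>) * ?m"
      using integral_cell_linear[OF \<tau>, of "mean \<tau>"] unfolding I_def inner_seed_def inner_vec_def by blast+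
    have "2 * (prob (cell \<tau>) * ?m) = (LINT b|P. 2 * (I \<tau> b * inner_seed d k b (mean \<tau>)))"
      using e by simp
    also have "\<dots> \<le> (LINT b|P. I \<tau> b * ?m + I \<tau> b * B \<tau> b)"
    proof (intro integral_mono)
      fix b
      show "2 * (I \<tau> b * inner_seed d k b (mean \<tau>)) \<le> I \<tau> b * ?m + I \<tau> b * B \<tau> b"
        using mult_left_mono[OF inner_seed_le_bessel_sum[of d k b "mean \<tau>" "directions X \<tau>"] I0[of \<tau> b]]
        by (simp add: B_def algebra_simps)
    qed (intro int_in Bochner_Integration.integrable_add integrable_mult_right integrable_mult_left int_I int_B \<tau>)+
    also have "\<dots> = prob (cell \<tau>) * ?m + (LINT b|P. I \<tau> b * B \<tau> b)"
      using \<tau> by (subst Bochner_Integration.integral_add) (auto intro!: int_I int_B simp: LI)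
    finally show ?thesis by simp
  qed
  let ?a = "ln (exp_bound k n)"
  \<comment> \<open>Jensen's inequality in tangent form: \<open>1 + x \<le> exp x\<close> at
    \<open>x = B \<tau> b / 4 - ?a\<close>. With this choice of \<open>?a\<close> the right-hand
    sides sum to at most 1.\<close>
  have jensen: "prob (cell \<tau>) * (1 - ?a) + (LINT b|P. I \<tau> b * B \<tau> b) / 4 \<le> (LINT b|P. I \<tau> b * exp (B \<tau> b / 4)) / exp_bound k n"
    if \<tau>: "\<tau> \<in> ?T" for \<tau>
  proof -
    have "prob (cell \<tau>) * (1 - ?a) + (LINT b|P. I \<tau> b * B \<tau> b) / 4 = (LINT b|P. I \<tau> b * (1 - ?a) + I \<tau> b * B \<tau> b / 4)"
      using \<tau> by (subst Bochner_Integration.integral_add) (auto intro!: int_I int_B simp: LI)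
    also have "\<dots> \<le> (LINT b|P. I \<tau> b * exp (B \<tau> b / 4) / exp_bound k n)"
    proof (intro integral_mono)
      fix b
      have "1 + (B \<tau> b / 4 - ?a) \<le> exp (B \<tau> b / 4 - ?a)" by (rule exp_ge_add_one_self)
      also have "\<dots> = exp (B \<tau> b / 4) / exp_bound k n" using exp_bound_pos[of n] by (simp add: exp_diff)
      finally have "I \<tau> b * (1 + (B \<tau> b / 4 - ?a)) \<le> I \<tau> b * (exp (B \<tau> b / 4) / exp_bound k n)"
        by (rule mult_left_mono[OF _ I0])
      then show "I \<tau> b * (1 - ?a) + I \<tau> b * B \<tau> b / 4 \<le> I \<tau> b * exp (B \<tau> b / 4) / exp_bound k n"
        by (simp add: algebra_simps)
    qed (intro Bochner_Integration.integrable_add integrable_mult_left integrable_divide int_I int_B int_exp \<tau>)+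
    finally show ?thesis by simp
  qed
  have "(\<Sum>\<tau>\<in>?T. prob (cell \<tau>) * (1 - ?a) + (LINT b|P. I \<tau> b * B \<tau> b) / 4) \<le> (\<Sum>\<tau>\<in>?T. (LINT b|P. I \<tau> b * exp (B \<tau> b / 4)) / exp_bound k n)"
    by (intro sum_mono jensen)
  also have "\<dots> \<le> 1"
    using sum_exp exp_bound_pos[of n] by (simp add: sum_divide_distrib[symmetric])
  also have "(\<Sum>\<tau>\<in>?T. prob (cell \<tau>) * (1 - ?a) + (LINT b|P. I \<tau> b * B \<tau> b) / 4) = (1 - ?a) + (\<Sum>\<tau>\<in>?T. LINT b|P. I \<tau> b * B \<tau> b) / 4"
    by (simp add: sum.distrib sum_divide_distrib sum_distrib_right[symmetric] sum_prob_cells)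
  finally have "(\<Sum>\<tau>\<in>?T. LINT b|P. I \<tau> b * B \<tau> b) \<le> 4 * ?a" by simp
  moreover have "(\<Sum>\<tau>\<in>?T. prob (cell \<tau>) * inner_seed d k (mean \<tau>) (mean \<tau>)) \<le> (\<Sum>\<tau>\<in>?T. LINT b|P. I \<tau> b * B \<tau> b)"
    by (intro sum_mono mean)
  ultimately show ?thesis by simp
qed

text \<open>The output is query number \<open>n + 1\<close>, hence \<open>Suc n\<close>: its rounded
  value is in the transcript, and the event is a union of cells. On each of them the averaged
  inequalities and Cauchy-Schwarz bound the norm of the sum of the means from below. The factor 16
  is 4 from the squared norm of \<open>x\<close> times 4 from
  \<open>sum_mean_inner_le\<close>.\<close>

lemma prob_rounded_success:
  assumes neg: "\<And>y. r y < 0 \<Longrightarrow> y \<le> r y" and s: "0 \<le> s"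
  shows "prob {b \<in> space P. let x = X (map snd (run b n)) in r (max_inner d k b x) < - s \<and> inner_vec d x x \<le> 4} * (real k * s)\<^sup>2
    \<le> 16 * ln (exp_bound k (Suc n))"
proof -
  let ?T = "transcripts k (range r) (Suc n)"
  define S where "S \<tau> \<longleftrightarrow> (let x = X (map snd (tl \<tau>)) in snd (hd \<tau>) < - s \<and> inner_vec d x x \<le> 4)" for \<tau> :: "(nat \<times> real) list"
  have set_eq: "{b \<in> space P. let x = X (map snd (run b n)) in r (max_inner d k b x) < - s \<and> inner_vec d x x \<le> 4}
      = {b \<in> space P. S (run b (Suc n))}"
    by (simp add: S_def Let_def)
  have U: "{b \<in> space P. S (run b (Suc n))} = (\<Union>\<tau>\<in>{\<tau>\<in>?T. S \<tau>}. cell \<tau>)"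
    using run_in_transcripts[of _ "Suc n"] by (auto simp: cell_def transcripts_def simp del: run.simps)
  have "prob {b \<in> space P. S (run b (Suc n))} = (\<Sum>\<tau>\<in>{\<tau>\<in>?T. S \<tau>}. prob (cell \<tau>))"
    unfolding U
  proof (rule finite_measure_finite_Union)
    show "finite {\<tau> \<in> ?T. S \<tau>}" using finite_runs[of "Suc n"] by (rule rev_finite_subset) auto
    show "cell ` {\<tau> \<in> ?T. S \<tau>} \<subseteq> events" by (auto intro: cell_measurable)
    show "disjoint_family_on cell {\<tau> \<in> ?T. S \<tau>}"
      by (auto simp: disjoint_family_on_def cell_def transcripts_def simp del: run.simps)
  qed
  then have "prob {b \<in> space P. S (run b (Suc n))} * (real k * s)\<^sup>2 = (\<Sum>\<tau>\<in>{\<tau>\<in>?T. S \<tau>}. prob (cell \<tau>) * (real k * s)\<^sup>2)"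
    by (simp add: sum_distrib_right)
  also have "\<dots> \<le> (\<Sum>\<tau>\<in>{\<tau>\<in>?T. S \<tau>}. 4 * (prob (cell \<tau>) * (\<Sum>j=1..d. (\<Sum>i=1..k. mean \<tau> i j)\<^sup>2)))"
  proof (rule sum_mono)
    fix \<tau> assume "\<tau> \<in> {\<tau>\<in>?T. S \<tau>}"
    then have \<tau>: "\<tau> \<in> ?T" and "S \<tau>" by auto
    define x where "x = X (map snd (tl \<tau>))"
    have x: "snd (hd \<tau>) < - s" "inner_vec d x x \<le> 4" using \<open>S \<tau>\<close> by (auto simp: S_def Let_def x_def)
    show "prob (cell \<tau>) * (real k * s)\<^sup>2 \<le> 4 * (prob (cell \<tau>) * (\<Sum>j=1..d. (\<Sum>i=1..k. mean \<tau> i j)\<^sup>2))"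
    proof (cases "prob (cell \<tau>) = 0")
      case False
      then have pos: "0 < prob (cell \<tau>)" by (simp add: zero_less_measure_iff)
      have le: "(\<Sum>i=1..k. inner_vec d (b i) x) \<le> - (real k * s)" if b: "b \<in> cell \<tau>" for b
      proof -
        have q: "snd (hd \<tau>) = r (max_inner d k b x)"
        proof -
          have "run b (Suc n) = \<tau>" using b \<tau> by (simp add: cell_def transcripts_def del: run.simps)
          then show ?thesis by (auto simp: x_def Let_def)
        qed
        have "r (max_inner d k b x) < 0" using x(1) s q by linarith
        \<comment> \<open>A negative rounded answer is never below the exact one, so the exact
          maximum is at most \<open>- s\<close> too.\<close>
        then have m: "max_inner d k b x \<le> - s" using neg[of "max_inner d k b x"] q x(1) by linarith
        have "inner_vec d (b i) x \<le> - s" if "i \<in> {1..k}" for i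
          using m Max_ge[of "(\<lambda>i. inner_vec d (b i) x) ` {1..k}" "inner_vec d (b i) x"] that
          unfolding max_inner_def by fastforce
        then have "(\<Sum>i=1..k. inner_vec d (b i) x) \<le> (\<Sum>i=1..k. - s)" by (rule sum_mono)
        then show ?thesis by simp
      qed
      have int_in: "integrable P (\<lambda>b. indicator (cell \<tau>) b * (\<Sum>i=1..k. inner_vec d (b i) x))"
        and L: "(LINT b|P. indicator (cell \<tau>) b * (\<Sum>i=1..k. inner_vec d (b i) x)) = prob (cell \<tau>) * (\<Sum>i=1..k. \<Sum>j=1..d. mean \<tau> i j * x j)"
        using integral_cell_linear[OF \<tau>, of "\<lambda>_. x"] unfolding inner_vec_def by blast+
      have "(LINT b|P. indicator (cell \<tau>) b * (\<Sum>i=1..k. inner_vec d (b i) x)) \<le> (LINT b|P. indicator (cell \<tau>) b * (- (real k * s)))"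
        by (intro integral_mono int_in integrable_cell_mult[OF \<tau>]) (auto simp: indicator_def le simp del: One_nat_def)
      also have "\<dots> = prob (cell \<tau>) * (- (real k * s))" using \<tau> by simp
      finally have "(\<Sum>i=1..k. \<Sum>j=1..d. mean \<tau> i j * x j) \<le> - (real k * s)"
        unfolding L using pos by (rule mult_left_le_imp_le)
      moreover have "(\<Sum>i=1..k. \<Sum>j=1..d. mean \<tau> i j * x j) = (\<Sum>j=1..d. (\<Sum>i=1..k. mean \<tau> i j) * x j)"
        by (subst sum.swap) (simp add: sum_distrib_right)
      ultimately have "real k * s \<le> \<bar>\<Sum>j=1..d. (\<Sum>i=1..k. mean \<tau> i j) * x j\<bar>" by linarith
      then have "(real k * s)\<^sup>2 \<le> (\<Sum>j=1..d. (\<Sum>i=1..k. mean \<tau> i j) * x j)\<^sup>2"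
        using s power_mono[of "real k * s" _ 2] by (metis mult_nonneg_nonneg of_nat_0_le_iff power2_abs)
      also have "\<dots> \<le> (\<Sum>j=1..d. (\<Sum>i=1..k. mean \<tau> i j)\<^sup>2) * (\<Sum>j=1..d. (x j)\<^sup>2)"
        by (rule Cauchy_Schwarz_ineq_sum)
      also have "\<dots> \<le> (\<Sum>j=1..d. (\<Sum>i=1..k. mean \<tau> i j)\<^sup>2) * 4"
        using x(2) by (intro mult_left_mono sum_nonneg) (auto simp: inner_vec_def power2_eq_square)
      finally show ?thesis using pos by simp
    qed simp
  qed
  also have "\<dots> \<le> (\<Sum>\<tau>\<in>?T. 4 * (prob (cell \<tau>) * (\<Sum>j=1..d. (\<Sum>i=1..k. mean \<tau> i j)\<^sup>2)))"
    by (intro sum_mono2) (auto simp: finite_runs intro!: sum_nonneg mult_nonneg_nonneg)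
  also have "\<dots> = 4 * (\<Sum>\<tau>\<in>?T. prob (cell \<tau>) * inner_seed d k (mean \<tau>) (mean \<tau>))"
    by (simp only: sum_distrib_left[symmetric] sum_mean_square)
  also have "\<dots> \<le> 16 * ln (exp_bound k (Suc n))"
    using sum_mean_inner_le[of "Suc n"] by simp
  finally show ?thesis unfolding set_eq .
qed

end

section \<open>The minimum of the hard function\<close>

definition combination :: "nat \<Rightarrow> (nat \<Rightarrow> real) \<Rightarrow> (nat \<Rightarrow> vec) \<Rightarrow> vec" where
  "combination k z b = (\<lambda>j. \<Sum>i=1..k. z i * b i j)"

lemma combination_square_measurable [measurable]:
  "(\<lambda>b. inner_vec d (combination k z b) (combination k z b)) \<in> borel_measurable (PiM {1..k} (\<lambda>_. borel_vec d))"
proof -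
  have "(\<lambda>b. b i j) \<in> borel_measurable (PiM {1..k} (\<lambda>_. borel_vec d))" if "i \<in> {1..k}" "j \<in> {1..d}" for i j
    by (rule measurable_compose[OF measurable_component_singleton[OF that(1)] measurable_component_singleton[OF that(2)]])
  then show ?thesis
    unfolding inner_vec_def combination_def
    by (intro borel_measurable_sum borel_measurable_times borel_measurable_const)
qed

text \<open>Completing the square. The offset \<open>u\<close> stands for the vectors not yet
  integrated out: the result has the same shape in \<open>u\<close>, with \<open>t\<close> replaced
  by \<open>t / (1 + 2 * t * z\<^sup>2)\<close>.\<close>

lemma nn_integral_std_normal_exp_square:
  assumes t: "0 \<le> t"
  shows "(\<integral>\<^sup>+y. ennreal (exp (- (t * (u + z * y)\<^sup>2))) \<partial>std_normal_distribution) =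
    ennreal (1 / sqrt (1 + 2 * t * z\<^sup>2) * exp (- (t / (1 + 2 * t * z\<^sup>2) * u\<^sup>2)))"
proof -
  define c where "c = 1 + 2 * t * z\<^sup>2"
  have c: "c > 0" using t unfolding c_def by (simp add: add_pos_nonneg)
  define C where "C = 1 / sqrt c * exp (- (t / c * u\<^sup>2))"
  have C: "C \<ge> 0" using c by (simp add: C_def)
  have eq: "std_normal_density y * exp (- (t * (u + z * y)\<^sup>2)) = C * normal_density (- (2 * t * u * z / c)) (1 / sqrt c) y" for y
  proof -
    have e: "- (y\<^sup>2 / 2) - t * (u + z * y)\<^sup>2 = - (t / c * u\<^sup>2) - c * (y + 2 * t * u * z / c)\<^sup>2 / 2"
    proof -
      have 1: "c * (y + 2 * t * u * z / c)\<^sup>2 = c * y\<^sup>2 + 4 * (t * u * z * y) + 4 * (t\<^sup>2 * u\<^sup>2 * z\<^sup>2 / c)"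
        using c by (simp add: power2_eq_square field_simps)
      have "t / c * u\<^sup>2 + 2 * (t\<^sup>2 * u\<^sup>2 * z\<^sup>2 / c) = t * u\<^sup>2 * (1 + 2 * t * z\<^sup>2) / c"
        using c by (simp add: field_simps power2_eq_square)
      then have 2: "t / c * u\<^sup>2 + 2 * (t\<^sup>2 * u\<^sup>2 * z\<^sup>2 / c) = t * u\<^sup>2"
        using c by (simp add: c_def)
      have 3: "c * y\<^sup>2 = y\<^sup>2 + 2 * (t * z\<^sup>2 * y\<^sup>2)"
        by (simp add: c_def algebra_simps)
      have 4: "t * (u + z * y)\<^sup>2 = t * u\<^sup>2 + 2 * (t * u * z * y) + t * z\<^sup>2 * y\<^sup>2"
        by (simp add: power2_eq_square algebra_simps)
      show ?thesis using 1 2 3 4 by linarith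
    qed
    have "std_normal_density y * exp (- (t * (u + z * y)\<^sup>2)) = 1 / sqrt (2 * pi) * exp (- (y\<^sup>2 / 2) - t * (u + z * y)\<^sup>2)"
      by (simp add: std_normal_density_def mult_exp_exp)
    also have "\<dots> = 1 / sqrt (2 * pi) * (exp (- (t / c * u\<^sup>2)) * exp (- (c * (y + 2 * t * u * z / c)\<^sup>2 / 2)))"
      unfolding e exp_add[symmetric] by simp
    also have "\<dots> = C * normal_density (- (2 * t * u * z / c)) (1 / sqrt c) y"
      using c by (simp add: C_def normal_density_def real_sqrt_mult real_sqrt_divide power_divide field_simps)
    finally show ?thesis .
  qed
  have "(\<integral>\<^sup>+y. ennreal (exp (- (t * (u + z * y)\<^sup>2))) \<partial>std_normal_distribution)
      = (\<integral>\<^sup>+y. ennreal C * ennreal (normal_density (- (2 * t * u * z / c)) (1 / sqrt c) y) \<partial>lborel)"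
    by (subst nn_integral_density) (auto intro!: nn_integral_cong simp: eq C simp flip: ennreal_mult)
  also have "\<dots> = ennreal C * emeasure (density lborel (normal_density (- (2 * t * u * z / c)) (1 / sqrt c))) UNIV"
    by (subst nn_integral_cmult) (auto simp: emeasure_density)
  also have "\<dots> = ennreal C"
    using prob_space.emeasure_space_1[OF prob_space_normal_density[of "1 / sqrt c" "- (2 * t * u * z / c)"]] c by simp
  finally show ?thesis by (simp add: C_def c_def)
qed

lemma nn_integral_std_gaussian_exp_square:
  assumes t: "0 \<le> t"
  shows "(\<integral>\<^sup>+y. ennreal (exp (- (t * inner_vec d (\<lambda>j. u j + z * y j) (\<lambda>j. u j + z * y j)))) \<partial>std_gaussian d) =
    ennreal ((1 / sqrt (1 + 2 * t * z\<^sup>2)) ^ d * exp (- (t / (1 + 2 * t * z\<^sup>2) * inner_vec d u u)))"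
proof -
  interpret product_prob_space "\<lambda>_. std_normal_distribution" "{1..d}"
    by (intro product_prob_spaceI prob_space_std_normal)
  have "(\<integral>\<^sup>+y. ennreal (exp (- (t * inner_vec d (\<lambda>j. u j + z * y j) (\<lambda>j. u j + z * y j)))) \<partial>std_gaussian d)
    = (\<integral>\<^sup>+y. (\<Prod>j=1..d. ennreal (exp (- (t * (u j + z * y j)\<^sup>2)))) \<partial>std_gaussian d)"
    by (intro nn_integral_cong)
      (simp add: inner_vec_def prod_ennreal power2_eq_square sum_distrib_left sum_negf flip: exp_sum)
  also have "\<dots> = (\<Prod>j=1..d. ennreal (1 / sqrt (1 + 2 * t * z\<^sup>2) * exp (- (t / (1 + 2 * t * z\<^sup>2) * (u j)\<^sup>2))))"
    unfolding std_gaussian_def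
    by (subst product_nn_integral_prod) (auto simp: nn_integral_std_normal_exp_square[OF t])
  also have "\<dots> = ennreal ((1 / sqrt (1 + 2 * t * z\<^sup>2)) ^ d * exp (- (t / (1 + 2 * t * z\<^sup>2) * inner_vec d u u)))"
  proof -
    have "(\<Prod>j=1..d. ennreal (1 / sqrt (1 + 2 * t * z\<^sup>2) * exp (- (t / (1 + 2 * t * z\<^sup>2) * (u j)\<^sup>2))))
      = ennreal (\<Prod>j=1..d. 1 / sqrt (1 + 2 * t * z\<^sup>2) * exp (- (t / (1 + 2 * t * z\<^sup>2) * (u j)\<^sup>2)))"
      using t by (intro prod_ennreal) auto
    also have "(\<Prod>j=1..d. 1 / sqrt (1 + 2 * t * z\<^sup>2) * exp (- (t / (1 + 2 * t * z\<^sup>2) * (u j)\<^sup>2)))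
      = (1 / sqrt (1 + 2 * t * z\<^sup>2)) ^ d * exp (- (t / (1 + 2 * t * z\<^sup>2) * inner_vec d u u))"
      by (simp only: prod.distrib prod_constant exp_sum[symmetric, OF finite_atLeastAtMost] inner_vec_def
          sum_distrib_left sum_negf power2_eq_square card_atLeastAtMost) simp
    finally show ?thesis .
  qed
  finally show ?thesis .
qed

text \<open>The vectors are integrated out one at a time, starting with the last. Each of them
  changes the parameter, so \<open>t\<close> is arbitrary in the induction.\<close>

lemma nn_integral_exp_combination:
  assumes t: "0 \<le> t"
  shows "(\<integral>\<^sup>+b. ennreal (exp (- (t * inner_vec d (combination k z b) (combination k z b)))) \<partial>gaussian_seed d k) =
    ennreal ((1 / sqrt (1 + 2 * t * (\<Sum>i=1..k. (z i)\<^sup>2))) ^ d)"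
  using t
proof (induction k arbitrary: t)
  case 0
  interpret prob_space "gaussian_seed d 0" by (rule prob_space_gaussian_seed)
  show ?case by (simp add: combination_def inner_vec_def emeasure_space_1)
next
  case (Suc k)
  interpret product_prob_space "\<lambda>_. std_gaussian d" "{1..k}"
    by (intro product_prob_spaceI prob_space_std_gaussian)
  define w where "w = z (Suc k)"
  define c where "c = 1 + 2 * t * w\<^sup>2"
  have c: "c > 0" using Suc.prems unfolding c_def by (simp add: add_pos_nonneg)
  have ins: "{1..Suc k} = insert (Suc k) {1..k}" by auto
  let ?f = "\<lambda>t k b. ennreal (exp (- (t * inner_vec d (combination k z b) (combination k z b))))"
  have upd: "combination (Suc k) z (b(Suc k := y)) = (\<lambda>j. combination k z b j + w * y j)" for b y
    by (auto simp: combination_def w_def intro!: sum.cong)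
  have meas: "?f t (Suc k) \<in> borel_measurable (PiM {1..Suc k} (\<lambda>_. std_gaussian d))"
    by (simp only: measurable_cong_sets[OF sets_PiM_cong[OF refl sets_std_gaussian] refl]) measurable
  have m: "?f (t / c) k \<in> borel_measurable (gaussian_seed d k)"
    unfolding measurable_cong_sets[OF sets_gaussian_seed refl] by measurable
  have "(\<integral>\<^sup>+b. ?f t (Suc k) b \<partial>gaussian_seed d (Suc k)) = (\<integral>\<^sup>+b. (\<integral>\<^sup>+y. ?f t (Suc k) (b(Suc k := y)) \<partial>std_gaussian d) \<partial>gaussian_seed d k)"
    unfolding gaussian_seed_def ins
    by (intro product_nn_integral_insert finite_atLeastAtMost meas[unfolded ins]) simp
  also have "\<dots> = (\<integral>\<^sup>+b. ennreal ((1 / sqrt c) ^ d) * ?f (t / c) k b \<partial>gaussian_seed d k)"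
    unfolding upd nn_integral_std_gaussian_exp_square[OF Suc.prems] c_def[symmetric]
    using c by (intro nn_integral_cong ennreal_mult) auto
  also have "\<dots> = ennreal ((1 / sqrt c) ^ d) * ennreal ((1 / sqrt (1 + 2 * (t / c) * (\<Sum>i=1..k. (z i)\<^sup>2))) ^ d)"
    using Suc.prems c by (subst nn_integral_cmult[OF m], subst Suc.IH) auto
  also have "\<dots> = ennreal ((1 / sqrt (c * (1 + 2 * (t / c) * (\<Sum>i=1..k. (z i)\<^sup>2)))) ^ d)"
  proof -
    have "0 \<le> 1 + 2 * (t / c) * (\<Sum>i=1..k. (z i)\<^sup>2)"
      using c Suc.prems by (intro add_nonneg_nonneg mult_nonneg_nonneg sum_nonneg) auto
    then show ?thesis
      using c by (subst ennreal_mult[symmetric]) (simp_all add: real_sqrt_mult power_mult_distrib[symmetric] del: One_nat_def)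
  qed
  also have "c * (1 + 2 * (t / c) * (\<Sum>i=1..k. (z i)\<^sup>2)) = 1 + 2 * t * (\<Sum>i=1..Suc k. (z i)\<^sup>2)"
    using c by (simp add: field_simps) (simp add: c_def w_def algebra_simps)
  finally show ?case .
qed

text \<open>Chernoff's bound with parameter \<open>1 / Z\<close>, for \<open>Z\<close> the sum of
  the squares: under the Gaussian law the squared norm is \<open>Z\<close> times a chi-squared
  variable, which gives \<open>(1 / sqrt 3) ^ d\<close>. The factor \<open>exp (d / 4)\<close> comes
  from the threshold and \<open>(4 / 3) ^ k\<close> from the truncation.\<close>

lemma prob_combination_small:
  assumes Z: "(\<Sum>i=1..k. (z i)\<^sup>2) > 0"
  shows "measure (seed_law d k) {b \<in> space (seed_law d k). inner_vec d (combination k z b) (combination k z b) \<le> (\<Sum>i=1..k. (z i)\<^sup>2) * real d / 4}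
    \<le> (4 / 3) ^ k * exp (real d / 4) * (1 / sqrt 3) ^ d" (is "measure _ ?A \<le> _")
proof -
  interpret prob_space "seed_law d k" by (rule prob_space_seed_law)
  define Z where "Z = (\<Sum>i=1..k. (z i)\<^sup>2)"
  define N where "N b = inner_vec d (combination k z b) (combination k z b)" for b
  have [measurable]: "N \<in> borel_measurable (PiM {1..k} (\<lambda>_. borel_vec d))"
    unfolding N_def by measurable
  have Zp: "Z > 0" using Z by (simp add: Z_def)
  have "emeasure (seed_law d k) ?A = (\<integral>\<^sup>+b. indicator ?A b \<partial>seed_law d k)"
    by (rule nn_integral_indicator[symmetric]) (simp add: N_def[symmetric] Z_def[symmetric])
  also have "\<dots> \<le> (\<integral>\<^sup>+b. ennreal (exp (real d / 4)) * ennreal (exp (- (1 / Z * N b))) \<partial>seed_law d k)"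
  proof (intro nn_integral_mono)
    fix b
    have "1 \<le> exp (real d / 4) * exp (- (1 / Z * N b))" if "b \<in> ?A"
    proof -
      have "N b \<le> Z * real d / 4" using that by (simp add: N_def Z_def del: One_nat_def)
      then show ?thesis using Zp by (simp add: exp_add[symmetric] field_simps)
    qed
    then show "indicator ?A b \<le> ennreal (exp (real d / 4)) * ennreal (exp (- (1 / Z * N b)))"
      by (auto simp: indicator_def simp flip: ennreal_mult ennreal_1)
  qed
  also have "\<dots> = ennreal (exp (real d / 4)) * (\<integral>\<^sup>+b. ennreal (exp (- (1 / Z * N b))) \<partial>seed_law d k)"
    by (rule nn_integral_cmult) measurable
  also have "\<dots> \<le> ennreal (exp (real d / 4)) * (ennreal ((4 / 3) ^ k) * (\<integral>\<^sup>+b. ennreal (exp (- (1 / Z * N b))) \<partial>gaussian_seed d k))"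
    by (intro mult_left_mono nn_integral_seed_law_le zero_le) measurable
  also have "(\<integral>\<^sup>+b. ennreal (exp (- (1 / Z * N b))) \<partial>gaussian_seed d k) = ennreal ((1 / sqrt (1 + 2 * (1 / Z) * Z)) ^ d)"
    unfolding N_def Z_def using Zp by (intro nn_integral_exp_combination) (simp add: Z_def)
  also have "1 + 2 * (1 / Z) * Z = 3" using Zp by simp
  also have "ennreal (exp (real d / 4)) * (ennreal ((4 / 3) ^ k) * ennreal ((1 / sqrt 3) ^ d)) = ennreal ((4 / 3) ^ k * exp (real d / 4) * (1 / sqrt 3) ^ d)"
    by (simp add: mult_ac flip: ennreal_mult)
  finally show ?thesis
    by (simp add: emeasure_eq_measure ennreal_le_iff)
qed

section \<open>Short sums of seed vectors and the perceptron\<close>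

definition multiplicities :: "nat \<Rightarrow> nat \<Rightarrow> (nat \<Rightarrow> nat) set" where
  "multiplicities k K = {z \<in> {1..k} \<rightarrow>\<^sub>E {..K}. (\<Sum>i=1..k. z i) = K}"

lemma finite_multiplicities: "finite (multiplicities k K)"
  by (rule finite_subset[of _ "{1..k} \<rightarrow>\<^sub>E {..K}"]) (auto simp: multiplicities_def intro!: finite_PiE)

text \<open>A generating function at \<open>1 / 2\<close>: every element has weight
  \<open>(1 / 2) ^ K\<close>, and the weights of all functions together are a product of
  \<open>k\<close> geometric sums, each at most 2.\<close>

lemma card_multiplicities: "real (card (multiplicities k K)) \<le> 2 ^ (K + k)"
proof -
  have "real (card (multiplicities k K)) = (\<Sum>z\<in>multiplicities k K. 2 ^ K * (\<Prod>i=1..k. (1 / 2) ^ z i))"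
  proof -
    have "2 ^ K * (\<Prod>i=1..k. (1 / 2 :: real) ^ z i) = 1" if "z \<in> multiplicities k K" for z
    proof -
      have "(\<Prod>i=1..k. (1 / 2 :: real) ^ z i) = (1 / 2) ^ K"
        using that power_sum[of "1 / 2 :: real" z "{1..k}"] by (simp add: multiplicities_def del: One_nat_def)
      then show ?thesis by (simp add: power_one_over)
    qed
    then show ?thesis by simp
  qed
  also have "\<dots> \<le> (\<Sum>z\<in>{1..k} \<rightarrow>\<^sub>E {..K}. 2 ^ K * (\<Prod>i=1..k. (1 / 2 :: real) ^ z i))"
    by (intro sum_mono2 finite_PiE mult_nonneg_nonneg prod_nonneg) (auto simp: multiplicities_def)
  also have "\<dots> = 2 ^ K * (\<Prod>i=1..k. \<Sum>m\<le>K. (1 / 2 :: real) ^ m)"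
    by (subst prod_sum_PiE) (auto simp: sum_distrib_left)
  also have "\<dots> \<le> 2 ^ K * (\<Prod>i=1..k. 2)"
  proof (intro mult_left_mono prod_mono conjI)
    show "(\<Sum>m\<le>K. (1 / 2 :: real) ^ m) \<le> 2" unfolding sum_gp0 by simp
  qed (auto intro: sum_nonneg)
  finally show ?thesis by (simp add: power_add)
qed

lemma inner_vec_nonneg: "0 \<le> inner_vec d x x"
  by (auto simp: inner_vec_def intro!: sum_nonneg)

text \<open>Perceptron: each vector \<open>b i\<close> with \<open>\<langle>b i, S\<rangle> \<le> d\<close> may be added to \<open>S\<close> at the cost
  \<open>6 * d\<close> in the squared norm; if no sum of \<open>24 * k\<close> of the vectors is that short, the procedure stops.\<close>

lemma perceptron:
  assumes d: "1 \<le> d" and k: "1 \<le> k"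
    and bound: "\<And>i. i \<in> {1..k} \<Longrightarrow> inner_vec d (b i) (b i) \<le> 4 * real d"
    and large: "\<And>z. z \<in> multiplicities k (24 * k) \<Longrightarrow>
      6 * real d * real (24 * k) < inner_vec d (combination k (\<lambda>i. real (z i)) b) (combination k (\<lambda>i. real (z i)) b)"
  obtains x where "inner_vec d x x \<le> 1" "\<And>i. i \<in> {1..k} \<Longrightarrow> inner_vec d (b i) x \<le> - (sqrt (real d / real k) / 12)"
proof -
  let ?C = "\<lambda>z :: nat \<Rightarrow> nat. combination k (\<lambda>i. real (z i)) b"
  have "\<exists>x. inner_vec d x x \<le> 1 \<and> (\<forall>i\<in>{1..k}. inner_vec d (b i) x \<le> - (sqrt (real d / real k) / 12))"
  proof (rule ccontr)
    assume no: "\<not> ?thesis"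
    have "\<exists>z. (\<Sum>i=1..k. z i) = n \<and> inner_vec d (?C z) (?C z) \<le> 6 * real d * real n" if "n \<le> 24 * k" for n
      using that
    proof (induction n)
      case 0
      show ?case by (intro exI[of _ "\<lambda>_. 0"]) (simp add: combination_def inner_vec_def)
    next
      case (Suc n)
      then obtain z where z: "(\<Sum>i=1..k. z i) = n" "inner_vec d (?C z) (?C z) \<le> 6 * real d * real n"
        by auto
      \<comment> \<open>\<open>R\<close> plays two roles: \<open>R\<^sup>2\<close> is the final norm
        bound \<open>6 * d * (24 * k)\<close>, so that \<open>x\<close> lies in the unit ball, and
        \<open>d / R\<close> is the margin \<open>sqrt (d / k) / 12\<close>.\<close>
      define R where "R = 12 * sqrt (real d * real k)"
      have R: "R > 0" "R\<^sup>2 = 144 * real d * real k" using d k by (auto simp: R_def power_mult_distrib)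
      define x where "x = (\<lambda>j. - ?C z j / R)"
      have "inner_vec d x x = inner_vec d (?C z) (?C z) / R\<^sup>2"
        by (simp add: x_def inner_vec_def sum_divide_distrib power2_eq_square)
      also have "\<dots> \<le> (6 * real d * real n) / R\<^sup>2" by (intro divide_right_mono z(2)) simp
      also have "\<dots> \<le> (6 * real d * real (24 * k)) / R\<^sup>2"
        using Suc.prems by (intro divide_right_mono mult_left_mono) auto
      also have "\<dots> = 1" using d k by (simp add: R(2))
      finally have "inner_vec d x x \<le> 1" .
      with no obtain i where i: "i \<in> {1..k}" "inner_vec d (b i) x > - (sqrt (real d / real k) / 12)"
        by (force simp: not_le)
      have "inner_vec d (b i) x = - inner_vec d (b i) (?C z) / R"
        by (simp add: x_def inner_vec_def sum_divide_distrib sum_negf)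
      moreover have "sqrt (real d / real k) / 12 = real d / R"
        using d k by (simp add: R_def real_sqrt_divide real_sqrt_mult field_simps)
      ultimately have "- (real d / R) < - inner_vec d (b i) (?C z) / R"
        using i(2) by simp
      then have "inner_vec d (b i) (?C z) < real d"
        using R(1) by (simp add: divide_less_cancel)
      define z' where "z' = z(i := Suc (z i))"
      have z'_eq: "?C z' j = ?C z j + b i j" for j
      proof -
        have "?C z' j = (\<Sum>l=1..k. real (z l) * b l j + (if l = i then b l j else 0))"
          unfolding combination_def by (intro sum.cong refl) (simp add: z'_def algebra_simps)
        then show ?thesis using i(1) by (simp add: sum.distrib combination_def)
      qed
      have "inner_vec d (?C z') (?C z') = inner_vec d (?C z) (?C z) + 2 * inner_vec d (b i) (?C z) + inner_vec d (b i) (b i)"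
        unfolding inner_vec_def z'_eq by (simp add: algebra_simps sum.distrib sum_distrib_left)
      also have "\<dots> \<le> 6 * real d * real n + 2 * real d + 4 * real d"
        using z(2) bound[OF i(1)] \<open>inner_vec d (b i) (?C z) < real d\<close> by linarith
      also have "\<dots> = 6 * real d * real (Suc n)" by (simp add: algebra_simps)
      finally have "inner_vec d (?C z') (?C z') \<le> 6 * real d * real (Suc n)" .
      moreover have "(\<Sum>l=1..k. z' l) = Suc n"
      proof -
        have "(\<Sum>l=1..k. z' l) = (\<Sum>l=1..k. z l + (if l = i then 1 else 0))"
          by (intro sum.cong refl) (simp add: z'_def)
        then show ?thesis using i(1) z(1) by (simp add: sum.distrib)
      qed
      ultimately show ?case by blast
    qed
    from this[of "24 * k"] obtain z where z: "(\<Sum>i=1..k. z i) = 24 * k" "inner_vec d (?C z) (?C z) \<le> 6 * real d * real (24 * k)"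
      by auto
    have le: "z i \<le> 24 * k" if "i \<in> {1..k}" for i
      using member_le_sum[OF that, of z] z(1) by simp
    have "(\<lambda>i\<in>{1..k}. z i) \<in> multiplicities k (24 * k)"
      using le z(1) by (auto simp: multiplicities_def)
    moreover have "?C (\<lambda>i\<in>{1..k}. z i) = ?C z"
      by (simp add: combination_def)
    ultimately show False using large z(2) by force
  qed
  then show ?thesis using that by blast
qed

definition well_spread :: "nat \<Rightarrow> nat \<Rightarrow> (nat \<Rightarrow> vec) \<Rightarrow> bool" where
  "well_spread d k b \<longleftrightarrow> (\<forall>z\<in>multiplicities k (24 * k).
      6 * real d * real (24 * k) < inner_vec d (combination k (\<lambda>i. real (z i)) b) (combination k (\<lambda>i. real (z i)) b))"

lemma well_spread_measurable [measurable]: "Measurable.pred (seed_law d k) (well_spread d k)"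
  unfolding well_spread_def using finite_multiplicities
  by (intro pred_intros_finite) (auto simp del: One_nat_def)

text \<open>A union bound. By Cauchy-Schwarz the squares of the multiplicities sum to at least
  \<open>576 * k\<close>, and 24 is such that \<open>6 * d * (24 * k)\<close> is exactly a quarter
  of \<open>576 * k * d\<close>, as \<open>prob_combination_small\<close> demands. The total
  exponent is at most \<open>26 * k - d / 4\<close>, which is at most \<open>- 12 * d / 100\<close>
  for \<open>k \<le> d / 200\<close>.\<close>

lemma prob_not_well_spread:
  assumes k: "1 \<le> k" "real k \<le> real d / 200" and d: "160000 \<le> d"
  shows "measure (seed_law d k) {b \<in> space (seed_law d k). \<not> well_spread d k b} \<le> 1 / 8"
proof -
  interpret prob_space "seed_law d k" by (rule prob_space_seed_law)
  let ?A = "\<lambda>z. {b \<in> space (seed_law d k). inner_vec d (combination k (\<lambda>i. real (z i)) b) (combination k (\<lambda>i. real (z i)) b) \<le> 6 * real d * real (24 * k)}"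
  define p where "p = (4 / 3) ^ k * exp (real d / 4) * (1 / sqrt 3 :: real) ^ d"
  have A: "prob (?A z) \<le> p" if z: "z \<in> multiplicities k (24 * k)" for z
  proof -
    let ?Z = "\<Sum>i=1..k. (real (z i))\<^sup>2"
    have "(\<Sum>i=1..k. real (z i) * 1)\<^sup>2 \<le> ?Z * (\<Sum>i=1..k. 1\<^sup>2)"
      by (rule Cauchy_Schwarz_ineq_sum)
    moreover have "(\<Sum>i=1..k. real (z i)) = real (24 * k)"
      using z by (auto simp: multiplicities_def simp flip: of_nat_sum)
    ultimately have "(real (24 * k))\<^sup>2 \<le> ?Z * real k" by simp
    then have Z: "576 * real k \<le> ?Z" using k(1) by (simp add: power2_eq_square)
    then have "?Z > 0" using k(1) by (smt (verit) of_nat_1 of_nat_le_iff)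
    have "6 * real d * real (24 * k) \<le> ?Z * real d / 4"
      using mult_right_mono[OF Z, of "real d"] by (simp add: mult_ac)
    then have "prob (?A z) \<le> prob {b \<in> space (seed_law d k). inner_vec d (combination k (\<lambda>i. real (z i)) b) (combination k (\<lambda>i. real (z i)) b) \<le> ?Z * real d / 4}"
      by (intro finite_measure_mono) auto
    also have "\<dots> \<le> p" unfolding p_def by (rule prob_combination_small[OF \<open>?Z > 0\<close>])
    finally show ?thesis .
  qed
  have U: "{b \<in> space (seed_law d k). \<not> well_spread d k b} = (\<Union>z\<in>multiplicities k (24 * k). ?A z)"
    by (auto simp: well_spread_def not_less)
  have "prob (\<Union>z\<in>multiplicities k (24 * k). ?A z) \<le> (\<Sum>z\<in>multiplicities k (24 * k). prob (?A z))"
    by (rule finite_measure_subadditive_finite[OF finite_multiplicities]) auto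
  also have "\<dots> \<le> (\<Sum>z\<in>multiplicities k (24 * k). p)" by (intro sum_mono A)
  also have "\<dots> = real (card (multiplicities k (24 * k))) * p" by (rule sum_constant)
  also have "\<dots> \<le> 2 ^ (24 * k + k) * p"
    by (intro mult_right_mono card_multiplicities) (simp add: p_def)
  also have "\<dots> \<le> exp (25 * real k) * (exp (real k) * exp (real d / 4) * exp (- (real d / 2)))"
    unfolding p_def
  proof (intro mult_mono order_refl)
    have e2: "(2::real) \<le> exp 1" using exp_ge_add_one_self[of 1] by simp
    have "(2::real) ^ (24 * k + k) \<le> exp 1 ^ (24 * k + k)" by (intro power_mono e2) simp
    then show "2 ^ (24 * k + k) \<le> exp (25 * real k)" by (simp flip: exp_of_nat_mult)
    have "(4 / 3 :: real) ^ k \<le> exp 1 ^ k" using e2 by (intro power_mono) auto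
    then show "(4 / 3 :: real) ^ k \<le> exp (real k)" by (simp flip: exp_of_nat_mult)
    have "exp (1 / 2 :: real) \<le> sqrt 3"
      using exp_le by (intro real_le_rsqrt) (simp flip: exp_double)
    then have "1 / sqrt 3 \<le> exp (- (1 / 2) :: real)"
      by (simp add: exp_minus field_simps)
    then have "(1 / sqrt 3) ^ d \<le> exp (- (1 / 2) :: real) ^ d" by (intro power_mono) auto
    then show "(1 / sqrt 3) ^ d \<le> exp (- (real d / 2))" by (simp flip: exp_of_nat_mult)
  qed auto
  also have "\<dots> = exp (26 * real k - real d / 4)" by (simp flip: exp_add)
  also have "\<dots> \<le> exp (- (12 * real d / 100))" using k(2) by simp
  also have "\<dots> \<le> 1 / 8"
  proof -
    have "8 \<le> 1 + 12 * real d / 100" using d by simp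
    also have "\<dots> \<le> exp (12 * real d / 100)" by (rule exp_ge_add_one_self)
    finally show ?thesis by (simp add: exp_minus field_simps)
  qed
  finally show ?thesis unfolding U .
qed

section \<open>Approximation of Borel functions by continuous ones\<close>

lemma tendsto_coordinatewise:
  fixes f :: "'a \<Rightarrow> nat \<Rightarrow> real"
  assumes "\<And>i. ((\<lambda>n. f n i) \<longlongrightarrow> l i) F"
  shows "(f \<longlongrightarrow> l) F"
proof -
  have "limitin (product_topology (\<lambda>_. euclidean) UNIV) f l F"
    using assms by (simp add: limitin_componentwise)
  then show ?thesis
    by (simp only: euclidean_product_topology limitin_canonical_iff)
qed

text \<open>Approximation in measure, not almost everywhere: in this form it passes to pointwise
  limits, which the induction over Borel sets and functions requires.\<close>

definition approximable :: "'a::metric_space measure \<Rightarrow> ('a \<Rightarrow> real) \<Rightarrow> bool" where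
  "approximable M g \<longleftrightarrow> g \<in> borel_measurable borel \<and>
    (\<forall>\<epsilon>>0. \<exists>\<phi>. continuous_on UNIV \<phi> \<and> measure M {y. \<epsilon> \<le> \<bar>g y - \<phi> y\<bar>} \<le> \<epsilon>)"

locale finite_borel_measure = finite_measure M for M :: "'a::metric_space measure" +
  assumes M: "sets M = sets borel"
begin

lemma approximable_continuous:
  assumes "continuous_on UNIV \<phi>"
  shows "approximable M \<phi>"
  unfolding approximable_def
proof (intro conjI allI impI exI)
  show "\<phi> \<in> borel_measurable borel" using assms by (rule borel_measurable_continuous_onI)
  fix \<epsilon> :: real assume e: "0 < \<epsilon>"
  then have "{y. \<epsilon> \<le> \<bar>\<phi> y - \<phi> y\<bar>} = {}" by auto
  then show "measure M {y. \<epsilon> \<le> \<bar>\<phi> y - \<phi> y\<bar>} \<le> \<epsilon>" using e by simp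
qed (rule assms)

text \<open>The sets of points at which some later \<open>U i\<close> is off by at least half of
  \<epsilon> decrease to the empty set; continuity of the finite measure makes one of them
  small.\<close>

lemma approximable_limit:
  assumes U: "\<And>i. approximable M (U i)" and lim: "\<And>y. (\<lambda>i. U i y) \<longlonglongrightarrow> u y"
  shows "approximable M u"
  unfolding approximable_def
proof (intro conjI allI impI)
  have Um [measurable]: "U i \<in> borel_measurable borel" for i
    using U by (simp add: approximable_def)
  show um [measurable]: "u \<in> borel_measurable borel"
    by (rule borel_measurable_LIMSEQ_real[OF lim Um])
  have M': "A \<in> sets borel \<Longrightarrow> A \<in> sets M" for A using M by simp
  fix \<epsilon> :: real assume e: "0 < \<epsilon>"
  define A where "A n = (\<Union>i\<in>{n..}. {y. \<epsilon> / 2 \<le> \<bar>u y - U i y\<bar>})" for n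
  have [measurable]: "A n \<in> sets borel" for n unfolding A_def by measurable
  have "(\<lambda>n. measure M (A n)) \<longlonglongrightarrow> measure M (\<Inter>n. A n)"
  proof (rule finite_Lim_measure_decseq)
    show "decseq A" unfolding decseq_def A_def by (intro allI impI UN_mono) auto
  qed (auto simp: M)
  moreover have "(\<Inter>n. A n) = {}"
  proof -
    have "\<exists>n. y \<notin> A n" for y
    proof -
      have "\<forall>\<^sub>F i in sequentially. dist (U i y) (u y) < \<epsilon> / 2"
        by (rule tendstoD[OF lim half_gt_zero[OF e]])
      then obtain n where "\<forall>i\<ge>n. dist (U i y) (u y) < \<epsilon> / 2" by (auto simp: eventually_sequentially)
      then have "y \<notin> A n" by (auto simp: A_def dist_real_def abs_minus_commute not_le)
      then show ?thesis ..
    qed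
    then show ?thesis by auto
  qed
  ultimately have "(\<lambda>n. measure M (A n)) \<longlonglongrightarrow> 0" by simp
  then have "\<forall>\<^sub>F n in sequentially. measure M (A n) < \<epsilon> / 2"
    using e by (intro order_tendstoD(2)) auto
  then obtain n where n: "measure M (A n) < \<epsilon> / 2"
    using eventually_happens'[OF sequentially_bot] by blast
  have "\<forall>\<epsilon>>0. \<exists>\<phi>. continuous_on UNIV \<phi> \<and> measure M {y. \<epsilon> \<le> \<bar>U n y - \<phi> y\<bar>} \<le> \<epsilon>"
    using U[of n] by (simp add: approximable_def)
  then obtain \<phi> where \<phi>: "continuous_on UNIV \<phi>" "measure M {y. \<epsilon> / 2 \<le> \<bar>U n y - \<phi> y\<bar>} \<le> \<epsilon> / 2"
    using e by (meson half_gt_zero)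
  have [measurable]: "\<phi> \<in> borel_measurable borel" using \<phi>(1) by (rule borel_measurable_continuous_onI)
  have "{y. \<epsilon> \<le> \<bar>u y - \<phi> y\<bar>} \<subseteq> A n \<union> {y. \<epsilon> / 2 \<le> \<bar>U n y - \<phi> y\<bar>}"
  proof
    fix y assume "y \<in> {y. \<epsilon> \<le> \<bar>u y - \<phi> y\<bar>}"
    then have "\<epsilon> / 2 \<le> \<bar>u y - U n y\<bar> \<or> \<epsilon> / 2 \<le> \<bar>U n y - \<phi> y\<bar>"
      using abs_triangle_ineq[of "u y - U n y" "U n y - \<phi> y"] unfolding mem_Collect_eq by force
    then show "y \<in> A n \<union> {y. \<epsilon> / 2 \<le> \<bar>U n y - \<phi> y\<bar>}" by (auto simp: A_def)
  qed
  then have "measure M {y. \<epsilon> \<le> \<bar>u y - \<phi> y\<bar>} \<le> measure M (A n \<union> {y. \<epsilon> / 2 \<le> \<bar>U n y - \<phi> y\<bar>})"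
    by (rule finite_measure_mono) (auto intro!: M')
  also have "\<dots> \<le> measure M (A n) + measure M {y. \<epsilon> / 2 \<le> \<bar>U n y - \<phi> y\<bar>}"
    by (rule measure_Un_le) (auto intro!: M')
  also have "\<dots> \<le> \<epsilon>" using n \<phi>(2) by simp
  finally show "\<exists>\<phi>. continuous_on UNIV \<phi> \<and> measure M {y. \<epsilon> \<le> \<bar>u y - \<phi> y\<bar>} \<le> \<epsilon>" using \<phi>(1) by blast
qed

lemma approximable_add:
  assumes "approximable M g" "approximable M h"
  shows "approximable M (\<lambda>y. g y + h y)"
  unfolding approximable_def
proof (intro conjI allI impI)
  have [measurable]: "g \<in> borel_measurable borel" "h \<in> borel_measurable borel"
    using assms by (simp_all add: approximable_def)
  show "(\<lambda>y. g y + h y) \<in> borel_measurable borel" by measurable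
  have M': "A \<in> sets borel \<Longrightarrow> A \<in> sets M" for A using M by simp
  fix \<epsilon> :: real assume e: "0 < \<epsilon>"
  obtain \<phi> where \<phi>: "continuous_on UNIV \<phi>" "measure M {y. \<epsilon> / 2 \<le> \<bar>g y - \<phi> y\<bar>} \<le> \<epsilon> / 2"
    using assms(1) e unfolding approximable_def by (meson half_gt_zero)
  obtain \<psi> where \<psi>: "continuous_on UNIV \<psi>" "measure M {y. \<epsilon> / 2 \<le> \<bar>h y - \<psi> y\<bar>} \<le> \<epsilon> / 2"
    using assms(2) e unfolding approximable_def by (meson half_gt_zero)
  have [measurable]: "\<phi> \<in> borel_measurable borel" "\<psi> \<in> borel_measurable borel"
    using \<phi>(1) \<psi>(1) by (auto intro: borel_measurable_continuous_onI)
  have "{y. \<epsilon> \<le> \<bar>g y + h y - (\<phi> y + \<psi> y)\<bar>} \<subseteq> {y. \<epsilon> / 2 \<le> \<bar>g y - \<phi> y\<bar>} \<union> {y. \<epsilon> / 2 \<le> \<bar>h y - \<psi> y\<bar>}"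
  proof
    fix y assume "y \<in> {y. \<epsilon> \<le> \<bar>g y + h y - (\<phi> y + \<psi> y)\<bar>}"
    then have "\<epsilon> / 2 \<le> \<bar>g y - \<phi> y\<bar> \<or> \<epsilon> / 2 \<le> \<bar>h y - \<psi> y\<bar>"
      unfolding mem_Collect_eq by (smt (verit) field_sum_of_halves)
    then show "y \<in> {y. \<epsilon> / 2 \<le> \<bar>g y - \<phi> y\<bar>} \<union> {y. \<epsilon> / 2 \<le> \<bar>h y - \<psi> y\<bar>}" by simp
  qed
  then have "measure M {y. \<epsilon> \<le> \<bar>g y + h y - (\<phi> y + \<psi> y)\<bar>} \<le> measure M ({y. \<epsilon> / 2 \<le> \<bar>g y - \<phi> y\<bar>} \<union> {y. \<epsilon> / 2 \<le> \<bar>h y - \<psi> y\<bar>})"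
    by (rule finite_measure_mono) (auto intro!: M')
  also have "\<dots> \<le> measure M {y. \<epsilon> / 2 \<le> \<bar>g y - \<phi> y\<bar>} + measure M {y. \<epsilon> / 2 \<le> \<bar>h y - \<psi> y\<bar>}"
    by (rule measure_Un_le) (auto intro!: M')
  also have "\<dots> \<le> \<epsilon>" using \<phi>(2) \<psi>(2) by simp
  finally show "\<exists>\<phi>. continuous_on UNIV \<phi> \<and> measure M {y. \<epsilon> \<le> \<bar>g y + h y - \<phi> y\<bar>} \<le> \<epsilon>"
    using continuous_on_add[OF \<phi>(1) \<psi>(1)] by blast
qed

lemma approximable_mult:
  assumes "approximable M g"
  shows "approximable M (\<lambda>y. c * g y)"
  unfolding approximable_def
proof (intro conjI allI impI)
  have [measurable]: "g \<in> borel_measurable borel"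
    using assms by (simp_all add: approximable_def)
  show "(\<lambda>y. c * g y) \<in> borel_measurable borel" by measurable
  fix \<epsilon> :: real assume e: "0 < \<epsilon>"
  show "\<exists>\<phi>. continuous_on UNIV \<phi> \<and> measure M {y. \<epsilon> \<le> \<bar>c * g y - \<phi> y\<bar>} \<le> \<epsilon>"
  proof (cases "c = 0")
    case True
    then show ?thesis using e by (intro exI[of _ "\<lambda>_. 0"]) simp
  next
    case False
    define \<delta> where "\<delta> = min \<epsilon> (\<epsilon> / \<bar>c\<bar>)"
    have d: "0 < \<delta>" "\<delta> \<le> \<epsilon>" "\<bar>c\<bar> * \<delta> \<le> \<epsilon>" using e False by (auto simp: \<delta>_def min_def field_simps)
    obtain \<phi> where \<phi>: "continuous_on UNIV \<phi>" "measure M {y. \<delta> \<le> \<bar>g y - \<phi> y\<bar>} \<le> \<delta>"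
      using assms d(1) unfolding approximable_def by meson
    have [measurable]: "\<phi> \<in> borel_measurable borel" using \<phi>(1) by (rule borel_measurable_continuous_onI)
    have "{y. \<epsilon> \<le> \<bar>c * g y - c * \<phi> y\<bar>} \<subseteq> {y. \<delta> \<le> \<bar>g y - \<phi> y\<bar>}"
    proof
      fix y assume "y \<in> {y. \<epsilon> \<le> \<bar>c * g y - c * \<phi> y\<bar>}"
      then have "\<epsilon> \<le> \<bar>c\<bar> * \<bar>g y - \<phi> y\<bar>" by (simp add: abs_mult[symmetric] right_diff_distrib)
      then have "\<bar>c\<bar> * \<delta> \<le> \<bar>c\<bar> * \<bar>g y - \<phi> y\<bar>" using d(3) by simp
      then show "y \<in> {y. \<delta> \<le> \<bar>g y - \<phi> y\<bar>}" using False by simp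
    qed
    then have "measure M {y. \<epsilon> \<le> \<bar>c * g y - c * \<phi> y\<bar>} \<le> measure M {y. \<delta> \<le> \<bar>g y - \<phi> y\<bar>}"
      by (rule finite_measure_mono) (simp add: M)
    also have "\<dots> \<le> \<epsilon>" using \<phi>(2) d(2) by simp
    finally have "measure M {y. \<epsilon> \<le> \<bar>c * g y - c * \<phi> y\<bar>} \<le> \<epsilon>" .
    then show ?thesis using continuous_on_mult_left[OF \<phi>(1), of c] by blast
  qed
qed

lemma approximable_sum:
  fixes n :: nat
  assumes "\<And>i. i < n \<Longrightarrow> approximable M (g i)"
  shows "approximable M (\<lambda>y. \<Sum>i<n. g i y)"
  using assms
proof (induction n)
  case 0
  then show ?case by (simp add: approximable_continuous)
next
  case (Suc n)
  then show ?case by (simp add: approximable_add)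
qed

text \<open>Induction over complements and disjoint unions from the closed sets, whose indicators
  are limits of continuous functions of the distance to the set.\<close>

lemma approximable_indicator:
  assumes "B \<in> sets borel"
  shows "approximable M (indicator B)"
proof -
  have "Int_stable (Collect closed)" by (auto simp: Int_stable_def)
  moreover have "Collect closed \<subseteq> Pow UNIV" by auto
  moreover have "B \<in> sigma_sets UNIV (Collect closed)"
    using assms by (simp add: borel_eq_closed)
  ultimately show ?thesis
  proof (induction rule: sigma_sets_induct_disjoint)
    case (basic K)
    then have K: "closed K" by simp
    show ?case
    \<comment> \<open>\<open>infdist\<close> to the empty set is 0 by convention, so the tent
      functions would not converge to the indicator there.\<close>
    proof (cases "K = {}")
      case True
      then show ?thesis by (simp add: approximable_continuous)
    next
      case False
      have "(\<lambda>n. max 0 (1 - real n * infdist y K)) \<longlonglongrightarrow> indicator K y" for y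
      proof (cases "y \<in> K")
        case True
        then show ?thesis by simp
      next
        case y: False
        then have "infdist y K > 0"
          using in_closed_iff_infdist_zero[OF K False] infdist_nonneg[of y K] by (metis less_eq_real_def)
        then have "\<forall>\<^sub>F n in sequentially. 1 / infdist y K \<le> real n"
          using filterlim_real_sequentially unfolding filterlim_at_top by blast
        then have "\<forall>\<^sub>F n in sequentially. max 0 (1 - real n * infdist y K) = 0"
          by eventually_elim (use \<open>infdist y K > 0\<close> in \<open>simp add: field_simps\<close>)
        then show ?thesis using y by (simp add: tendsto_eventually)
      qed
      then show ?thesis
        by (rule approximable_limit[of "\<lambda>n y. max 0 (1 - real n * infdist y K)", rotated])
          (intro approximable_continuous continuous_intros)
    qed
  next
    case empty
    show ?case by (simp add: approximable_continuous)
  next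
    case (compl A)
    have "indicator (UNIV - A) = (\<lambda>y. 1 + (- 1) * indicator A y :: real)"
      by (auto simp: indicator_def)
    then show ?case
      using approximable_add[OF approximable_continuous[OF continuous_on_const] approximable_mult[OF compl.IH]] by (simp only:)
  next
    case (union A)
    have "(\<lambda>n. \<Sum>i<n. indicator (A i) y) \<longlonglongrightarrow> (indicator (\<Union>i. A i) y :: real)" for y
      using indicator_sums[of A y] union.hyps(1) by (auto simp: sums_def disjoint_family_on_def)
    then show ?case
      by (rule approximable_limit[of "\<lambda>n y. \<Sum>i<n. indicator (A i) y", rotated])
        (intro approximable_sum union.IH)
  qed
qed

lemma approximable_measurable:
  fixes g :: "'a \<Rightarrow> real"
  assumes g: "g \<in> borel_measurable borel"
  shows "approximable M g"
proof -
  have nn: "approximable M u" if "u \<in> borel_measurable borel" "\<And>x. 0 \<le> u x" for u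
    using that
  proof (induction rule: borel_measurable_induct_real)
    case (set A)
    then show ?case by (rule approximable_indicator)
  next
    case (mult u c)
    then show ?case by (intro approximable_mult)
  next
    case (add u v)
    then show ?case by (intro approximable_add)
  next
    case (seq U)
    show ?case by (rule approximable_limit[of U]) (use seq in auto)
  qed
  have "g = (\<lambda>y. max 0 (g y) + (- 1) * max 0 (- g y))" by (auto simp: max_def)
  moreover have "approximable M (\<lambda>y. max 0 (g y) + (- 1) * max 0 (- g y))"
    using g by (intro approximable_add approximable_mult nn) auto
  ultimately show ?thesis by simp
qed

text \<open>The tolerances \<open>(1 / 2) ^ n\<close> are summable, so by Borel-Cantelli almost
  every point violates only finitely many of them.\<close>

lemma continuous_AE_approximation:
  fixes g :: "'a \<Rightarrow> real"
  assumes g [measurable]: "g \<in> borel_measurable borel"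
  obtains \<phi> where "\<And>n. continuous_on UNIV (\<phi> n)" "AE y in M. (\<lambda>n. \<phi> n y) \<longlonglongrightarrow> g y"
proof -
  have "\<forall>n. \<exists>\<phi>. continuous_on UNIV \<phi> \<and> measure M {y. (1 / 2) ^ n \<le> \<bar>g y - \<phi> y\<bar>} \<le> (1 / 2) ^ n"
    using approximable_measurable[OF assms] by (simp add: approximable_def)
  then obtain \<phi> where \<phi>: "\<And>n. continuous_on UNIV (\<phi> n)" "\<And>n. measure M {y. (1 / 2) ^ n \<le> \<bar>g y - \<phi> n y\<bar>} \<le> (1 / 2) ^ n"
    by metis
  have [measurable]: "\<phi> n \<in> borel_measurable borel" for n
    using \<phi>(1) by (rule borel_measurable_continuous_onI)
  let ?A = "\<lambda>n. {y. (1 / 2) ^ n \<le> \<bar>g y - \<phi> n y\<bar>}"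
  have "AE y in M. \<forall>\<^sub>F n in sequentially. y \<in> space M - ?A n"
  proof (rule borel_cantelli_AE1)
    show "?A n \<in> sets M" for n unfolding M by measurable
    show "emeasure M (?A n) < \<infinity>" for n by (simp add: emeasure_eq_measure)
    show "summable (\<lambda>n. measure M (?A n))"
      by (rule summable_comparison_test'[of "\<lambda>n. (1 / 2) ^ n" 0]) (auto simp: \<phi>(2))
  qed
  then have "AE y in M. (\<lambda>n. \<phi> n y) \<longlonglongrightarrow> g y"
  proof eventually_elim
    fix y assume "\<forall>\<^sub>F n in sequentially. y \<in> space M - ?A n"
    then have "\<forall>\<^sub>F n in sequentially. norm (\<phi> n y - g y) \<le> (1 / 2) ^ n"
      by eventually_elim (auto simp: abs_minus_commute)
    moreover have "(\<lambda>n. (1 / 2 :: real) ^ n) \<longlonglongrightarrow> 0" by (rule LIMSEQ_power_zero) simp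
    ultimately have "(\<lambda>n. \<phi> n y - g y) \<longlonglongrightarrow> 0"
      by (rule Lim_null_comparison)
    then show "(\<lambda>n. \<phi> n y) \<longlonglongrightarrow> g y" by (simp add: LIM_zero_iff)
  qed
  with \<phi>(1) show ?thesis by (rule that)
qed

end

text \<open>Fatou's lemma for sets: up to a null set, \<open>A\<close> lies in the increasing union
  of the intersections of the tails of \<open>B\<close>.\<close>

lemma (in finite_measure) measure_le_of_eventually:
  assumes A: "A \<in> sets M" and B: "\<And>n. B n \<in> sets M"
    and AB: "AE x in M. x \<in> A \<longrightarrow> (\<forall>\<^sub>F n in sequentially. x \<in> B n)"
    and le: "\<And>n. measure M (B n) \<le> p"
  shows "measure M A \<le> p"
proof -
  let ?C = "\<lambda>m. (\<Inter>n\<in>{m..}. B n)"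
  have C: "?C m \<in> sets M" for m using B by (intro sets.countable_INT') auto
  have "AE x in M. x \<in> A \<longrightarrow> x \<in> (\<Union>m. ?C m)"
    using AB by eventually_elim (auto simp: eventually_sequentially)
  then have "measure M A \<le> measure M (\<Union>m. ?C m)"
    using C by (intro finite_measure_mono_AE) auto
  also have "(\<lambda>m. measure M (?C m)) \<longlonglongrightarrow> measure M (\<Union>m. ?C m)"
    using C by (intro finite_Lim_measure_incseq) (auto simp: incseq_def)
  then have "measure M (\<Union>m. ?C m) \<le> p"
  proof (rule LIMSEQ_le_const2, intro exI allI impI)
    fix m
    have "measure M (?C m) \<le> measure M (B m)" using B by (intro finite_measure_mono) auto
    then show "measure M (?C m) \<le> p" using le[of m] by simp
  qed
  finally show ?thesis .
qed

section \<open>From rounded to exact answers\<close>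

text \<open>Rounding goes up, so that negative rounded answers never lie below the exact ones; the
  cutoff at \<open>Suc N\<close> in absolute value makes the range finite. The upper cutoff can
  lower an answer, but the result is then positive.\<close>

definition round_answer :: "nat \<Rightarrow> real \<Rightarrow> real" where
  "round_answer N y = max (- real (Suc N)) (min (real (Suc N)) (of_int \<lceil>real (Suc N) * y\<rceil> / real (Suc N)))"

lemma mono_round_answer: "mono (round_answer N)"
  unfolding round_answer_def
  by (intro monoI max.mono min.mono order_refl divide_right_mono) (auto intro!: ceiling_mono mult_left_mono)

lemma finite_range_round_answer: "finite (range (round_answer N))"
proof -
  let ?M = "int (Suc N)"
  have "round_answer N y \<in> (\<lambda>m. of_int m / of_int ?M) ` {- (?M * ?M)..?M * ?M}" for y
  proof -
    define m where "m = max (- (?M * ?M)) (min (?M * ?M) \<lceil>real (Suc N) * y\<rceil>)"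
    have "round_answer N y = of_int m / of_int ?M"
      by (simp add: m_def round_answer_def of_int_max of_int_min max_divide_distrib_right min_divide_distrib_right)
    moreover have "m \<in> {- (?M * ?M)..?M * ?M}" by (auto simp: m_def)
    ultimately show ?thesis by blast
  qed
  then have "range (round_answer N) \<subseteq> (\<lambda>m. of_int m / of_int ?M) ` {- (?M * ?M)..?M * ?M}" by blast
  then show ?thesis by (rule finite_subset) simp
qed

lemma ceiling_divide_bounds:
  "y \<le> of_int \<lceil>real (Suc N) * y\<rceil> / real (Suc N)" "of_int \<lceil>real (Suc N) * y\<rceil> / real (Suc N) \<le> y + 1 / real (Suc N)"
proof -
  have "real (Suc N) * y \<le> of_int \<lceil>real (Suc N) * y\<rceil>" "of_int \<lceil>real (Suc N) * y\<rceil> \<le> real (Suc N) * y + 1"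
    by linarith+
  then show "y \<le> of_int \<lceil>real (Suc N) * y\<rceil> / real (Suc N)" "of_int \<lceil>real (Suc N) * y\<rceil> / real (Suc N) \<le> y + 1 / real (Suc N)"
    by (simp_all add: field_simps del: of_nat_Suc)
qed

lemma round_answer_neg: "round_answer N y < 0 \<Longrightarrow> y \<le> round_answer N y"
  using ceiling_divide_bounds(1)[where y=y and N=N] unfolding round_answer_def by (auto simp: max_def min_def split: if_splits)

text \<open>The argument varies with \<open>N\<close> too, because earlier rounding changes the
  queries and hence the exact values. For large \<open>N\<close> the cutoff is inactive.\<close>

lemma tendsto_round_answer:
  assumes y: "y \<longlonglongrightarrow> l"
  shows "(\<lambda>N. round_answer N (y N)) \<longlonglongrightarrow> l"
proof -
  have "\<forall>\<^sub>F N in sequentially. dist (y N) l < 1" by (rule tendstoD[OF y]) simp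
  moreover have "\<forall>\<^sub>F N in sequentially. \<bar>l\<bar> + 2 \<le> real N"
    using filterlim_real_sequentially unfolding filterlim_at_top by blast
  ultimately have "\<forall>\<^sub>F N in sequentially. norm (round_answer N (y N) - y N) \<le> 1 / real (Suc N)"
  proof eventually_elim
    case (elim N)
    define c where "c = of_int \<lceil>real (Suc N) * y N\<rceil> / real (Suc N)"
    have c: "y N \<le> c" "c \<le> y N + 1 / real (Suc N)"
      using ceiling_divide_bounds[where y="y N" and N=N] by (simp_all add: c_def)
    have "1 / real (Suc N) \<le> 1" by simp
    moreover have "\<bar>y N\<bar> \<le> \<bar>l\<bar> + 1" using elim(1) by (simp add: dist_real_def)
    ultimately have "- real (Suc N) \<le> c" "c \<le> real (Suc N)" using c elim(2) by linarith+
    then have "round_answer N (y N) = c" by (simp add: round_answer_def c_def[symmetric] del: of_nat_Suc)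
    then show ?case using c by simp
  qed
  moreover have "(\<lambda>N. 1 / real (Suc N)) \<longlonglongrightarrow> 0" by (rule lim_1_over_n[THEN LIMSEQ_Suc])
  ultimately have "(\<lambda>N. round_answer N (y N) - y N) \<longlonglongrightarrow> 0" by (rule Lim_null_comparison)
  from tendsto_add[OF this y] show ?thesis by simp
qed

text \<open>Counterpart of \<open>answers\<close> for queries on the whole type
  \<open>nat \<Rightarrow> real\<close>, whose topology and Borel sets are then at hand. The
  argument of \<open>\<pi> t\<close> is \<open>undefined\<close> outside \<open>{1..t - 1}\<close>;
  in particular \<open>\<pi> 1\<close> is applied to a constant.\<close>

primrec observed :: "(nat \<Rightarrow> vec \<Rightarrow> vec) \<Rightarrow> (vec \<Rightarrow> real) \<Rightarrow> (real \<Rightarrow> real) \<Rightarrow> nat \<Rightarrow> vec" where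
  "observed \<pi> f r 0 = (\<lambda>_. undefined)"
| "observed \<pi> f r (Suc t) = (observed \<pi> f r t)(Suc t := r (f (\<pi> (Suc t) (observed \<pi> f r t))))"

fun answer_vec :: "real list \<Rightarrow> vec" where
  "answer_vec [] = (\<lambda>_. undefined)"
| "answer_vec (q # qs) = (answer_vec qs)(Suc (length qs) := q)"

lemma (in rounded_protocol) observed_eq_answer_vec:
  assumes X: "\<And>qs. X qs = \<pi> (Suc (length qs)) (answer_vec qs)"
  shows "observed \<pi> (max_inner d k b) r t = answer_vec (map snd (run b t))" "length (run b t) = t"
  by (induction t) (simp_all add: Let_def X)

lemma tendsto_MAX:
  fixes f :: "'i \<Rightarrow> 'a \<Rightarrow> real"
  assumes "finite I" "I \<noteq> {}" "\<And>i. i \<in> I \<Longrightarrow> (f i \<longlongrightarrow> l i) F"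
  shows "((\<lambda>n. MAX i\<in>I. f i n) \<longlongrightarrow> (MAX i\<in>I. l i)) F"
  using assms
proof (induction I rule: finite_ne_induct)
  case (insert i I)
  then have "((\<lambda>n. max (f i n) (MAX i\<in>I. f i n)) \<longlongrightarrow> max (l i) (MAX i\<in>I. l i)) F"
    by (intro tendsto_max) simp_all
  then show ?case using insert.hyps by simp
qed simp

lemma tendsto_inner_vec:
  assumes "\<And>j. j \<in> {1..d} \<Longrightarrow> ((\<lambda>n. x n j) \<longlongrightarrow> x' j) F" "\<And>j. j \<in> {1..d} \<Longrightarrow> ((\<lambda>n. z n j) \<longlongrightarrow> z' j) F"
  shows "((\<lambda>n. inner_vec d (x n) (z n)) \<longlongrightarrow> inner_vec d x' z') F"
  unfolding inner_vec_def by (intro tendsto_sum tendsto_mult assms)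

lemma tendsto_max_inner:
  assumes "1 \<le> k" "\<And>j. j \<in> {1..d} \<Longrightarrow> ((\<lambda>n. x n j) \<longlongrightarrow> x' j) F"
  shows "((\<lambda>n. max_inner d k b (x n)) \<longlongrightarrow> max_inner d k b x') F"
  unfolding max_inner_def
proof (rule tendsto_MAX)
  show "((\<lambda>n. inner_vec d (b i) (x n)) \<longlongrightarrow> inner_vec d (b i) x') F" for i
    by (rule tendsto_inner_vec[OF tendsto_const assms(2)])
qed (use assms(1) in auto)

lemma max_inner_measurable:
  assumes x: "\<And>j. j \<in> {1..d} \<Longrightarrow> (\<lambda>b. x b j) \<in> borel_measurable (seed_law d k)"
  shows "(\<lambda>b. max_inner d k b (x b)) \<in> borel_measurable (seed_law d k)"
  unfolding max_inner_def
proof (rule borel_measurable_Max)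
  show "(\<lambda>b. inner_vec d (b i) (x b)) \<in> borel_measurable (seed_law d k)" if "i \<in> {1..k}" for i
    unfolding inner_vec_def
    by (rule borel_measurable_sum) (rule borel_measurable_times[OF entry_measurable[OF that] x])
qed simp

lemma observed_measurable:
  assumes r: "r \<in> borel_measurable borel"
    and \<pi>: "\<And>t j. t \<in> {1..T} \<Longrightarrow> j \<in> {1..d} \<Longrightarrow> (\<lambda>y. \<pi> t y j) \<in> borel_measurable borel"
    and "t \<le> T"
  shows "(\<lambda>b. observed \<pi> (max_inner d k b) r t) \<in> borel_measurable (seed_law d k)"
  using assms(3)
proof (induction t)
  case 0
  then show ?case by simp
next
  case (Suc t)
  then have IH: "(\<lambda>b. observed \<pi> (max_inner d k b) r t) \<in> borel_measurable (seed_law d k)" by simp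
  have "(\<lambda>b. \<pi> (Suc t) (observed \<pi> (max_inner d k b) r t) j) \<in> borel_measurable (seed_law d k)" if "j \<in> {1..d}" for j
    using Suc.prems that by (intro measurable_compose[OF IH \<pi>]) auto
  from max_inner_measurable[OF this]
  have new: "(\<lambda>b. max_inner d k b (\<pi> (Suc t) (observed \<pi> (max_inner d k b) r t))) \<in> borel_measurable (seed_law d k)" .
  have old: "(\<lambda>b. observed \<pi> (max_inner d k b) r t i) \<in> borel_measurable (seed_law d k)" for i
    by (rule measurable_compose[OF IH borel_measurable_continuous_onI[OF continuous_on_product_coordinates]])
  show ?case
  proof (rule measurable_coordinatewise_then_product)
    fix i
    show "(\<lambda>b. observed \<pi> (max_inner d k b) r (Suc t) i) \<in> borel_measurable (seed_law d k)"
    proof (cases "i = Suc t")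
      case True
      show ?thesis unfolding True observed.simps fun_upd_same by (rule measurable_compose[OF new r])
    next
      case False
      show ?thesis unfolding observed.simps fun_upd_other[OF False] by (rule old)
    qed
  qed
qed

definition final_query :: "nat \<Rightarrow> nat \<Rightarrow> (nat \<Rightarrow> vec \<Rightarrow> vec) \<Rightarrow> nat \<Rightarrow> (real \<Rightarrow> real) \<Rightarrow> (nat \<Rightarrow> vec) \<Rightarrow> vec" where
  "final_query d k \<pi> T r b = \<pi> (Suc T) (observed \<pi> (max_inner d k b) r T)"

definition success_event :: "nat \<Rightarrow> nat \<Rightarrow> (nat \<Rightarrow> vec \<Rightarrow> vec) \<Rightarrow> nat \<Rightarrow> (real \<Rightarrow> real) \<Rightarrow> real \<Rightarrow> (nat \<Rightarrow> vec) set" where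
  "success_event d k \<pi> T r s = {b \<in> space (seed_law d k).
     r (max_inner d k b (final_query d k \<pi> T r b)) < - s \<and>
     inner_vec d (final_query d k \<pi> T r b) (final_query d k \<pi> T r b) < 4}"

lemma success_event_measurable:
  assumes [measurable]: "r \<in> borel_measurable borel"
    and \<pi>: "\<And>t j. t \<in> {1..Suc T} \<Longrightarrow> j \<in> {1..d} \<Longrightarrow> (\<lambda>y. \<pi> t y j) \<in> borel_measurable borel"
  shows "success_event d k \<pi> T r s \<in> sets (seed_law d k)"
proof -
  have obs: "(\<lambda>b. observed \<pi> (max_inner d k b) r T) \<in> borel_measurable (seed_law d k)"
    by (rule observed_measurable[where T=T]) (auto intro: \<pi>)
  have x: "(\<lambda>b. final_query d k \<pi> T r b j) \<in> borel_measurable (seed_law d k)" if "j \<in> {1..d}" for j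
    unfolding final_query_def using that by (intro measurable_compose[OF obs \<pi>]) auto
  have "(\<lambda>b. max_inner d k b (final_query d k \<pi> T r b)) \<in> borel_measurable (seed_law d k)"
    by (rule max_inner_measurable[OF x])
  moreover have "(\<lambda>b. inner_vec d (final_query d k \<pi> T r b) (final_query d k \<pi> T r b)) \<in> borel_measurable (seed_law d k)"
    unfolding inner_vec_def by (intro borel_measurable_sum borel_measurable_times x)
  moreover have "{b \<in> space M. r (F b) < - s \<and> G b < 4} \<in> sets M"
    if [measurable]: "F \<in> borel_measurable M" "G \<in> borel_measurable M"
    for F G :: "(nat \<Rightarrow> vec) \<Rightarrow> real" and M
    by measurable
  ultimately show ?thesis unfolding success_event_def by blast
qed

definition success_bound :: "nat \<Rightarrow> nat \<Rightarrow> real \<Rightarrow> real" where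
  "success_bound k T s = 16 * ln (exp_bound k (Suc T)) / (real k * s)\<^sup>2"

lemma prob_success_rounded:
  assumes k: "1 \<le> k" and s: "0 < s" and r: "mono r" "finite (range r)" "\<And>y. r y < 0 \<Longrightarrow> y \<le> r y"
    and \<pi>: "\<And>t j. t \<in> {1..Suc T} \<Longrightarrow> j \<in> {1..d} \<Longrightarrow> (\<lambda>y. \<pi> t y j) \<in> borel_measurable borel"
  shows "measure (seed_law d k) (success_event d k \<pi> T r s) \<le> success_bound k T s"
proof -
  define X where "X qs = \<pi> (Suc (length qs)) (answer_vec qs)" for qs
  interpret rounded_protocol d k X r
    by unfold_locales (rule k r(1) r(2))+
  have "final_query d k \<pi> T r b = X (map snd (run b T))" for b
    by (simp add: final_query_def observed_eq_answer_vec[OF X_def] X_def[of "map snd (run b T)"])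
  then have eq: "success_event d k \<pi> T r s = {b \<in> space P. let x = X (map snd (run b T)) in r (max_inner d k b x) < - s \<and> inner_vec d x x < 4}"
    by (simp add: success_event_def Let_def)
  let ?W = "{b \<in> space P. let x = X (map snd (run b T)) in r (max_inner d k b x) < - s \<and> inner_vec d x x \<le> 4}"
  have W: "?W \<in> sets P"
  proof -
    let ?T = "{\<tau> \<in> transcripts k (range r) (Suc T). snd (hd \<tau>) < - s \<and> inner_vec d (X (map snd (tl \<tau>))) (X (map snd (tl \<tau>))) \<le> 4}"
    have "?W = {b \<in> space P. run b (Suc T) \<in> ?T}"
      using run_in_transcripts[of _ "Suc T"] by (auto simp: Let_def)
    also have "\<dots> = (\<Union>\<tau>\<in>?T. cell \<tau>)"
      using run_in_transcripts[of _ "Suc T"] by (auto simp: cell_def transcripts_def simp del: run.simps)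
    also have "\<dots> \<in> sets P"
      using finite_runs[of "Suc T"] by (intro sets.finite_UN) (auto intro: cell_measurable)
    finally show ?thesis .
  qed
  have "prob (success_event d k \<pi> T r s) \<le> prob ?W"
    unfolding eq Let_def by (rule finite_measure_mono[OF _ W[unfolded Let_def]]) (use less_imp_le in blast)
  also have "prob ?W \<le> success_bound k T s"
  proof -
    have "0 < (real k * s)\<^sup>2" using k s by simp
    moreover have "prob ?W * (real k * s)\<^sup>2 \<le> 16 * ln (exp_bound k (Suc T))"
      by (rule prob_rounded_success[OF r(3) less_imp_le[OF s]])
    ultimately show ?thesis
      unfolding success_bound_def by (simp only: pos_le_divide_eq)
  qed
  finally show ?thesis .
qed

text \<open>Convergence passes from round to round: convergent observations give convergent queries
  by \<open>step\<close>, hence convergent answers. Both conditions of the event are open, so they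
  hold for the approximations from some \<open>N\<close> on. \<open>step\<close> presupposes
  convergent observations so that it covers continuous queries as well as a replaced one.\<close>

lemma success_event_limit:
  assumes k: "1 \<le> k"
    and r: "\<And>y l. y \<longlonglongrightarrow> l \<Longrightarrow> (\<lambda>N. r N (y N)) \<longlonglongrightarrow> l"
    and step: "\<And>t j. t \<in> {1..Suc T} \<Longrightarrow> j \<in> {1..d} \<Longrightarrow>
      (\<lambda>N. observed (\<pi>' N) (max_inner d k b) (r N) (t - 1)) \<longlonglongrightarrow> observed \<pi> (max_inner d k b) (\<lambda>y. y) (t - 1) \<Longrightarrow>
      (\<lambda>N. \<pi>' N t (observed (\<pi>' N) (max_inner d k b) (r N) (t - 1)) j) \<longlonglongrightarrow> \<pi> t (observed \<pi> (max_inner d k b) (\<lambda>y. y) (t - 1)) j"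
    and b: "b \<in> success_event d k \<pi> T (\<lambda>y. y) s"
  shows "\<forall>\<^sub>F N in sequentially. b \<in> success_event d k (\<pi>' N) T (r N) s"
proof -
  let ?f = "max_inner d k b"
  have obs: "t \<le> T \<Longrightarrow> (\<lambda>N. observed (\<pi>' N) ?f (r N) t) \<longlonglongrightarrow> observed \<pi> ?f (\<lambda>y. y) t" for t
  proof (induction t)
    case 0
    then show ?case by simp
  next
    case (Suc t)
    then have IH: "(\<lambda>N. observed (\<pi>' N) ?f (r N) t) \<longlonglongrightarrow> observed \<pi> ?f (\<lambda>y. y) t" by simp
    have "(\<lambda>N. \<pi>' N (Suc t) (observed (\<pi>' N) ?f (r N) t) j) \<longlonglongrightarrow> \<pi> (Suc t) (observed \<pi> ?f (\<lambda>y. y) t) j"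
      if "j \<in> {1..d}" for j
      using step[of "Suc t" j] Suc.prems that IH by simp
    from r[OF tendsto_max_inner[OF k this]]
    have new: "(\<lambda>N. r N (?f (\<pi>' N (Suc t) (observed (\<pi>' N) ?f (r N) t)))) \<longlonglongrightarrow> ?f (\<pi> (Suc t) (observed \<pi> ?f (\<lambda>y. y) t))" .
    have old: "(\<lambda>N. observed (\<pi>' N) ?f (r N) t i) \<longlonglongrightarrow> observed \<pi> ?f (\<lambda>y. y) t i" for i
      using continuous_on_tendsto_compose[OF continuous_on_product_coordinates[of i] IH] by simp
    show ?case
    proof (rule tendsto_coordinatewise)
      fix i
      show "(\<lambda>N. observed (\<pi>' N) ?f (r N) (Suc t) i) \<longlonglongrightarrow> observed \<pi> ?f (\<lambda>y. y) (Suc t) i"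
        using new old by (cases "i = Suc t") simp_all
    qed
  qed
  have x: "(\<lambda>N. final_query d k (\<pi>' N) T (r N) b j) \<longlonglongrightarrow> final_query d k \<pi> T (\<lambda>y. y) b j" if "j \<in> {1..d}" for j
    unfolding final_query_def using step[of "Suc T" j] obs[of T] that by simp
  from b have "?f (final_query d k \<pi> T (\<lambda>y. y) b) < - s"
    by (simp add: success_event_def)
  from order_tendstoD(2)[OF r[OF tendsto_max_inner[OF k x]] this]
  have 1: "\<forall>\<^sub>F N in sequentially. r N (?f (final_query d k (\<pi>' N) T (r N) b)) < - s" by simp
  from b have "inner_vec d (final_query d k \<pi> T (\<lambda>y. y) b) (final_query d k \<pi> T (\<lambda>y. y) b) < 4"
    by (simp add: success_event_def)
  from order_tendstoD(2)[OF tendsto_inner_vec[OF x x] this]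
  have 2: "\<forall>\<^sub>F N in sequentially. inner_vec d (final_query d k (\<pi>' N) T (r N) b) (final_query d k (\<pi>' N) T (r N) b) < 4"
    by simp
  from 1 2 show ?thesis
    by eventually_elim (use b in \<open>simp add: success_event_def\<close>)
qed

text \<open>Induction on the number \<open>m\<close> of leading queries that are only Borel. The
  last of these is approximated: the queries before it are untouched, so the law of what it observes
  is fixed and convergence almost everywhere for that law suffices; the queries after it are already
  continuous and transport the limit. For \<open>m = 0\<close> the limit is taken in the
  rounding.\<close>

lemma prob_success_partially_continuous:
  assumes k: "1 \<le> k" and s: "0 < s" and "m \<le> Suc T"
    and "\<And>t j. t \<in> {1..m} \<Longrightarrow> j \<in> {1..d} \<Longrightarrow> (\<lambda>y. \<pi> t y j) \<in> borel_measurable borel"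
    and "\<And>t j. t \<in> {Suc m..Suc T} \<Longrightarrow> j \<in> {1..d} \<Longrightarrow> continuous_on UNIV (\<lambda>y. \<pi> t y j)"
  shows "measure (seed_law d k) (success_event d k \<pi> T (\<lambda>y. y) s) \<le> success_bound k T s"
  using assms(3-5)
proof (induction m arbitrary: \<pi>)
  case 0
  interpret prob_space "seed_law d k" by (rule prob_space_seed_law)
  have cont: "continuous_on UNIV (\<lambda>y. \<pi> t y j)" if "t \<in> {1..Suc T}" "j \<in> {1..d}" for t j
    using 0 that by simp
  then have meas: "(\<lambda>y. \<pi> t y j) \<in> borel_measurable borel" if "t \<in> {1..Suc T}" "j \<in> {1..d}" for t j
    using that by (intro borel_measurable_continuous_onI)
  show ?case
  proof (rule measure_le_of_eventually)
    show "success_event d k \<pi> T (\<lambda>y. y) s \<in> events"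
      by (rule success_event_measurable[OF _ meas]) auto
    show "success_event d k \<pi> T (round_answer N) s \<in> events" for N
      by (rule success_event_measurable[OF borel_measurable_mono[OF mono_round_answer] meas])
    show "prob (success_event d k \<pi> T (round_answer N) s) \<le> success_bound k T s" for N
      by (rule prob_success_rounded[OF k s mono_round_answer finite_range_round_answer round_answer_neg meas])
    show "AE b in seed_law d k. b \<in> success_event d k \<pi> T (\<lambda>y. y) s \<longrightarrow>
        (\<forall>\<^sub>F N in sequentially. b \<in> success_event d k \<pi> T (round_answer N) s)"
    proof (intro AE_I2 impI)
      fix b assume b: "b \<in> success_event d k \<pi> T (\<lambda>y. y) s"
      show "\<forall>\<^sub>F N in sequentially. b \<in> success_event d k \<pi> T (round_answer N) s"
      proof (rule success_event_limit[OF k tendsto_round_answer _ b])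
        fix t j assume "t \<in> {1..Suc T}" "j \<in> {1..d}"
          "(\<lambda>N. observed \<pi> (max_inner d k b) (round_answer N) (t - 1)) \<longlonglongrightarrow> observed \<pi> (max_inner d k b) (\<lambda>y. y) (t - 1)"
        then show "(\<lambda>N. \<pi> t (observed \<pi> (max_inner d k b) (round_answer N) (t - 1)) j) \<longlonglongrightarrow> \<pi> t (observed \<pi> (max_inner d k b) (\<lambda>y. y) (t - 1)) j"
          using continuous_on_tendsto_compose[OF cont[of t j]] by simp
      qed
    qed
  qed
next
  case (Suc m)
  interpret prob_space "seed_law d k" by (rule prob_space_seed_law)
  have meas: "(\<lambda>y. \<pi> t y j) \<in> borel_measurable borel" if "t \<in> {1..Suc T}" "j \<in> {1..d}" for t j
    using Suc.prems(2,3) that by (cases "t \<le> Suc m") (auto intro!: borel_measurable_continuous_onI)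
  define obs where "obs b = observed \<pi> (max_inner d k b) (\<lambda>y. y) m" for b
  have obs [measurable]: "obs \<in> borel_measurable (seed_law d k)"
    unfolding obs_def using Suc.prems(1) by (intro observed_measurable[where T=m] meas) auto
  \<comment> \<open>The law of the first \<open>m\<close> exact answers, on which query
    \<open>Suc m\<close> acts.\<close>
  interpret nu: prob_space "distr (seed_law d k) borel obs"
    by (rule prob_space_distr[OF obs])
  interpret nu: finite_borel_measure "distr (seed_law d k) borel obs"
    by unfold_locales simp
  have "\<forall>j\<in>{1..d}. \<exists>\<phi>. (\<forall>N. continuous_on UNIV (\<phi> N)) \<and> (AE y in distr (seed_law d k) borel obs. (\<lambda>N. \<phi> N y) \<longlonglongrightarrow> \<pi> (Suc m) y j)"
  proof
    fix j assume "j \<in> {1..d}"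
    then have "(\<lambda>y. \<pi> (Suc m) y j) \<in> borel_measurable borel" using Suc.prems(1) by (intro meas) auto
    from nu.continuous_AE_approximation[OF this]
    show "\<exists>\<phi>. (\<forall>N. continuous_on UNIV (\<phi> N)) \<and> (AE y in distr (seed_law d k) borel obs. (\<lambda>N. \<phi> N y) \<longlonglongrightarrow> \<pi> (Suc m) y j)"
      by blast
  qed
  from bchoice[OF this] obtain \<phi> where \<phi>': "\<forall>j\<in>{1..d}. (\<forall>N. continuous_on UNIV (\<phi> j N)) \<and>
      (AE y in distr (seed_law d k) borel obs. (\<lambda>N. \<phi> j N y) \<longlonglongrightarrow> \<pi> (Suc m) y j)"
    by blast
  have \<phi>: "continuous_on UNIV (\<phi> j N)" "AE y in distr (seed_law d k) borel obs. (\<lambda>N. \<phi> j N y) \<longlonglongrightarrow> \<pi> (Suc m) y j"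
    if "j \<in> {1..d}" for j N
    using bspec[OF \<phi>' that] by blast+
  have AE: "AE b in seed_law d k. \<forall>j\<in>{1..d}. (\<lambda>N. \<phi> j N (obs b)) \<longlonglongrightarrow> \<pi> (Suc m) (obs b) j"
  proof (rule AE_finite_allI)
    fix j assume j: "j \<in> {1..d}"
    show "AE b in seed_law d k. (\<lambda>N. \<phi> j N (obs b)) \<longlonglongrightarrow> \<pi> (Suc m) (obs b) j"
      by (rule AE_distrD[OF obs \<phi>(2)[OF j]])
  qed simp
  define \<pi>' where "\<pi>' N = \<pi>(Suc m := (\<lambda>y j. \<phi> j N y))" for N
  have meas': "(\<lambda>y. \<pi>' N t y j) \<in> borel_measurable borel" if "t \<in> {1..Suc T}" "j \<in> {1..d}" for N t j
    using meas[OF that] \<phi>(1)[OF that(2)] by (auto simp: \<pi>'_def intro: borel_measurable_continuous_onI)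
  show ?case
  proof (rule measure_le_of_eventually)
    show "success_event d k \<pi> T (\<lambda>y. y) s \<in> events"
      by (rule success_event_measurable[OF _ meas]) auto
    show "success_event d k (\<pi>' N) T (\<lambda>y. y) s \<in> events" for N
      by (rule success_event_measurable[OF _ meas']) auto
    show "prob (success_event d k (\<pi>' N) T (\<lambda>y. y) s) \<le> success_bound k T s" for N
    proof (rule Suc.IH)
      show "m \<le> Suc T" using Suc.prems(1) by simp
      show "(\<lambda>y. \<pi>' N t y j) \<in> borel_measurable borel" if "t \<in> {1..m}" "j \<in> {1..d}" for t j
        using meas' that Suc.prems(1) by auto
      show "continuous_on UNIV (\<lambda>y. \<pi>' N t y j)" if "t \<in> {Suc m..Suc T}" "j \<in> {1..d}" for t j
        using Suc.prems(3)[of t j] that \<phi>(1)[OF that(2)] by (cases "t = Suc m") (auto simp: \<pi>'_def)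
    qed
    show "AE b in seed_law d k. b \<in> success_event d k \<pi> T (\<lambda>y. y) s \<longrightarrow>
        (\<forall>\<^sub>F N in sequentially. b \<in> success_event d k (\<pi>' N) T (\<lambda>y. y) s)"
      using AE
    proof (eventually_elim, intro impI)
      fix b assume lim: "\<forall>j\<in>{1..d}. (\<lambda>N. \<phi> j N (obs b)) \<longlonglongrightarrow> \<pi> (Suc m) (obs b) j"
        and b: "b \<in> success_event d k \<pi> T (\<lambda>y. y) s"
      let ?f = "max_inner d k b"
      have same: "t \<le> m \<Longrightarrow> observed (\<pi>' N) ?f (\<lambda>y. y) t = observed \<pi> ?f (\<lambda>y. y) t" for N t
        by (induction t) (simp_all add: \<pi>'_def)
      show "\<forall>\<^sub>F N in sequentially. b \<in> success_event d k (\<pi>' N) T (\<lambda>y. y) s"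
      proof (rule success_event_limit[OF k _ _ b])
        fix t j assume t: "t \<in> {1..Suc T}" and j: "j \<in> {1..d}"
          and conv: "(\<lambda>N. observed (\<pi>' N) ?f (\<lambda>y. y) (t - 1)) \<longlonglongrightarrow> observed \<pi> ?f (\<lambda>y. y) (t - 1)"
        consider "t \<le> m" | "t = Suc m" | "Suc m < t" by linarith
        then show "(\<lambda>N. \<pi>' N t (observed (\<pi>' N) ?f (\<lambda>y. y) (t - 1)) j) \<longlonglongrightarrow> \<pi> t (observed \<pi> ?f (\<lambda>y. y) (t - 1)) j"
        proof cases
          case 1
          then have "\<pi>' N t = \<pi> t" for N by (simp add: \<pi>'_def)
          moreover have "observed (\<pi>' N) ?f (\<lambda>y. y) (t - 1) = observed \<pi> ?f (\<lambda>y. y) (t - 1)" for N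
            using 1 by (intro same) simp
          ultimately show ?thesis by simp
        next
          case 2
          then have "\<pi>' N t y j = \<phi> j N y" for N y by (simp add: \<pi>'_def)
          moreover have "observed (\<pi>' N) ?f (\<lambda>y. y) (t - 1) = obs b" for N
            unfolding obs_def using 2 by (simp add: same)
          moreover have "observed \<pi> ?f (\<lambda>y. y) (t - 1) = obs b"
            using 2 by (simp add: obs_def)
          ultimately show ?thesis using lim j 2 by simp
        next
          case 3
          then have "continuous_on UNIV (\<lambda>y. \<pi> t y j)" using Suc.prems(3)[of t j] t j by simp
          from continuous_on_tendsto_compose[OF this conv] show ?thesis
            using 3 by (simp add: \<pi>'_def)
        qed
      qed
    qed
  qed
qed

lemma prob_success:
  assumes "1 \<le> k" "0 < s"
    and "\<And>t j. t \<in> {1..Suc T} \<Longrightarrow> j \<in> {1..d} \<Longrightarrow> (\<lambda>y. \<pi> t y j) \<in> borel_measurable borel"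
  shows "measure (seed_law d k) (success_event d k \<pi> T (\<lambda>y. y) s) \<le> success_bound k T s"
  using assms by (intro prob_success_partially_continuous[where m="Suc T"]) auto

section \<open>The error of a deterministic algorithm\<close>

lemma hard_function_eq: "1 \<le> k \<Longrightarrow> hard_function d k \<Xi> x = max_inner d k \<Xi> x / sqrt (real d)"
proof -
  assume k: "1 \<le> k"
  have "mono (\<lambda>v. v / sqrt (real d))" by (intro monoI divide_right_mono) auto
  from mono_Max_commute[OF this, of "(\<lambda>i. inner_vec d (\<Xi> i) x) ` {1..k}"]
  show ?thesis
    using k by (simp add: hard_function_def max_inner_def inner_vec_def image_image sum_divide_distrib)
qed

section \<open>The unit ball, a countable dense subset, and the error\<close>

lemma unit_ball_iff: "x \<in> unit_ball d \<longleftrightarrow> x \<in> {1..d} \<rightarrow>\<^sub>E UNIV \<and> inner_vec d x x \<le> 1"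
  unfolding unit_ball_def using L2_set_le_iff_inner_vec[of 1 x d] by simp

lemma inner_vec_restrict [simp]: "inner_vec d y (restrict x {1..d}) = inner_vec d y x"
  "inner_vec d (restrict x {1..d}) y = inner_vec d x y"
  by (auto simp: inner_vec_def intro!: sum.cong)

lemma max_inner_restrict [simp]: "max_inner d k b (restrict x {1..d}) = max_inner d k b x"
  by (simp add: max_inner_def del: One_nat_def)

definition retract_ball :: "nat \<Rightarrow> vec \<Rightarrow> vec" where
  "retract_ball d z = (\<lambda>j\<in>{1..d}. z j / max 1 (sqrt (inner_vec d z z)))"

lemma retract_ball_in: "retract_ball d z \<in> unit_ball d"
proof -
  let ?m = "max 1 (sqrt (inner_vec d z z))"
  have "inner_vec d (retract_ball d z) (retract_ball d z) = inner_vec d z z / ?m\<^sup>2"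
    unfolding retract_ball_def inner_vec_restrict
    by (simp add: inner_vec_def sum_divide_distrib power2_eq_square)
  also have "\<dots> \<le> 1"
  proof -
    have "inner_vec d z z = (sqrt (inner_vec d z z))\<^sup>2" using inner_vec_nonneg[of d z] by simp
    also have "\<dots> \<le> ?m\<^sup>2" using inner_vec_nonneg[of d z] by (intro power_mono) auto
    finally show ?thesis by (simp add: divide_le_eq_1 zero_less_power2)
  qed
  finally show ?thesis by (simp add: unit_ball_iff) (simp add: retract_ball_def)
qed

lemma retract_ball_id: "x \<in> unit_ball d \<Longrightarrow> retract_ball d x = x"
proof -
  assume x: "x \<in> unit_ball d"
  then have "max 1 (sqrt (inner_vec d x x)) = 1" by (simp add: unit_ball_iff)
  then have "retract_ball d x = restrict x {1..d}" by (simp add: retract_ball_def)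
  also have "\<dots> = x" using x unfolding unit_ball_iff by (intro extensional_restrict) (simp add: PiE_def)
  finally show ?thesis .
qed

text \<open>A countable dense subset of the ball. Retracting all rational points, instead of keeping
  those inside, makes boundary points limits in the same way as interior ones.\<close>

definition rational_ball :: "nat \<Rightarrow> vec set" where
  "rational_ball d = retract_ball d ` ({1..d} \<rightarrow>\<^sub>E \<rat>)"

lemma countable_rational_ball: "countable (rational_ball d)"
  unfolding rational_ball_def by (intro countable_image countable_PiE) (auto simp: countable_rat)

lemma ex_rational_sequence: "\<exists>q. (\<forall>n. q n \<in> \<rat>) \<and> q \<longlonglongrightarrow> (x :: real)"
proof -
  have "\<forall>n. \<exists>r\<in>\<rat>. x < r \<and> r < x + 1 / real (Suc n)"
    by (intro allI Rats_dense_in_real) simp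
  then obtain q where q: "\<And>n. q n \<in> \<rat>" "\<And>n. x < q n" "\<And>n. q n < x + 1 / real (Suc n)"
    by metis
  have "(\<lambda>n. x + 1 / real (Suc n)) \<longlonglongrightarrow> x + 0"
    by (intro tendsto_add tendsto_const lim_1_over_n[THEN LIMSEQ_Suc])
  then have lim: "(\<lambda>n. x + 1 / real (Suc n)) \<longlonglongrightarrow> x" by simp
  have "\<forall>\<^sub>F n in sequentially. x \<le> q n" "\<forall>\<^sub>F n in sequentially. q n \<le> x + 1 / real (Suc n)"
    using q(2,3) by (auto intro: always_eventually less_imp_le)
  from tendsto_sandwich[OF this tendsto_const lim] have "q \<longlonglongrightarrow> x" .
  with q(1) show ?thesis by blast
qed

lemma ex_rational_ball_less:
  assumes k: "1 \<le> k" and x: "x \<in> unit_ball d" and less: "max_inner d k b x < a"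
  shows "\<exists>z\<in>rational_ball d. max_inner d k b z < a"
proof -
  have "\<forall>j. \<exists>q. (\<forall>n. q n \<in> \<rat>) \<and> q \<longlonglongrightarrow> x j"
    by (intro allI ex_rational_sequence)
  from choice[OF this] obtain q where q: "\<And>j n. q j n \<in> \<rat>" "\<And>j. q j \<longlonglongrightarrow> x j"
    by blast
  define z where "z n = (\<lambda>j\<in>{1..d}. q j n)" for n
  have z: "(\<lambda>n. z n j) \<longlonglongrightarrow> x j" if "j \<in> {1..d}" for j
    using q(2) that by (simp add: z_def)
  have "(\<lambda>n. retract_ball d (z n) j) \<longlonglongrightarrow> retract_ball d x j" if "j \<in> {1..d}" for j
    using that unfolding retract_ball_def
    by (simp del: One_nat_def) (intro tendsto_divide z tendsto_max tendsto_const tendsto_real_sqrt tendsto_inner_vec; simp)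
  from tendsto_max_inner[OF k this]
  have "(\<lambda>n. max_inner d k b (retract_ball d (z n))) \<longlonglongrightarrow> max_inner d k b x"
    by (simp add: retract_ball_id[OF x])
  from order_tendstoD(2)[OF this less]
  obtain n where "max_inner d k b (retract_ball d (z n)) < a"
    using eventually_happens'[OF sequentially_bot] by blast
  moreover have "z n \<in> {1..d} \<rightarrow>\<^sub>E \<rat>" using q(1) by (simp add: z_def)
  ultimately show ?thesis unfolding rational_ball_def by blast
qed

text \<open>Cauchy-Schwarz for the first vector, whose inner product the maximum dominates.
  Boundedness gives the real infimum in \<open>err\<close> its meaning.\<close>

lemma hard_function_bdd_below:
  assumes k: "1 \<le> k"
  shows "bdd_below (hard_function d k \<Xi> ` unit_ball d)"
proof (rule bdd_belowI2)
  fix x assume "x \<in> unit_ball d"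
  then have x: "inner_vec d x x \<le> 1" by (simp add: unit_ball_iff)
  have "\<bar>inner_vec d (\<Xi> 1) x\<bar> \<le> sqrt (inner_vec d (\<Xi> 1) (\<Xi> 1))"
  proof (rule real_le_rsqrt)
    have "\<bar>inner_vec d (\<Xi> 1) x\<bar>\<^sup>2 \<le> inner_vec d (\<Xi> 1) (\<Xi> 1) * inner_vec d x x"
      using Cauchy_Schwarz_ineq_sum[of "\<Xi> 1" x "{1..d}"] by (simp add: inner_vec_def power2_eq_square)
    also have "\<dots> \<le> inner_vec d (\<Xi> 1) (\<Xi> 1) * 1" by (intro mult_left_mono x inner_vec_nonneg)
    finally show "\<bar>inner_vec d (\<Xi> 1) x\<bar>\<^sup>2 \<le> inner_vec d (\<Xi> 1) (\<Xi> 1)" by simp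
  qed
  moreover have "inner_vec d (\<Xi> 1) x \<le> max_inner d k \<Xi> x"
    unfolding max_inner_def using k by (intro Max_ge) auto
  ultimately have "- sqrt (inner_vec d (\<Xi> 1) (\<Xi> 1)) \<le> max_inner d k \<Xi> x" by linarith
  then show "- sqrt (inner_vec d (\<Xi> 1) (\<Xi> 1)) / sqrt (real d) \<le> hard_function d k \<Xi> x"
    unfolding hard_function_eq[OF k] by (rule divide_right_mono) simp
qed

lemma unit_ball_nonempty: "unit_ball d \<noteq> {}"
  using retract_ball_in[of d "\<lambda>_. 0"] by blast

text \<open>The infimum runs over an uncountable ball; density of the rational points reduces the
  event to countably many inequalities, each measurable in the seed.\<close>

lemma err_gt_iff:
  assumes k: "1 \<le> k" and d: "1 \<le> d"
  shows "c < err d T A (hard_function d k \<Xi>) \<longleftrightarrow>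
    (\<exists>z\<in>rational_ball d. hard_function d k \<Xi> z < hard_function d k \<Xi> (output_point T A (hard_function d k \<Xi>)) - c)"
proof -
  define f where "f = hard_function d k \<Xi>"
  define a where "a = f (output_point T A f) - c"
  have f: "f x < a \<longleftrightarrow> max_inner d k \<Xi> x < a * sqrt (real d)" for x
    using d by (simp add: f_def hard_function_eq[OF k] pos_divide_less_eq)
  have "c < err d T A f \<longleftrightarrow> (INF x\<in>unit_ball d. f x) < a" by (auto simp: err_def a_def)
  also have "\<dots> \<longleftrightarrow> (\<exists>x\<in>unit_ball d. f x < a)"
    unfolding f_def by (rule cINF_less_iff[OF unit_ball_nonempty hard_function_bdd_below[OF k]])
  also have "\<dots> \<longleftrightarrow> (\<exists>z\<in>rational_ball d. f z < a)"
    unfolding f using ex_rational_ball_less[OF k] retract_ball_in by (auto simp: rational_ball_def)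
  finally show ?thesis unfolding a_def f_def .
qed

section \<open>Running an algorithm on unscaled answers\<close>

text \<open>\<open>max_inner\<close> lacks the factor \<open>1 / sqrt d\<close> of the hard function, so the queries rescale the answers.\<close>

definition unscaled_queries :: "nat \<Rightarrow> nat \<Rightarrow> algorithm \<Rightarrow> nat \<Rightarrow> vec \<Rightarrow> vec" where
  "unscaled_queries d T A t y =
    (if t \<le> T then query A t (\<lambda>i\<in>{1..t - 1}. y i / sqrt (real d))
     else final_output A (\<lambda>i\<in>{1..T}. y i / sqrt (real d)))"

text \<open>The restriction reproduces the value \<open>undefined\<close> of \<open>answers\<close>
  outside \<open>{1..t}\<close>, so that the two agree as functions and lie in the space of
  \<open>borel_vec t\<close>.\<close>

lemma answers_eq_observed:
  assumes k: "1 \<le> k" and "t \<le> T"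
  shows "answers A (hard_function d k \<Xi>) t =
    (\<lambda>i\<in>{1..t}. observed (unscaled_queries d T A) (max_inner d k \<Xi>) (\<lambda>y. y) t i / sqrt (real d))"
  using assms(2)
proof (induction t)
  case 0
  then show ?case by (auto simp: restrict_def)
next
  case (Suc t)
  define f where "f = hard_function d k \<Xi>"
  define obs where "obs = observed (unscaled_queries d T A) (max_inner d k \<Xi>) (\<lambda>y. y) t"
  have f: "f x = max_inner d k \<Xi> x / sqrt (real d)" for x
    by (simp add: f_def hard_function_eq[OF k])
  have IH: "answers A f t = (\<lambda>i\<in>{1..t}. obs i / sqrt (real d))"
    using Suc.IH[OF Suc_leD[OF Suc.prems]] unfolding f_def obs_def .
  have q: "unscaled_queries d T A (Suc t) obs = query A (Suc t) (answers A f t)"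
    using Suc.prems by (simp add: unscaled_queries_def IH)
  have "answers A f (Suc t) i = (\<lambda>i\<in>{1..Suc t}. (obs(Suc t := max_inner d k \<Xi> (unscaled_queries d T A (Suc t) obs))) i / sqrt (real d)) i" for i
  proof (cases "i = Suc t")
    case True
    then show ?thesis by (simp add: f q)
  next
    case False
    then show ?thesis by (auto simp: IH restrict_def)
  qed
  then show ?case by (simp add: f_def obs_def fun_eq_iff del: One_nat_def)
qed

lemma output_point_eq:
  assumes k: "1 \<le> k"
  shows "output_point T A (hard_function d k \<Xi>) = final_query d k (unscaled_queries d T A) T (\<lambda>y. y) \<Xi>"
  unfolding output_point_def final_query_def answers_eq_observed[OF k order_refl] by (simp add: unscaled_queries_def)

lemma unscaled_queries_measurable:
  assumes A: "A \<in> det_algorithms d T" and t: "t \<in> {1..Suc T}" and j: "j \<in> {1..d}"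
  shows "(\<lambda>y. unscaled_queries d T A t y j) \<in> borel_measurable borel"
proof -
  have restr: "(\<lambda>y. \<lambda>i\<in>{1..n}. y i / sqrt (real d)) \<in> (borel :: vec measure) \<rightarrow>\<^sub>M borel_vec n" for n
  proof (rule measurable_restrict)
    fix i
    have "(\<lambda>y :: vec. y i) \<in> borel_measurable borel"
      by (intro borel_measurable_continuous_onI continuous_on_product_coordinates)
    then show "(\<lambda>y :: vec. y i / sqrt (real d)) \<in> borel_measurable borel" by measurable
  qed
  have comp: "(\<lambda>y. g (\<lambda>i\<in>{1..n}. y i / sqrt (real d)) j) \<in> borel_measurable (borel :: vec measure)"
    if g: "g \<in> borel_vec n \<rightarrow>\<^sub>M restrict_space (borel_vec d) (unit_ball d)" for g and n
  proof -
    from g have "g \<in> borel_vec n \<rightarrow>\<^sub>M borel_vec d" unfolding measurable_restrict_space2_iff by blast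
    from measurable_compose[OF restr measurable_compose[OF this measurable_component_singleton[OF j]]]
    show ?thesis .
  qed
  consider "t = 1" "t \<le> T" | "t \<in> {2..T}" | "t = Suc T" using t by force
  then show ?thesis
  proof cases
    case 1
    then have "(\<lambda>y. unscaled_queries d T A t y j) = (\<lambda>_. first_query A j)"
      by (simp add: unscaled_queries_def query_def)
    then show ?thesis by simp
  next
    case 2
    then have "next_query A t \<in> borel_vec (t - 1) \<rightarrow>\<^sub>M restrict_space (borel_vec d) (unit_ball d)"
      using A unfolding det_algorithms_def by blast
    from comp[OF this]
    have "(\<lambda>y. next_query A t (\<lambda>i\<in>{1..t - 1}. y i / sqrt (real d)) j) \<in> borel_measurable borel" .
    moreover have "(\<lambda>y. unscaled_queries d T A t y j) = (\<lambda>y. next_query A t (\<lambda>i\<in>{1..t - 1}. y i / sqrt (real d)) j)"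
      using 2 by (simp add: unscaled_queries_def query_def)
    ultimately show ?thesis by (simp only:)
  next
    case 3
    have "final_output A \<in> borel_vec T \<rightarrow>\<^sub>M restrict_space (borel_vec d) (unit_ball d)"
      using A unfolding det_algorithms_def by blast
    from comp[OF this]
    have "(\<lambda>y. final_output A (\<lambda>i\<in>{1..T}. y i / sqrt (real d)) j) \<in> borel_measurable borel" .
    moreover have "(\<lambda>y. unscaled_queries d T A t y j) = (\<lambda>y. final_output A (\<lambda>i\<in>{1..T}. y i / sqrt (real d)) j)"
      using 3 by (simp add: unscaled_queries_def)
    ultimately show ?thesis by (simp only:)
  qed
qed

lemma output_point_in_unit_ball:
  assumes A: "A \<in> det_algorithms d T" and k: "1 \<le> k"
  shows "output_point T A (hard_function d k \<Xi>) \<in> unit_ball d"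
proof -
  have "final_output A \<in> borel_vec T \<rightarrow>\<^sub>M restrict_space (borel_vec d) (unit_ball d)"
    using A unfolding det_algorithms_def by blast
  moreover have "answers A (hard_function d k \<Xi>) T \<in> space (borel_vec T)"
    unfolding answers_eq_observed[OF k order_refl] by (simp add: space_PiM)
  ultimately have "final_output A (answers A (hard_function d k \<Xi>) T) \<in> space (restrict_space (borel_vec d) (unit_ball d))"
    by (rule measurable_space)
  then show ?thesis by (simp add: output_point_def space_restrict_space)
qed

lemma err_event_measurable:
  assumes A: "A \<in> det_algorithms d T" and k: "1 \<le> k" and d: "1 \<le> d"
  shows "{\<Xi> \<in> space (seed_law d k). c < err d T A (hard_function d k \<Xi>)} \<in> sets (seed_law d k)"
proof -
  have obs: "(\<lambda>b. observed (unscaled_queries d T A) (max_inner d k b) (\<lambda>y. y) T) \<in> borel_measurable (seed_law d k)"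
    by (rule observed_measurable[where T=T]) (auto intro!: unscaled_queries_measurable[OF A])
  have "(\<lambda>b. final_query d k (unscaled_queries d T A) T (\<lambda>y. y) b j) \<in> borel_measurable (seed_law d k)" if "j \<in> {1..d}" for j
    unfolding final_query_def using that by (intro measurable_compose[OF obs unscaled_queries_measurable[OF A]]) auto
  from max_inner_measurable[OF this]
  have G: "(\<lambda>b. max_inner d k b (final_query d k (unscaled_queries d T A) T (\<lambda>y. y) b)) \<in> borel_measurable (seed_law d k)" .
  have F: "(\<lambda>b. max_inner d k b z) \<in> borel_measurable (seed_law d k)" for z
    by (rule max_inner_measurable[OF borel_measurable_const])
  have sets: "{b \<in> space M. F b / a < G b / a - c} \<in> sets M"
    if [measurable]: "F \<in> borel_measurable M" "G \<in> borel_measurable M"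
    for F G :: "(nat \<Rightarrow> vec) \<Rightarrow> real" and M a
    by measurable
  have "{\<Xi> \<in> space (seed_law d k). c < err d T A (hard_function d k \<Xi>)} =
      (\<Union>z\<in>rational_ball d. {\<Xi> \<in> space (seed_law d k). max_inner d k \<Xi> z / sqrt (real d) <
        max_inner d k \<Xi> (final_query d k (unscaled_queries d T A) T (\<lambda>y. y) \<Xi>) / sqrt (real d) - c})"
    unfolding err_gt_iff[OF k d] output_point_eq[OF k] unfolding hard_function_eq[OF k] by blast
  also have "\<dots> \<in> sets (seed_law d k)"
    by (intro sets.countable_UN' countable_rational_ball image_subsetI sets[OF F G])
  finally show ?thesis .
qed

text \<open>Origin of the constants: \<open>d \<ge> 160000\<close> gives
  \<open>k \<le> d * k / 160000\<close>, and \<open>T * L \<le> d * k / 480000\<close> gives the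
  same bound for \<open>3 * T * L\<close>, so the logarithm is at most \<open>d * k / 80000\<close>.
  With \<open>(k * s)\<^sup>2 = d * k / 625\<close> the quotient is
  \<open>16 * 625 / 80000 = 1 / 8\<close>.\<close>

lemma success_bound_le:
  assumes k: "1 \<le> k" and d: "160000 \<le> d" and T: "1 \<le> T"
    "real T \<le> 1 / 480000 * (real d * real k / ln (exp 1 * real k))"
  shows "success_bound k T (sqrt (real d / real k) / 25) \<le> 1 / 8"
proof -
  define L where "L = ln (exp 1 * real k)"
  have lnk: "0 \<le> ln (real k)" using k by simp
  have L: "L = 1 + ln (real k)" using k by (simp add: L_def ln_mult)
  then have L1: "1 \<le> L" using lnk by simp
  have TL: "real T * L \<le> real d * real k / 480000"
    using T(2) L1 unfolding L_def[symmetric] by (simp add: field_simps)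
  have "ln (exp_bound k (Suc T)) = real k * ln (4 / 3) + (ln (sqrt 2) + real (Suc T) * (ln (real k) + ln (sqrt 2)))"
  proof -
    have "ln (x * (y * z)) = ln x + (ln y + ln z)" if "0 < x" "0 < y" "0 < z" for x y z :: real
      using that by (simp add: ln_mult)
    from this[of "(4 / 3) ^ k" "sqrt 2" "(real k * sqrt 2) ^ Suc T"] show ?thesis
      unfolding exp_bound_def using k by (simp add: ln_realpow ln_mult del: power_Suc)
  qed
  also have "\<dots> \<le> real k * 1 + (1 * 1 + real (2 * T) * L)"
  proof (intro add_mono mult_mono mult_left_mono)
    have "ln (sqrt 2) \<le> sqrt 2 - 1" by (rule ln_le_minus_one) simp
    also have "\<dots> \<le> 1" using real_le_lsqrt[of 2 2] by simp
    finally have s2: "ln (sqrt 2) \<le> 1" .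
    then show "ln (sqrt 2) \<le> 1 * 1" by simp
    show "ln (real k) + ln (sqrt 2) \<le> L" using s2 L by simp
    show "ln (4 / 3 :: real) \<le> 1" using ln_le_minus_one[of "4 / 3 :: real"] by simp
    show "real (Suc T) \<le> real (2 * T)" using T(1) by simp
    show "0 \<le> ln (real k) + ln (sqrt 2)" using lnk by simp
  qed simp_all
  also have "\<dots> \<le> real k + 3 * (real T * L)"
    using mult_mono[of 1 "real T" 1 L] T(1) L1 by (simp add: mult.commute)
  also have "\<dots> \<le> real d * real k / 80000"
  proof -
    have "160000 * real k \<le> real d * real k" using d by (intro mult_right_mono) auto
    then show ?thesis using TL by simp
  qed
  finally have ln: "ln (exp_bound k (Suc T)) \<le> real d * real k / 80000" .
  have sq: "(real k * (sqrt (real d / real k) / 25))\<^sup>2 = real d * real k / 625"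
    using k by (simp add: power_mult_distrib power_divide) (simp add: power2_eq_square)
  have pos: "0 < real d * real k" using k d by simp
  have "success_bound k T (sqrt (real d / real k) / 25) \<le> 16 * (real d * real k / 80000) / (real d * real k / 625)"
    unfolding success_bound_def sq using ln pos by (intro divide_right_mono mult_left_mono) auto
  also have "\<dots> = 1 / 8" using k d by (simp add: field_simps)
  finally show ?thesis .
qed

text \<open>Two exceptional events have probability at most \<open>1 / 8\<close> each. If the
  minimum is at most \<open>- 1 / (12 * sqrt k)\<close>, an error of at most half that size forces a
  value of at most \<open>- 1 / (24 * sqrt k)\<close> at the output; the slightly smaller
  \<open>1 / 25\<close> in \<open>s\<close> makes the inequality strict.\<close>

lemma prob_err:
  assumes A: "A \<in> det_algorithms d T" and k: "1 \<le> k" "real k \<le> real d / 200" and d: "160000 \<le> d"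
    and T: "1 \<le> T" "real T \<le> 1 / 480000 * (real d * real k / ln (exp 1 * real k))"
  shows "3 / 4 \<le> measure (seed_law d k) {\<Xi> \<in> space (seed_law d k). 1 / 24 / sqrt (real k) < err d T A (hard_function d k \<Xi>)}"
    (is "_ \<le> measure _ ?E")
proof -
  interpret prob_space "seed_law d k" by (rule prob_space_seed_law)
  define s where "s = sqrt (real d / real k) / 25"
  have s: "0 < s" using k d by (simp add: s_def)
  let ?\<pi> = "unscaled_queries d T A"
  let ?S = "success_event d k ?\<pi> T (\<lambda>y. y) s"
  let ?W = "{b \<in> space (seed_law d k). \<not> well_spread d k b}"
  have E: "?E \<in> events" using d by (intro err_event_measurable[OF A k(1)]) simp
  have S: "?S \<in> events" by (rule success_event_measurable[OF _ unscaled_queries_measurable[OF A]]) auto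
  have W: "?W \<in> events" by measurable
  have "prob ?S \<le> success_bound k T s"
    by (rule prob_success[OF k(1) s]) (rule unscaled_queries_measurable[OF A])
  also have "\<dots> \<le> 1 / 8"
    unfolding s_def by (rule success_bound_le[OF k(1) d T])
  finally have pS: "prob ?S \<le> 1 / 8" .
  have pW: "prob ?W \<le> 1 / 8" by (rule prob_not_well_spread[OF k d])
  \<comment> \<open>The inclusion holds only up to a null set, because the norm bound that the
    perceptron uses holds almost surely.\<close>
  have "AE b in seed_law d k. b \<in> space (seed_law d k) - ?E \<longrightarrow> b \<in> ?S \<union> ?W"
    using AE_seed_law_bounded[of k d] AE_space
  proof eventually_elim
    case (elim b)
    let ?f = "hard_function d k b"
    define x where "x = output_point T A ?f"
    have xb: "x \<in> unit_ball d" unfolding x_def by (rule output_point_in_unit_ball[OF A k(1)])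
    show ?case
    proof
      assume b: "b \<in> space (seed_law d k) - ?E"
      show "b \<in> ?S \<union> ?W"
      proof (cases "well_spread d k b")
        case True
        obtain z where z: "inner_vec d z z \<le> 1" "\<And>i. i \<in> {1..k} \<Longrightarrow> inner_vec d (b i) z \<le> - (sqrt (real d / real k) / 12)"
          using perceptron[of d k b] True elim(1) k(1) d unfolding well_spread_def by auto
        define w where "w = restrict z {1..d}"
        have w: "w \<in> unit_ball d" using z(1) by (simp add: unit_ball_iff w_def del: One_nat_def)
        have "max_inner d k b w \<le> - (sqrt (real d / real k) / 12)"
          unfolding w_def max_inner_restrict unfolding max_inner_def using z(2) k(1) by (intro Max.boundedI) auto
        then have "?f w \<le> - (sqrt (real d / real k) / 12) / sqrt (real d)"
          unfolding hard_function_eq[OF k(1)] by (rule divide_right_mono) simp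
        also have "\<dots> = - (1 / 12 / sqrt (real k))"
          using d k by (simp add: real_sqrt_divide)
        finally have fw: "?f w \<le> - (1 / 12 / sqrt (real k))" .
        have "(INF x\<in>unit_ball d. ?f x) \<le> ?f w"
          by (rule cINF_lower[OF hard_function_bdd_below[OF k(1)] w])
        moreover have "?f x - (INF x\<in>unit_ball d. ?f x) \<le> 1 / 24 / sqrt (real k)"
          using b by (auto simp: err_def x_def not_less)
        ultimately have "?f x \<le> - (1 / 24 / sqrt (real k))" using fw by simp
        then have "max_inner d k b x \<le> - (1 / 24 / sqrt (real k)) * sqrt (real d)"
          using d unfolding hard_function_eq[OF k(1)] by (simp add: field_simps)
        also have "\<dots> = - (sqrt (real d / real k) / 24)" by (simp add: real_sqrt_divide)
        also have "\<dots> < - s" using s by (simp add: s_def)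
        finally have "max_inner d k b x < - s" .
        moreover have "x = final_query d k ?\<pi> T (\<lambda>y. y) b"
          unfolding x_def by (rule output_point_eq[OF k(1)])
        moreover have "inner_vec d x x < 4" using xb by (simp add: unit_ball_iff)
        ultimately show ?thesis using elim(2) by (simp add: success_event_def)
      next
        case False
        then show ?thesis using b by simp
      qed
    qed
  qed
  then have "prob (space (seed_law d k) - ?E) \<le> prob (?S \<union> ?W)"
    by (rule finite_measure_mono_AE[OF _ sets.Un[OF S W]])
  also have "\<dots> \<le> prob ?S + prob ?W"
    by (rule measure_Un_le[OF S W])
  finally have "1 - prob ?E \<le> prob ?S + prob ?W"
    unfolding prob_compl[OF E] .
  then show ?thesis using pS pW by linarith
qed

theorem theorem5:
  shows "\<exists>c_dim > (0::real). \<exists>c_prob > (0::real). \<exists>c_err > (0::real). \<exists>d0 \<ge> (1::nat).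
    \<forall>d \<ge> d0. \<forall>k::nat. 1 \<le> k \<and> real k \<le> c_dim * real d \<longrightarrow>
      (\<forall>T::nat. 1 \<le> T \<and> real T \<le> c_prob * (real d * real k / ln (exp 1 * real k)) \<longrightarrow>
        (\<forall>A \<in> det_algorithms d T.
          \<P>(\<Xi> in seed_law d k. err d T A (hard_function d k \<Xi>) > c_err / sqrt (real k)) \<ge> 3 / 4))"
proof (intro exI conjI allI impI ballI)
  fix d k T :: nat and A
  assume "160000 \<le> d" "1 \<le> k \<and> real k \<le> 1 / 200 * real d"
    "1 \<le> T \<and> real T \<le> 1 / 480000 * (real d * real k / ln (exp 1 * real k))" "A \<in> det_algorithms d T"
  then show "\<P>(\<Xi> in seed_law d k. err d T A (hard_function d k \<Xi>) > 1 / 24 / sqrt (real k)) \<ge> 3 / 4"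
    by (intro prob_err) auto
qed auto

end
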